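(* Let $P$ and $Q$ be finite posets and let $s$ be the number of connected components of $P$. Then \[ \operatorname{reg} \mathbb{K}[P,Q] \geq \mathfrak{a}(Q)\cdot (|P|-s)+s-1. \] If, in addition, $s=1$ and $Q$ contains $a_k$ antichains of cardinality $k$, then \[\beta_{k, k|P|}^{S_{P,Q}}(\mathbb{K}[P,Q]) \geq a_k.\]
   Context: All posets are finite and nonempty; $\mathbb{K}$ is an arbitrary field. $\operatorname{Hom}(P,Q)$ is the set of order-preserving maps $P\to Q$. $S_{P,Q}=\mathbb{K}[x_{p,q} : p\in P, q\in Q]$, $u_\phi=\prod_{p\in P}x_{p,\phi(p)}$, $L(P,Q)=(u_\phi : \phi\in \operatorname{Hom}(P,Q))\subseteq S_{P,Q}$ and $\mathbb{K}[P,Q]=S_{P,Q}/L(P,Q)$. Connected components of a poset are those of its Hasse diagram. An antichain is a set of pairwise incomparable elements, and $\mathfrak{a}(Q)$ is the maximal cardinality of an antichain in $Q$. $\beta^{S}_{i,j}(R)=\dim_{\mathbb K}\operatorname{Tor}_i^{S}(R,\mathbb{K})_j$ are the graded Betti numbers (all variables of degree 1), and $\operatorname{reg} R=\max\{j-i : \beta^S_{i,j}(R)\ne0\}$. *)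

theory Defs
  imports
    Complex_Main
    "HOL-Library.Poly_Mapping"
    "HOL-Library.Function_Algebras"
    "HOL-Library.Cardinality"
begin

section \<open>Posets\<close>

text \<open>
  A finite nonempty poset is a type of class \<open>{finite, order}\<close>; then \<open>Hom(P,Q)\<close> is
  \<open>{\<phi>. mono \<phi>}\<close>.
\<close>

definition hasse :: "('a::order \<times> 'a) set" where
  "hasse = {(x, y). x < y \<and> \<not> (\<exists>z. x < z \<and> z < y)}"

definition poset_components :: "'a::order set set" where
  "poset_components = UNIV // (hasse \<union> hasse\<inverse>)\<^sup>*"

definition antichain :: "'a::order set \<Rightarrow> bool" where
  "antichain A \<longleftrightarrow> (\<forall>x\<in>A. \<forall>y\<in>A. x \<noteq> y \<longrightarrow> \<not> x \<le> y \<and> \<not> y \<le> x)"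

definition antichain_number :: "'a::{finite,order} itself \<Rightarrow> nat" where
  "antichain_number _ = Max {card A | A :: 'a set. antichain A}"


section \<open>Polynomials and the ideal \<open>L(P,Q)\<close>\<close>

type_synonym 'v monomial = "'v \<Rightarrow>\<^sub>0 nat"
type_synonym ('v, 'k) mpoly = "'v monomial \<Rightarrow>\<^sub>0 'k"

definition var :: "'v \<Rightarrow> ('v, 'k::comm_ring_1) mpoly" where
  "var v = Poly_Mapping.single (Poly_Mapping.single v 1) 1"

definition monomial_degree :: "'v monomial \<Rightarrow> nat" where
  "monomial_degree m = (\<Sum>v\<in>Poly_Mapping.keys m. Poly_Mapping.lookup m v)"

interpretation ideal: module "(*) :: 'a::comm_ring_1 \<Rightarrow> 'a \<Rightarrow> 'a"
  by unfold_locales (simp_all add: distrib_left distrib_right mult.assoc)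

definition hom_monomial :: "('p::finite \<Rightarrow> 'q) \<Rightarrow> ('p \<times> 'q, 'k::comm_ring_1) mpoly" where
  "hom_monomial \<phi> = (\<Prod>p\<in>UNIV. var (p, \<phi> p))"

definition hom_ideal ::
  "('p::{finite,order} \<times> 'q::{finite,order}, 'k::field) mpoly set" where
  "hom_ideal = ideal.span (hom_monomial ` {\<phi> :: 'p \<Rightarrow> 'q. mono \<phi>})"


section \<open>Graded free resolutions\<close>

text \<open>
  The free module \<open>R\<^sup>n\<close> is the set of functions on \<open>nat\<close> that vanish from \<open>n\<close> on.
\<close>

definition vecs :: "nat \<Rightarrow> (nat \<Rightarrow> 'r::zero) set" where
  "vecs n = {v. \<forall>a\<ge>n. v a = 0}"

text \<open>
  The data of an augmented complex
  \<open>\<dots> \<rightarrow> F\<^sub>2 \<rightarrow> F\<^sub>1 \<rightarrow> F\<^sub>0 \<rightarrow> S/I\<close> of finitely generated graded free modules over the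
  polynomial ring \<open>S\<close>:
  \<open>F\<^sub>i\<close> has basis \<open>e\<^sub>0, \<dots>, e\<^bsub>rk i - 1\<^esub>\<close> with \<open>e\<^sub>a\<close> of degree \<open>dg i a\<close>; \<open>dif i a b\<close> is the
  coefficient of \<open>e\<^sub>b \<in> F\<^sub>i\<close> in the image of \<open>e\<^sub>a \<in> F\<^bsub>i+1\<^esub>\<close>; and \<open>e\<^sub>a \<in> F\<^sub>0\<close> is sent to the residue
  class of \<open>aug a\<close> in \<open>S/I\<close>.
\<close>

record (overloaded) ('v, 'k) free_complex =
  rk :: "nat \<Rightarrow> nat"
  dg :: "nat \<Rightarrow> nat \<Rightarrow> int"
  dif :: "nat \<Rightarrow> nat \<Rightarrow> nat \<Rightarrow> ('v, 'k) mpoly"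
  aug :: "nat \<Rightarrow> ('v, 'k) mpoly"

definition dif_map ::
  "('v, 'k::field) free_complex \<Rightarrow> nat \<Rightarrow> (nat \<Rightarrow> ('v, 'k) mpoly) \<Rightarrow> nat \<Rightarrow> ('v, 'k) mpoly" where
  "dif_map F i v = (\<lambda>b. if b < rk F i then \<Sum>a<rk F (Suc i). v a * dif F i a b else 0)"

definition aug_map ::
  "('v, 'k::field) free_complex \<Rightarrow> (nat \<Rightarrow> ('v, 'k) mpoly) \<Rightarrow> ('v, 'k) mpoly" where
  "aug_map F v = (\<Sum>a<rk F 0. v a * aug F a)"

text \<open>
  \<open>F\<close> is a graded free resolution of \<open>S/I\<close>: the maps are homogeneous of degree 0, and the augmented
  complex is exact at \<open>S/I\<close>, at \<open>F\<^sub>0\<close> and at every \<open>F\<^bsub>i+1\<^esub>\<close>.  Equality in \<open>S/I\<close> is congruence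
  modulo \<open>I\<close>.
\<close>

definition graded_free_resolution ::
  "('v, 'k::field) mpoly set \<Rightarrow> ('v, 'k) free_complex \<Rightarrow> bool" where
  "graded_free_resolution I F \<longleftrightarrow>
     (\<forall>i. \<forall>a<rk F (Suc i). \<forall>b<rk F i. \<forall>m\<in>Poly_Mapping.keys (dif F i a b).
        int (monomial_degree m) + dg F i b = dg F (Suc i) a) \<and>
     (\<forall>a<rk F 0. \<forall>m\<in>Poly_Mapping.keys (aug F a). int (monomial_degree m) = dg F 0 a) \<and>
     (\<forall>f. \<exists>v\<in>vecs (rk F 0). f - aug_map F v \<in> I) \<and>
     {v \<in> vecs (rk F 0). aug_map F v \<in> I} = dif_map F 0 ` vecs (rk F 1) \<and>
     (\<forall>i. {v \<in> vecs (rk F (Suc i)). dif_map F i v = 0} =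
          dif_map F (Suc i) ` vecs (rk F (Suc (Suc i))))"


section \<open>Tor, graded Betti numbers and regularity\<close>

text \<open>
  \<open>K\<close> is the \<open>S\<close>-module \<open>S/(all variables)\<close>, so \<open>S\<^sup>n \<otimes>\<^sub>S K = K\<^sup>n\<close> and a matrix over \<open>S\<close> induces
  the matrix of its constant coefficients.
\<close>

definition tensor_map ::
  "('v, 'k::field) free_complex \<Rightarrow> nat \<Rightarrow> (nat \<Rightarrow> 'k) \<Rightarrow> nat \<Rightarrow> 'k" where
  "tensor_map F i v =
     (\<lambda>b. if b < rk F i then \<Sum>a<rk F (Suc i). v a * Poly_Mapping.lookup (dif F i a b) 0 else 0)"

definition tensor_component ::
  "('v, 'k::field) free_complex \<Rightarrow> nat \<Rightarrow> int \<Rightarrow> (nat \<Rightarrow> 'k) set" where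
  "tensor_component F i j = {v \<in> vecs (rk F i). \<forall>a. v a \<noteq> 0 \<longrightarrow> dg F i a = j}"

definition tor_cycles ::
  "('v, 'k::field) free_complex \<Rightarrow> nat \<Rightarrow> int \<Rightarrow> (nat \<Rightarrow> 'k) set" where
  "tor_cycles F i j =
     {v \<in> tensor_component F i j. case i of 0 \<Rightarrow> True | Suc i' \<Rightarrow> tensor_map F i' v = 0}"

definition tor_boundaries ::
  "('v, 'k::field) free_complex \<Rightarrow> nat \<Rightarrow> int \<Rightarrow> (nat \<Rightarrow> 'k) set" where
  "tor_boundaries F i j = tensor_map F i ` tensor_component F (Suc i) j"

definition scale_vec :: "'k::field \<Rightarrow> (nat \<Rightarrow> 'k) \<Rightarrow> nat \<Rightarrow> 'k" where
  "scale_vec c v = (\<lambda>a. c * v a)"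

interpretation coeff: vector_space scale_vec
  by unfold_locales
    (rule ext; simp only: scale_vec_def plus_fun_apply distrib_left distrib_right mult.assoc mult_1_left)+

text \<open>
  \<open>\<beta>\<^bsub>i,j\<^esub>(S/I) = dim Tor\<^sub>i(S/I, K)\<^sub>j\<close> for a homogeneous ideal \<open>I\<close> (in finitely many variables),
  where Tor is computed from a chosen graded free resolution of \<open>S/I\<close>; the dimension does not depend
  on the choice.  As the boundaries are a subspace of the cycles and both are finite-dimensional,
  the dimension of the homology is the difference of the two dimensions.
\<close>

definition betti_quotient :: "('v, 'k::field) mpoly set \<Rightarrow> nat \<Rightarrow> int \<Rightarrow> nat" where
  "betti_quotient I i j =
     (let F = SOME F. graded_free_resolution I F
      in coeff.dim (tor_cycles F i j) - coeff.dim (tor_boundaries F i j))"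

definition reg_quotient :: "('v, 'k::field) mpoly set \<Rightarrow> int" where
  "reg_quotient I = Max {j - int i | i j. betti_quotient I i j \<noteq> 0}"

end

theory Submission
  imports Defs
begin

text \<open>
  Betti numbers may be computed from any graded resolution, in particular from the Taylor
  resolution \<open>T\<close> of \<open>S/L(P,Q)\<close>.  The complex \<open>T \<otimes> K\<close> splits by multidegree.  Let \<open>A \<subseteq> Q\<close> be an
  antichain with \<open>k > 0\<close> elements and consider the multidegree \<open>\<Prod>\<^sub>p \<Prod>\<^sub>a x\<^bsub>p,a\<^esub>\<close> with \<open>p \<in> P\<close>,
  \<open>a \<in> A\<close>.  The homomorphisms \<open>P \<rightarrow> A\<close> are constant on components, hence they are the vertices of a
  product of \<open>s\<close> simplices of dimension \<open>k - 1\<close>, and a set of them has this least common multiple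
  iff it lies in no facet of the product.  The staircase triangulation of the product yields a
  relative cycle of dimension \<open>s (k - 1)\<close>, which pairs to \<open>\<plusminus>1\<close> with the product cocycle.  This gives a
  nonzero class in homological degree \<open>s (k - 1) + 1\<close> and degree \<open>k |P|\<close>.  Classes of different
  antichains have different multidegrees.
\<close>

text \<open>As a rewrite rule it loops together with associativity of multiplication.\<close>
declare ideal.scale_scale [simp del]

section \<open>Dimension of a quotient\<close>

text \<open>Only a lower bound is wanted, so no homology group is computed: a cycle that pairs
  nontrivially with a cocycle is no boundary, because the differential of
  \<open>T \<otimes> K\<close> is adjoint to the coboundary. Cycle and cocycle have integer
  coefficients and their pairing is a unit of the integers, so one construction serves every field.
  In a fixed multidegree only the sets with exactly that lcm survive in
  \<open>T \<otimes> K\<close>; faces with a smaller lcm drop out, which is why a relative cycle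
  suffices. The complex consists of all vertex sets and not only of the simplices of the
  triangulation, and its signs come from the numbering of the generators. The staircase cells and
  the cup product fit these signs only if paths are increasing in the numbering; this is the reason
  for ordering the homomorphisms by a weight that grows with every coordinate. The bound for the
  regularity is degree minus homological degree,
  \<open>k |P| - s (k - 1) - 1 = k (|P| - s) + s - 1\<close>, with \<open>k\<close> the antichain
  number; for \<open>s = 1\<close> the homological degree \<open>(k - 1) + 1\<close> is
  \<open>k\<close>.\<close>

context vector_space
begin

text \<open>A basis \<open>D\<close> of \<open>B\<close> extends to a basis \<open>E\<close> of
  \<open>Z\<close>, and \<open>E - D\<close> is independent modulo \<open>B\<close>. With the next
  lemma this handles the dimension of \<open>Z / B\<close> without forming the quotient.\<close>

lemma obtain_independent_modulo:
  assumes "subspace B" "B \<subseteq> Z" "Z \<subseteq> span W" "finite W"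
  obtains C where "finite C" "C \<subseteq> Z" "card C = dim Z - dim B"
    "\<And>u. (\<Sum>c\<in>C. u c *s c) \<in> B \<Longrightarrow> \<forall>c\<in>C. u c = 0"
proof -
  obtain D where D: "D \<subseteq> B" "independent D" "B \<subseteq> span D"
    using maximal_independent_subset by blast
  obtain E where E: "D \<subseteq> E" "E \<subseteq> Z" "independent E" "Z \<subseteq> span E"
    using maximal_independent_subset_extend[of D Z] D assms(2) by blast
  have finE: "finite E"
    using independent_span_bound[of W E] assms E by blast
  then have finD: "finite D" using E finite_subset by blast
  show ?thesis
  proof (rule that[of "E - D"])
    have "dim B = card D" "dim Z = card E"
      using D E by (auto intro: dim_unique)
    then show "card (E - D) = dim Z - dim B"
      using E finD by (simp add: card_Diff_subset)
    fix u assume "(\<Sum>c\<in>E - D. u c *s c) \<in> B"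
    then obtain v where v: "(\<Sum>c\<in>E - D. u c *s c) = (\<Sum>d\<in>D. v d *s d)"
      using D(3) span_finite[OF finD] by auto
    define w where "w = (\<lambda>c. if c \<in> D then - v c else u c)"
    have "(\<Sum>c\<in>E. w c *s c) = (\<Sum>c\<in>E - D. w c *s c) + (\<Sum>c\<in>D. w c *s c)"
      using sum.subset_diff[OF E(1) finE] .
    also have "(\<Sum>c\<in>E - D. w c *s c) = (\<Sum>c\<in>E - D. u c *s c)"
      by (rule sum.cong) (auto simp: w_def)
    also have "(\<Sum>c\<in>D. w c *s c) = - (\<Sum>c\<in>D. v c *s c)"
      by (simp add: w_def sum_negf)
    finally have "(\<Sum>c\<in>E. w c *s c) = 0" using v by simp
    then have "\<forall>c\<in>E. w c = 0"
      using E(3) finE unfolding independent_explicit_finite_subsets by blast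
    then show "\<forall>c\<in>E - D. u c = 0" by (auto simp: w_def)
  qed (use E finE in auto)
qed

text \<open>A basis of \<open>B\<close> together with the vectors \<open>z j\<close> is still
  independent, so its size is at most \<open>dim Z\<close>.\<close>

lemma card_le_dim_diff:
  assumes "subspace B" "B \<subseteq> Z" "Z \<subseteq> span W" "finite W" "finite J" "\<And>j. j \<in> J \<Longrightarrow> z j \<in> Z"
    and indep: "\<And>u. (\<Sum>j\<in>J. u j *s z j) \<in> B \<Longrightarrow> \<forall>j\<in>J. u j = 0"
  shows "card J \<le> dim Z - dim B"
proof -
  obtain D where D: "D \<subseteq> B" "independent D" "B \<subseteq> span D"
    using maximal_independent_subset by blast
  obtain E where E: "E \<subseteq> Z" "independent E" "Z \<subseteq> span E"
    using maximal_independent_subset[of Z] by blast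
  have finE: "finite E"
    using independent_span_bound[of W E] assms E by blast
  have spanD: "span D \<subseteq> B" using D(1) assms(1) span_minimal by blast
  have zB: "z j \<notin> B" if "j \<in> J" for j
  proof
    assume "z j \<in> B"
    then have "(\<Sum>i\<in>J. (if i = j then 1 else 0) *s z i) \<in> B"
      using that assms(5) by (simp add: if_distrib[of "\<lambda>c. c *s _"] sum.delta' cong: if_cong)
    from indep[OF this] that show False by auto
  qed
  have inj: "inj_on z J"
  proof
    fix i j assume ij: "i \<in> J" "j \<in> J" "z i = z j"
    show "i = j"
    proof (rule ccontr)
      assume "i \<noteq> j"
      have "(\<Sum>l\<in>J. ((if l = i then 1 else 0) - (if l = j then 1 else 0)) *s z l) = z i - z j"
        using ij assms(5)
        by (simp add: scale_left_diff_distrib sum_subtractf if_distrib[of "\<lambda>c. c *s _"] sum.delta' cong: if_cong)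
      then have "(\<Sum>l\<in>J. ((if l = i then 1 else 0) - (if l = j then 1 else 0)) *s z l) \<in> B"
        using ij subspace_0[OF assms(1)] by simp
      from indep[OF this] ij \<open>i \<noteq> j\<close> show False by auto
    qed
  qed
  have disj: "z ` J \<inter> D = {}" using zB D(1) by auto
  have D_Z: "D \<subseteq> span E" using D(1) assms(2) E(3) by blast
  have finD: "finite D" using independent_span_bound[OF finE D(2) D_Z] by blast
  have "independent (z ` J \<union> D)"
  proof (rule independent_if_scalars_zero)
    fix f x assume "(\<Sum>x\<in>z ` J \<union> D. f x *s x) = 0" and x: "x \<in> z ` J \<union> D"
    then have 0: "(\<Sum>j\<in>J. f (z j) *s z j) + (\<Sum>d\<in>D. f d *s d) = 0"
      using disj assms(5) finD inj by (simp add: sum.union_disjoint sum.reindex)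
    have "(\<Sum>d\<in>D. - f d *s d) \<in> B"
      using D(1) assms(1) by (intro subspace_sum subspace_scale) auto
    moreover have "(\<Sum>j\<in>J. f (z j) *s z j) = (\<Sum>d\<in>D. - f d *s d)"
      using 0 by (simp add: sum_negf eq_neg_iff_add_eq_0)
    ultimately have J: "\<forall>j\<in>J. f (z j) = 0" using indep[of "\<lambda>j. f (z j)"] by auto
    then have "(\<Sum>d\<in>D. f d *s d) = 0" using 0 by simp
    then have "\<forall>d\<in>D. f d = 0"
      using D(2) finD unfolding independent_explicit_finite_subsets by blast
    then show "f x = 0" using J x by auto
  qed (use assms finD in auto)
  moreover have "z ` J \<union> D \<subseteq> span E" using D_Z E(3) assms(6) by auto
  ultimately have "card (z ` J \<union> D) \<le> card E" using independent_span_bound[OF finE] by blast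
  moreover have "card (z ` J \<union> D) = card J + card D"
    using disj assms(5) finD inj by (simp add: card_Un_disjoint card_image)
  moreover have "dim B = card D" "dim Z = card E"
    using D E by (auto intro: dim_unique)
  ultimately show ?thesis by simp
qed

end

lemma sum_fun_apply: "sum f A x = (\<Sum>a\<in>A. f a x)"
  by (induction A rule: infinite_finite_induct) auto

lemma vecs_subset_span:
  "\<exists>W. finite W \<and> (vecs n :: (nat \<Rightarrow> 'k::field) set) \<subseteq> coeff.span W"
proof (intro exI conjI subsetI)
  let ?e = "\<lambda>a b. if a = b then 1 else 0 :: 'k"
  fix v :: "nat \<Rightarrow> 'k" assume "v \<in> vecs n"
  then have "v = (\<Sum>a<n. scale_vec (v a) (?e a))"
    by (auto simp: fun_eq_iff sum_fun_apply scale_vec_def vecs_def if_distrib sum.delta cong: if_cong)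
  moreover have "(\<Sum>a<n. scale_vec (v a) (?e a)) \<in> coeff.span (?e ` {..<n})"
    by (intro coeff.span_sum coeff.span_scale coeff.span_base) auto
  ultimately show "v \<in> coeff.span (?e ` {..<n})" by simp
qed simp

section \<open>Coefficients and degrees of polynomials\<close>

lemma mpoly_expand:
  fixes p :: "'a \<Rightarrow>\<^sub>0 'b::comm_monoid_add"
  shows "(\<Sum>m\<in>Poly_Mapping.keys p. Poly_Mapping.single m (Poly_Mapping.lookup p m)) = p"
  by (rule poly_mapping_eqI) (auto simp: lookup_sum lookup_single when_def sum.delta in_keys_iff)

lemma monomial_add_eq_0_iff: "a + b = 0 \<longleftrightarrow> a = 0 \<and> b = (0 :: 'v monomial)"
  by (auto simp: poly_mapping_eq_iff fun_eq_iff lookup_add)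

text \<open>A product of two monomials is \<open>1\<close> only if both are, so taking constant
  coefficients is a ring homomorphism; this is the map \<open>S \<rightarrow> K\<close> that defines
  Tor.\<close>

lemma const_coeff_mult:
  fixes p q :: "('v, 'k::comm_ring_1) mpoly"
  shows "Poly_Mapping.lookup (p * q) 0 = Poly_Mapping.lookup p 0 * Poly_Mapping.lookup q 0"
proof -
  have "p * q = (\<Sum>m\<in>Poly_Mapping.keys p. Poly_Mapping.single m (Poly_Mapping.lookup p m)) *
      (\<Sum>n\<in>Poly_Mapping.keys q. Poly_Mapping.single n (Poly_Mapping.lookup q n))"
    by (simp add: mpoly_expand)
  then have "Poly_Mapping.lookup (p * q) 0 = (\<Sum>m\<in>Poly_Mapping.keys p. \<Sum>n\<in>Poly_Mapping.keys q.
      if m = 0 \<and> n = 0 then Poly_Mapping.lookup p m * Poly_Mapping.lookup q n else 0)"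
    by (simp add: sum_product lookup_sum mult_single lookup_single when_def monomial_add_eq_0_iff
        cong: if_cong)
  also have "\<dots> = (\<Sum>m\<in>Poly_Mapping.keys p. if m = 0 then \<Sum>n\<in>Poly_Mapping.keys q.
      if n = 0 then Poly_Mapping.lookup p m * Poly_Mapping.lookup q n else 0 else 0)"
    by (intro sum.cong) auto
  also have "\<dots> = Poly_Mapping.lookup p 0 * Poly_Mapping.lookup q 0"
    by (auto simp: sum.delta in_keys_iff)
  finally show ?thesis .
qed

lemma monomial_degree_superset:
  "finite V \<Longrightarrow> Poly_Mapping.keys m \<subseteq> V \<Longrightarrow> monomial_degree m = (\<Sum>v\<in>V. Poly_Mapping.lookup m v)"
  unfolding monomial_degree_def by (rule sum.mono_neutral_left) (auto simp: in_keys_iff)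

lemma monomial_degree_add: "monomial_degree (a + b) = monomial_degree a + monomial_degree b"
proof -
  let ?V = "Poly_Mapping.keys a \<union> Poly_Mapping.keys b"
  have "monomial_degree (a + b) = (\<Sum>v\<in>?V. Poly_Mapping.lookup (a + b) v)"
    by (rule monomial_degree_superset) (simp_all add: keys_add)
  also have "\<dots> = monomial_degree a + monomial_degree b"
    by (simp add: lookup_add sum.distrib monomial_degree_superset[of ?V a]
        monomial_degree_superset[of ?V b])
  finally show ?thesis .
qed

text \<open>The degree is an integer because it will be shifted by degrees of basis vectors; for a
  negative degree the part is \<open>0\<close>.\<close>

definition hpart :: "int \<Rightarrow> ('v, 'k::comm_monoid_add) mpoly \<Rightarrow> ('v, 'k) mpoly" where
  "hpart d p = (\<Sum>m\<in>{m \<in> Poly_Mapping.keys p. int (monomial_degree m) = d}.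
     Poly_Mapping.single m (Poly_Mapping.lookup p m))"

lemma lookup_hpart:
  "Poly_Mapping.lookup (hpart d p) m = (if int (monomial_degree m) = d then Poly_Mapping.lookup p m else 0)"
  by (auto simp: hpart_def lookup_sum lookup_single when_def sum.delta in_keys_iff)

lemma hpart_0 [simp]: "hpart d 0 = 0"
  by (rule poly_mapping_eqI) (simp add: lookup_hpart)

lemma hpart_sum: "hpart d (\<Sum>a\<in>A. f a) = (\<Sum>a\<in>A. hpart d (f a))"
  by (rule poly_mapping_eqI) (simp add: lookup_hpart lookup_sum)

lemma hpart_diff: "hpart d (p - q) = hpart d p - hpart d (q :: ('v, 'k::comm_ring_1) mpoly)"
  by (rule poly_mapping_eqI) (simp add: lookup_hpart lookup_minus)

lemma hpart_eq_self:
  "(\<And>m. m \<in> Poly_Mapping.keys p \<Longrightarrow> int (monomial_degree m) = d) \<Longrightarrow> hpart d p = p"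
  by (rule poly_mapping_eqI) (force simp: lookup_hpart in_keys_iff)

lemma degree_of_hpart: "m \<in> Poly_Mapping.keys (hpart d p) \<Longrightarrow> int (monomial_degree m) = d"
  by (auto simp: in_keys_iff lookup_hpart split: if_splits)

lemma hpart_eq_self_iff:
  "hpart d p = p \<longleftrightarrow> (\<forall>m\<in>Poly_Mapping.keys p. int (monomial_degree m) = d)"
  using hpart_eq_self[of p d] degree_of_hpart[of _ d p] by metis

text \<open>Split \<open>p\<close> into its part of degree \<open>d - e\<close> and the rest; the
  rest times \<open>q\<close> has no monomial of degree \<open>d\<close>.\<close>

lemma hpart_mult:
  fixes p q :: "('v, 'k::comm_ring_1) mpoly"
  assumes q: "\<And>m. m \<in> Poly_Mapping.keys q \<Longrightarrow> int (monomial_degree m) = e"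
  shows "hpart d (p * q) = hpart (d - e) p * q"
proof (rule poly_mapping_eqI)
  fix m
  let ?h = "hpart (d - e) p"
  have split: "p * q = ?h * q + (p - ?h) * q" by (simp add: algebra_simps)
  show "Poly_Mapping.lookup (hpart d (p * q)) m = Poly_Mapping.lookup (?h * q) m"
  proof (cases "int (monomial_degree m) = d")
    case True
    have "m \<notin> Poly_Mapping.keys ((p - ?h) * q)"
    proof
      assume "m \<in> Poly_Mapping.keys ((p - ?h) * q)"
      then obtain a b where ab: "m = a + b" "a \<in> Poly_Mapping.keys (p - ?h)" "b \<in> Poly_Mapping.keys q"
        using keys_mult by blast
      then have "int (monomial_degree a) = d - e"
        using True q[of b] by (simp add: monomial_degree_add)
      then show False using ab(2) by (simp add: in_keys_iff lookup_minus lookup_hpart)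
    qed
    then show ?thesis
      using True by (subst split) (simp add: lookup_hpart lookup_add in_keys_iff)
  next
    case False
    have "m \<notin> Poly_Mapping.keys (?h * q)"
    proof
      assume "m \<in> Poly_Mapping.keys (?h * q)"
      then obtain a b where ab: "m = a + b" "a \<in> Poly_Mapping.keys ?h" "b \<in> Poly_Mapping.keys q"
        using keys_mult by blast
      then show False
        using False q[of b] degree_of_hpart[of a "d - e" p] by (simp add: monomial_degree_add)
    qed
    then show ?thesis using False by (simp add: lookup_hpart in_keys_iff)
  qed
qed

section \<open>Linear maps between free modules\<close>

text \<open>\<open>M a\<close> is the image of the \<open>a\<close>-th basis vector.\<close>

definition lin :: "nat \<Rightarrow> (nat \<Rightarrow> nat \<Rightarrow> 'r::comm_ring_1) \<Rightarrow> (nat \<Rightarrow> 'r) \<Rightarrow> nat \<Rightarrow> 'r" where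
  "lin n M v = (\<lambda>b. \<Sum>a<n. v a * M a b)"

lemma lin_0 [simp]: "lin n M 0 = 0"
  by (simp add: lin_def fun_eq_iff)

lemma lin_add: "lin n M (v + w) = lin n M v + lin n M w"
  by (simp add: lin_def fun_eq_iff distrib_right sum.distrib)

lemma lin_diff: "lin n M (v - w) = lin n M v - lin n M w"
  by (simp add: lin_def fun_eq_iff left_diff_distrib sum_subtractf)

lemma lin_add_left: "lin n (\<lambda>a. M a + M' a) v = lin n M v + lin n M' v"
  by (simp add: lin_def fun_eq_iff distrib_left sum.distrib)

lemma lin_diff_left: "lin n (\<lambda>a. M a - M' a) v = lin n M v - lin n M' v"
  by (simp add: lin_def fun_eq_iff right_diff_distrib sum_subtractf)

lemma lin_cong: "(\<And>a. a < n \<Longrightarrow> M a = M' a) \<Longrightarrow> lin n M v = lin n M' v"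
  by (simp add: lin_def)

lemma lin_lin: "lin k N (lin n M v) = lin n (\<lambda>a. lin k N (M a)) v"
proof
  fix b
  have "lin k N (lin n M v) b = (\<Sum>c<k. \<Sum>a<n. v a * M a c * N c b)"
    by (simp add: lin_def sum_distrib_right)
  also have "\<dots> = (\<Sum>a<n. \<Sum>c<k. v a * M a c * N c b)" by (rule sum.swap)
  also have "\<dots> = lin n (\<lambda>a. lin k N (M a)) v b"
    by (simp add: lin_def sum_distrib_left mult.assoc)
  finally show "lin k N (lin n M v) b = lin n (\<lambda>a. lin k N (M a)) v b" .
qed

definition unit_vec :: "nat \<Rightarrow> nat \<Rightarrow> 'r::zero_neq_one" where
  "unit_vec a b = (if a = b then 1 else 0)"

lemma lin_unit_vec: "a < n \<Longrightarrow> lin n M (unit_vec a) = M a"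
  by (auto simp: lin_def unit_vec_def fun_eq_iff if_distrib[of "\<lambda>c. c * _"] sum.delta cong: if_cong)

lemma lin_of_unit_vec: "v \<in> vecs n \<Longrightarrow> lin n unit_vec v = v"
  by (auto simp: lin_def unit_vec_def vecs_def fun_eq_iff if_distrib sum.delta cong: if_cong)

lemma lin_in_vecs: "(\<And>a. a < n \<Longrightarrow> M a \<in> vecs k) \<Longrightarrow> lin n M v \<in> vecs k"
  by (auto simp: lin_def vecs_def)

lemma unit_vec_in_vecs: "a < n \<Longrightarrow> unit_vec a \<in> vecs n"
  by (auto simp: unit_vec_def vecs_def)

lemma vecs_diff: "v \<in> vecs n \<Longrightarrow> w \<in> vecs n \<Longrightarrow> v - w \<in> vecs n"
  for v w :: "nat \<Rightarrow> 'r::group_add"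
  by (auto simp: vecs_def)

text \<open>Component of degree \<open>d\<close> in the graded free module whose basis vector
  \<open>a\<close> has degree \<open>\<alpha> a\<close>.\<close>

definition vpart :: "(nat \<Rightarrow> int) \<Rightarrow> int \<Rightarrow> (nat \<Rightarrow> ('v, 'k::comm_monoid_add) mpoly) \<Rightarrow> nat \<Rightarrow> ('v, 'k) mpoly" where
  "vpart \<alpha> d v = (\<lambda>a. hpart (d - \<alpha> a) (v a))"

text \<open>Homogeneity of degree \<open>0\<close> for a map from the free module with basis degrees
  \<open>\<alpha>\<close> to the one with basis degrees \<open>\<beta>\<close>.\<close>

definition hmat :: "nat \<Rightarrow> (nat \<Rightarrow> int) \<Rightarrow> (nat \<Rightarrow> int) \<Rightarrow> (nat \<Rightarrow> nat \<Rightarrow> ('v, 'k::zero) mpoly) \<Rightarrow> bool" where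
  "hmat n \<alpha> \<beta> M \<longleftrightarrow>
     (\<forall>a<n. \<forall>b. \<forall>m\<in>Poly_Mapping.keys (M a b). int (monomial_degree m) + \<beta> b = \<alpha> a)"

text \<open>The entry \<open>M a b\<close> has degree \<open>\<alpha> a - \<beta> b\<close>, so
  multiplication by it shifts parts accordingly. This lets any lift be replaced by one of its
  homogeneous components.\<close>

lemma vpart_lin:
  fixes M :: "nat \<Rightarrow> nat \<Rightarrow> ('v, 'k::comm_ring_1) mpoly"
  assumes "hmat n \<alpha> \<beta> M"
  shows "vpart \<beta> d (lin n M v) = lin n M (vpart \<alpha> d v)"
proof
  fix b
  have "hpart (d - \<beta> b) (v a * M a b) = hpart (d - \<alpha> a) (v a) * M a b" if "a < n" for a
    using hpart_mult[of "M a b" "\<alpha> a - \<beta> b" "d - \<beta> b" "v a"] assms that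
    by (force simp: hmat_def)
  then show "vpart \<beta> d (lin n M v) b = lin n M (vpart \<alpha> d v) b"
    by (simp add: vpart_def lin_def hpart_sum)
qed

lemma vpart_in_vecs: "v \<in> vecs n \<Longrightarrow> vpart \<alpha> d v \<in> vecs n"
  by (simp add: vecs_def vpart_def)

lemma hmat_iff_vpart: "hmat n \<alpha> \<beta> M \<longleftrightarrow> (\<forall>a<n. vpart \<beta> (\<alpha> a) (M a) = M a)"
  by (simp add: hmat_def vpart_def fun_eq_iff hpart_eq_self_iff eq_diff_eq)

section \<open>Comparison of graded free resolutions\<close>

definition homogeneous_ideal :: "('v, 'k::field) mpoly set \<Rightarrow> bool" where
  "homogeneous_ideal I \<longleftrightarrow> ideal.subspace I \<and> (\<forall>p\<in>I. \<forall>d. hpart d p \<in> I)"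

text \<open>\<open>dif\<close> is arbitrary outside the ranks; padding with \<open>0\<close> makes
  every row an element of \<open>vecs\<close>, so that \<open>lin\<close> applies.\<close>

definition dmat :: "('v, 'k::field) free_complex \<Rightarrow> nat \<Rightarrow> nat \<Rightarrow> nat \<Rightarrow> ('v, 'k) mpoly" where
  "dmat F i a b = (if b < rk F i then dif F i a b else 0)"

text \<open>Index \<open>0\<close> means the kernel of the augmentation modulo \<open>I\<close>;
  thus exactness at every free module becomes the single statement
  \<open>cycles_eq_image\<close>.\<close>

definition cycles :: "('v, 'k::field) mpoly set \<Rightarrow> ('v, 'k) free_complex \<Rightarrow> nat \<Rightarrow> (nat \<Rightarrow> ('v, 'k) mpoly) set" where
  "cycles I F i =
     {v \<in> vecs (rk F i). case i of 0 \<Rightarrow> aug_map F v \<in> I | Suc i' \<Rightarrow> dif_map F i' v = 0}"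

lemma dif_map_eq_lin: "dif_map F i v = lin (rk F (Suc i)) (dmat F i) v"
  by (auto simp: dif_map_def lin_def dmat_def)

lemma dmat_in_vecs: "dmat F i a \<in> vecs (rk F i)"
  by (simp add: dmat_def vecs_def)

lemma dif_map_unit_vec: "a < rk F (Suc i) \<Longrightarrow> dif_map F i (unit_vec a) = dmat F i a"
  by (simp add: dif_map_eq_lin lin_unit_vec)

lemma dif_map_lin: "dif_map F i (lin n M v) = lin n (\<lambda>a. dif_map F i (M a)) v"
  by (simp add: dif_map_eq_lin lin_lin)

lemma dif_map_diff: "dif_map F i (v - w) = dif_map F i v - dif_map F i w"
  by (simp add: dif_map_eq_lin lin_diff)

lemma aug_map_lin: "aug_map F (lin n M v) = (\<Sum>a<n. v a * aug_map F (M a))"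
proof -
  have *: "aug_map F w = lin (rk F 0) (\<lambda>a b. aug F a) w 0" for w
    by (simp add: aug_map_def lin_def)
  show ?thesis by (simp add: * lin_lin) (simp add: lin_def)
qed

lemma aug_map_unit_vec: "a < rk F 0 \<Longrightarrow> aug_map F (unit_vec a) = aug F a"
  by (auto simp: aug_map_def unit_vec_def if_distrib[of "\<lambda>c. c * _"] sum.delta cong: if_cong)

lemma aug_map_diff: "aug_map F (v - w) = aug_map F v - aug_map F w"
  by (simp add: aug_map_def left_diff_distrib sum_subtractf)

context
  fixes I :: "('v, 'k::field) mpoly set"
  assumes I: "homogeneous_ideal I"
begin

lemma ideal_diff: "p \<in> I \<Longrightarrow> q \<in> I \<Longrightarrow> p - q \<in> I"
  using I ideal.subspace_diff unfolding homogeneous_ideal_def by blast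

lemma ideal_add: "p \<in> I \<Longrightarrow> q \<in> I \<Longrightarrow> p + q \<in> I"
  using I ideal.subspace_add unfolding homogeneous_ideal_def by blast

lemma ideal_sum_mult: "(\<And>a. a \<in> A \<Longrightarrow> p a \<in> I) \<Longrightarrow> (\<Sum>a\<in>A. v a * p a) \<in> I"
  using I unfolding homogeneous_ideal_def
  by (intro ideal.subspace_sum ideal.subspace_scale) auto

lemma cycles_eq_image:
  "graded_free_resolution I F \<Longrightarrow> cycles I F i = dif_map F i ` vecs (rk F (Suc i))"
  by (cases i) (simp_all add: graded_free_resolution_def cycles_def)

lemma dmat_in_cycles:
  "graded_free_resolution I F \<Longrightarrow> a < rk F (Suc i) \<Longrightarrow> dmat F i a \<in> cycles I F i"
  using cycles_eq_image[of F i] unit_vec_in_vecs[of a "rk F (Suc i)"] dif_map_unit_vec[of a F i]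
  by (metis imageI)

lemma dif_map_dif_map:
  assumes "graded_free_resolution I F" "v \<in> vecs (rk F (Suc (Suc i)))"
  shows "dif_map F i (dif_map F (Suc i) v) = 0"
proof -
  have "dif_map F (Suc i) v \<in> cycles I F (Suc i)"
    using assms cycles_eq_image by blast
  then show ?thesis by (simp add: cycles_def)
qed

lemma hmat_dmat: "graded_free_resolution I F \<Longrightarrow> hmat (rk F (Suc i)) (dg F (Suc i)) (dg F i) (dmat F i)"
  by (auto simp: graded_free_resolution_def hmat_def dmat_def)

lemma vpart_dif_map:
  assumes "graded_free_resolution I F"
  shows "vpart (dg F i) d (dif_map F i v) = dif_map F i (vpart (dg F (Suc i)) d v)"
  unfolding dif_map_eq_lin by (rule vpart_lin[OF hmat_dmat[OF assms]])

text \<open>Exactness gives a preimage of unknown degrees; its part of degree \<open>d\<close> has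
  the same image because the differential preserves degrees and \<open>w\<close> is
  homogeneous.\<close>

lemma homogeneous_lift:
  assumes "graded_free_resolution I F" "w \<in> cycles I F i" "vpart (dg F i) d w = w"
  obtains v where "v \<in> vecs (rk F (Suc i))" "dif_map F i v = w" "vpart (dg F (Suc i)) d v = v"
proof -
  obtain v where v: "v \<in> vecs (rk F (Suc i))" "dif_map F i v = w"
    using assms(2) cycles_eq_image[OF assms(1)] by auto
  show ?thesis
  proof (rule that)
    show "vpart (dg F (Suc i)) d v \<in> vecs (rk F (Suc i))"
      using v(1) by (rule vpart_in_vecs)
    show "dif_map F i (vpart (dg F (Suc i)) d v) = w"
      using vpart_dif_map[OF assms(1)] v(2) assms(3) by metis
    show "vpart (dg F (Suc i)) d (vpart (dg F (Suc i)) d v) = vpart (dg F (Suc i)) d v"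
      by (auto simp: vpart_def hpart_eq_self_iff degree_of_hpart)
  qed
qed

lemma homogeneous_aug_lift:
  assumes "graded_free_resolution I F" "hpart d p = p"
  obtains v where "v \<in> vecs (rk F 0)" "aug_map F v - p \<in> I" "vpart (dg F 0) d v = v"
proof -
  have "\<exists>v\<in>vecs (rk F 0). p - aug_map F v \<in> I"
    using assms(1) by (simp add: graded_free_resolution_def)
  then obtain v where v: "v \<in> vecs (rk F 0)" "p - aug_map F v \<in> I" ..
  have "hmat (rk F 0) (dg F 0) (\<lambda>_. 0) (\<lambda>a b. aug F a)"
    using assms(1) by (auto simp: graded_free_resolution_def hmat_def)
  from fun_cong[OF vpart_lin[OF this, of d v], of 0]
  have "hpart d (aug_map F v) = aug_map F (vpart (dg F 0) d v)"
    by (simp add: vpart_def lin_def aug_map_def)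
  moreover have "hpart d (p - aug_map F v) \<in> I"
    using v(2) I by (simp add: homogeneous_ideal_def)
  ultimately have "p - aug_map F (vpart (dg F 0) d v) \<in> I"
    by (simp add: hpart_diff assms(2))
  moreover have "0 \<in> I" using I ideal.subspace_0 unfolding homogeneous_ideal_def by blast
  ultimately have "0 - (p - aug_map F (vpart (dg F 0) d v)) \<in> I" by (metis ideal_diff)
  then show ?thesis
    using v(1) by (intro that[of "vpart (dg F 0) d v"] vpart_in_vecs)
      (auto simp: vpart_def hpart_eq_self_iff degree_of_hpart)
qed

section \<open>Existence of lifts of the identity\<close>

text \<open>A lift of the identity of \<open>S/I\<close> of degree \<open>0\<close>:
  \<open>f i a\<close> is the image of the basis vector \<open>e_a\<close>, and the third clause
  says that the augmentations agree modulo \<open>I\<close>.\<close>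

definition chain_map :: "('v, 'k) free_complex \<Rightarrow> ('v, 'k) free_complex \<Rightarrow> (nat \<Rightarrow> nat \<Rightarrow> nat \<Rightarrow> ('v, 'k) mpoly) \<Rightarrow> bool" where
  "chain_map F G f \<longleftrightarrow>
     (\<forall>i. \<forall>a<rk F i. f i a \<in> vecs (rk G i)) \<and>
     (\<forall>i. hmat (rk F i) (dg F i) (dg G i) (f i)) \<and>
     (\<forall>a<rk F 0. aug_map G (f 0 a) - aug F a \<in> I) \<and>
     (\<forall>i. \<forall>a<rk F (Suc i). dif_map G i (f (Suc i) a) = lin (rk F i) (f i) (dmat F i a))"

text \<open>Built degree by degree. The invariant \<open>P\<close> also records that cycles go to
  cycles, since this is what puts the image of \<open>dmat F i a\<close> into the range of the next
  differential of \<open>G\<close>.\<close>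

lemma chain_map_exists:
  assumes F: "graded_free_resolution I F" and G: "graded_free_resolution I G"
  obtains f where "chain_map F G f"
proof -
  define P where "P i M \<longleftrightarrow> (\<forall>a<rk F i. M a \<in> vecs (rk G i)) \<and>
      hmat (rk F i) (dg F i) (dg G i) M \<and>
      (\<forall>v\<in>cycles I F i. lin (rk F i) M v \<in> cycles I G i) \<and>
      (i = 0 \<longrightarrow> (\<forall>a<rk F 0. aug_map G (M a) - aug F a \<in> I))" for i M
  define Q where "Q i M M' \<longleftrightarrow>
      (\<forall>a<rk F (Suc i). dif_map G i (M' a) = lin (rk F i) M (dmat F i a))" for i M M'
  have "\<exists>f. \<forall>n. P n (f n) \<and> Q n (f n) (f (Suc n))"
  proof (rule dependent_nat_choice[of P Q])
    have "\<exists>v. v \<in> vecs (rk G 0) \<and> aug_map G v - aug F a \<in> I \<and> vpart (dg G 0) (dg F 0 a) v = v"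
      if "a < rk F 0" for a
    proof -
      have "hpart (dg F 0 a) (aug F a) = aug F a"
        using F that by (simp add: graded_free_resolution_def hpart_eq_self_iff)
      then show ?thesis using homogeneous_aug_lift[OF G] by metis
    qed
    then obtain M where M: "\<And>a. a < rk F 0 \<Longrightarrow> M a \<in> vecs (rk G 0)"
      "\<And>a. a < rk F 0 \<Longrightarrow> aug_map G (M a) - aug F a \<in> I"
      "\<And>a. a < rk F 0 \<Longrightarrow> vpart (dg G 0) (dg F 0 a) (M a) = M a"
      by metis
    have "lin (rk F 0) M v \<in> cycles I G 0" if v: "v \<in> cycles I F 0" for v
    proof -
      have "aug_map G (lin (rk F 0) M v) - aug_map F v
          = (\<Sum>a<rk F 0. v a * (aug_map G (M a) - aug F a))"
        by (simp add: aug_map_lin aug_map_def[of F] right_diff_distrib sum_subtractf)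
      also have "\<dots> \<in> I" using M(2) by (intro ideal_sum_mult) auto
      finally have 1: "aug_map G (lin (rk F 0) M v) - aug_map F v \<in> I" .
      have 2: "aug_map F v \<in> I" using v by (simp add: cycles_def)
      \<comment> \<open>The sum of \<open>1\<close> and \<open>2\<close>, written with differences
        only.\<close>
      have "aug_map G (lin (rk F 0) M v) \<in> I"
        using ideal_diff[OF 1 ideal_diff[OF ideal_diff[OF 2 2] 2]] by simp
      then show ?thesis using M(1) by (simp add: cycles_def lin_in_vecs)
    qed
    with M show "\<exists>M. P 0 M" by (intro exI[of _ M]) (simp add: P_def hmat_iff_vpart)
  next
    fix M i assume P: "P i M"
    have "\<exists>v. v \<in> vecs (rk G (Suc i)) \<and> dif_map G i v = lin (rk F i) M (dmat F i a) \<and>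
        vpart (dg G (Suc i)) (dg F (Suc i) a) v = v" if "a < rk F (Suc i)" for a
    proof -
      have "vpart (dg F i) (dg F (Suc i) a) (dmat F i a) = dmat F i a"
        using hmat_dmat[OF F, of i] that by (simp add: hmat_iff_vpart)
      then have "vpart (dg G i) (dg F (Suc i) a) (lin (rk F i) M (dmat F i a)) = lin (rk F i) M (dmat F i a)"
        using P by (simp add: P_def vpart_lin[of "rk F i" "dg F i" "dg G i"])
      moreover have "lin (rk F i) M (dmat F i a) \<in> cycles I G i"
        using P dmat_in_cycles[OF F that] by (simp add: P_def)
      ultimately show ?thesis using homogeneous_lift[OF G] by metis
    qed
    then obtain M' where M': "\<And>a. a < rk F (Suc i) \<Longrightarrow> M' a \<in> vecs (rk G (Suc i))"
      "\<And>a. a < rk F (Suc i) \<Longrightarrow> dif_map G i (M' a) = lin (rk F i) M (dmat F i a)"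
      "\<And>a. a < rk F (Suc i) \<Longrightarrow> vpart (dg G (Suc i)) (dg F (Suc i) a) (M' a) = M' a"
      by metis
    have "dif_map G i (lin (rk F (Suc i)) M' v) = lin (rk F i) M (dif_map F i v)" for v
      by (simp add: dif_map_lin dif_map_eq_lin[of F] lin_lin lin_cong[OF M'(2)])
    then have "lin (rk F (Suc i)) M' v \<in> cycles I G (Suc i)" if "v \<in> cycles I F (Suc i)" for v
      using that M'(1) by (simp add: cycles_def lin_in_vecs)
    with M' show "\<exists>M'. P (Suc i) M' \<and> Q i M M'"
      by (intro exI[of _ M']) (auto simp: P_def Q_def hmat_iff_vpart)
  qed
  then obtain f where "\<And>n. P n (f n) \<and> Q n (f n) (f (Suc n))" by blast
  then have "chain_map F G f" by (auto simp: chain_map_def P_def Q_def)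
  then show ?thesis by (rule that)
qed

lemma chain_map_dif_map:
  assumes "chain_map F G f"
  shows "dif_map G i (lin (rk F (Suc i)) (f (Suc i)) v) = lin (rk F i) (f i) (dif_map F i v)"
  using assms
  by (auto simp: chain_map_def dif_map_lin dif_map_eq_lin[of F] lin_lin intro!: lin_cong)

section \<open>Uniqueness of lifts up to homotopy\<close>

text \<open>Here \<open>\<phi>\<close> lifts the zero map. By the invariant \<open>P\<close>, on
  cycles \<open>\<phi> i\<close> is the differential of \<open>h i\<close>; hence
  \<open>\<phi> (Suc i) a\<close> minus the value of \<open>h i\<close> at \<open>dmat F i a\<close>
  is a cycle, and a preimage of it is the next value of \<open>h\<close>.\<close>

lemma null_homotopy_exists:
  assumes F: "graded_free_resolution I F"
    and vecs: "\<And>i a. a < rk F i \<Longrightarrow> \<phi> i a \<in> vecs (rk F i)"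
    and aug: "\<And>a. a < rk F 0 \<Longrightarrow> aug_map F (\<phi> 0 a) \<in> I"
    and comm: "\<And>i a. a < rk F (Suc i) \<Longrightarrow> dif_map F i (\<phi> (Suc i) a) = lin (rk F i) (\<phi> i) (dmat F i a)"
  obtains h where "\<And>i a. a < rk F i \<Longrightarrow> h i a \<in> vecs (rk F (Suc i))"
    "\<And>a. a < rk F 0 \<Longrightarrow> \<phi> 0 a = dif_map F 0 (h 0 a)"
    "\<And>i a. a < rk F (Suc i) \<Longrightarrow>
       \<phi> (Suc i) a = dif_map F (Suc i) (h (Suc i) a) + lin (rk F i) (h i) (dmat F i a)"
proof -
  define P where "P i H \<longleftrightarrow> (\<forall>a<rk F i. H a \<in> vecs (rk F (Suc i))) \<and>
      (\<forall>v\<in>cycles I F i. lin (rk F i) (\<phi> i) v = dif_map F i (lin (rk F i) H v)) \<and>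
      (i = 0 \<longrightarrow> (\<forall>a<rk F 0. \<phi> 0 a = dif_map F 0 (H a)))" for i H
  define Q where "Q i H H' \<longleftrightarrow> (\<forall>a<rk F (Suc i).
      \<phi> (Suc i) a = dif_map F (Suc i) (H' a) + lin (rk F i) H (dmat F i a))" for i H H'
  have "\<exists>h. \<forall>n. P n (h n) \<and> Q n (h n) (h (Suc n))"
  proof (rule dependent_nat_choice[of P Q])
    have "\<exists>v. v \<in> vecs (rk F 1) \<and> \<phi> 0 a = dif_map F 0 v" if "a < rk F 0" for a
    proof -
      have "\<phi> 0 a \<in> cycles I F 0" using that vecs aug by (simp add: cycles_def)
      then show ?thesis using cycles_eq_image[OF F, of 0] by auto
    qed
    then obtain H where H: "\<And>a. a < rk F 0 \<Longrightarrow> H a \<in> vecs (rk F 1)"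
      "\<And>a. a < rk F 0 \<Longrightarrow> \<phi> 0 a = dif_map F 0 (H a)"
      by metis
    then have "P 0 H" by (simp add: P_def dif_map_lin lin_cong[OF H(2)])
    then show "\<exists>H. P 0 H" by blast
  next
    fix H i assume P: "P i H"
    have "\<exists>v. v \<in> vecs (rk F (Suc (Suc i))) \<and>
        \<phi> (Suc i) a = dif_map F (Suc i) v + lin (rk F i) H (dmat F i a)" if a: "a < rk F (Suc i)" for a
    proof -
      let ?w = "\<phi> (Suc i) a - lin (rk F i) H (dmat F i a)"
      have "dif_map F i ?w = 0"
        using P dmat_in_cycles[OF F a] comm[OF a] by (simp add: P_def dif_map_diff)
      moreover have "?w \<in> vecs (rk F (Suc i))"
        using P vecs[OF a] by (intro vecs_diff lin_in_vecs) (auto simp: P_def)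
      ultimately have "?w \<in> cycles I F (Suc i)" by (simp add: cycles_def)
      then obtain v where "v \<in> vecs (rk F (Suc (Suc i)))" "?w = dif_map F (Suc i) v"
        using cycles_eq_image[OF F, of "Suc i"] by auto
      then show ?thesis by (metis diff_add_cancel)
    qed
    then obtain H' where H': "\<And>a. a < rk F (Suc i) \<Longrightarrow> H' a \<in> vecs (rk F (Suc (Suc i)))"
      "\<And>a. a < rk F (Suc i) \<Longrightarrow> \<phi> (Suc i) a = dif_map F (Suc i) (H' a) + lin (rk F i) H (dmat F i a)"
      by metis
    have "lin (rk F (Suc i)) (\<phi> (Suc i)) v = lin (rk F (Suc i))
        (\<lambda>a. dif_map F (Suc i) (H' a) + lin (rk F i) H (dmat F i a)) v" for v
      by (rule lin_cong) (rule H'(2))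
    then have "lin (rk F (Suc i)) (\<phi> (Suc i)) v
        = dif_map F (Suc i) (lin (rk F (Suc i)) H' v) + lin (rk F i) H (dif_map F i v)" for v
      by (simp only: lin_add_left dif_map_lin dif_map_eq_lin[of F i] lin_lin)
    then have "lin (rk F (Suc i)) (\<phi> (Suc i)) v = dif_map F (Suc i) (lin (rk F (Suc i)) H' v)"
      if "v \<in> cycles I F (Suc i)" for v
      using that by (simp add: cycles_def)
    with H' show "\<exists>H'. P (Suc i) H' \<and> Q i H H'" by (auto simp: P_def Q_def)
  qed
  then obtain h where "\<And>n. P n (h n) \<and> Q n (h n) (h (Suc n))" by blast
  then show ?thesis by (intro that[of h]) (auto simp: P_def Q_def)
qed

text \<open>The difference \<open>g \<circ> f - id\<close> lifts zero, so it is null-homotopic; the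
  homotopy identity is extended from basis vectors to all vectors.\<close>

lemma comparison_homotopy:
  assumes F: "graded_free_resolution I F"
    and f: "chain_map F G f" and g: "chain_map G F g"
  obtains h where "\<And>i a. a < rk F i \<Longrightarrow> h i a \<in> vecs (rk F (Suc i))"
    "\<And>v. v \<in> vecs (rk F 0) \<Longrightarrow>
       lin (rk G 0) (g 0) (lin (rk F 0) (f 0) v) - v = dif_map F 0 (lin (rk F 0) (h 0) v)"
    "\<And>i v. v \<in> vecs (rk F (Suc i)) \<Longrightarrow>
       lin (rk G (Suc i)) (g (Suc i)) (lin (rk F (Suc i)) (f (Suc i)) v) - v =
       dif_map F (Suc i) (lin (rk F (Suc i)) (h (Suc i)) v) + lin (rk F i) (h i) (dif_map F i v)"
proof -
  define \<phi> where "\<phi> i a = lin (rk G i) (g i) (f i a) - unit_vec a" for i a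
  have lin_\<phi>: "lin (rk F i) (\<phi> i) v = lin (rk G i) (g i) (lin (rk F i) (f i) v) - v"
    if "v \<in> vecs (rk F i)" for i v
    using that unfolding \<phi>_def lin_diff_left by (simp add: lin_lin lin_of_unit_vec)
  have 1: "\<phi> i a \<in> vecs (rk F i)" if "a < rk F i" for i a
    using that g unfolding \<phi>_def chain_map_def
    by (intro vecs_diff lin_in_vecs unit_vec_in_vecs) auto
  have 2: "aug_map F (\<phi> 0 a) \<in> I" if "a < rk F 0" for a
  proof -
    have "aug_map F (\<phi> 0 a) = (\<Sum>b<rk G 0. f 0 a b * (aug_map F (g 0 b) - aug G b))
        + (aug_map G (f 0 a) - aug F a)"
      using that by (simp add: \<phi>_def aug_map_diff aug_map_lin aug_map_unit_vec
          aug_map_def[of G] right_diff_distrib sum_subtractf)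
    moreover have "(\<Sum>b<rk G 0. f 0 a b * (aug_map F (g 0 b) - aug G b)) \<in> I"
      using g by (intro ideal_sum_mult) (auto simp: chain_map_def)
    moreover have "aug_map G (f 0 a) - aug F a \<in> I"
      using f that by (simp add: chain_map_def)
    ultimately show ?thesis by (simp only: ideal_add)
  qed
  have 3: "dif_map F i (\<phi> (Suc i) a) = lin (rk F i) (\<phi> i) (dmat F i a)"
    if a: "a < rk F (Suc i)" for i a
  proof -
    have "dif_map F i (\<phi> (Suc i) a) = lin (rk G i) (g i) (dif_map G i (f (Suc i) a)) - dmat F i a"
      using a by (simp add: \<phi>_def dif_map_diff dif_map_unit_vec chain_map_dif_map[OF g])
    also have "\<dots> = lin (rk G i) (g i) (lin (rk F i) (f i) (dmat F i a)) - dmat F i a"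
      using f a by (simp add: chain_map_def)
    also have "\<dots> = lin (rk F i) (\<phi> i) (dmat F i a)"
      by (simp add: lin_\<phi> dmat_in_vecs)
    finally show ?thesis .
  qed
  obtain h where h: "\<And>i a. a < rk F i \<Longrightarrow> h i a \<in> vecs (rk F (Suc i))"
    "\<And>a. a < rk F 0 \<Longrightarrow> \<phi> 0 a = dif_map F 0 (h 0 a)"
    "\<And>i a. a < rk F (Suc i) \<Longrightarrow>
       \<phi> (Suc i) a = dif_map F (Suc i) (h (Suc i) a) + lin (rk F i) (h i) (dmat F i a)"
    using null_homotopy_exists[of F \<phi>, OF F 1 2 3] by blast
  show ?thesis
  proof (rule that[of h])
    fix v :: "nat \<Rightarrow> ('v, 'k) mpoly"
    assume "v \<in> vecs (rk F 0)"
    then have "lin (rk G 0) (g 0) (lin (rk F 0) (f 0) v) - v = lin (rk F 0) (\<phi> 0) v"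
      by (simp add: lin_\<phi>)
    also have "\<dots> = lin (rk F 0) (\<lambda>a. dif_map F 0 (h 0 a)) v"
      by (rule lin_cong) (rule h(2))
    finally show "lin (rk G 0) (g 0) (lin (rk F 0) (f 0) v) - v = dif_map F 0 (lin (rk F 0) (h 0) v)"
      by (simp only: dif_map_lin)
  next
    fix i and v :: "nat \<Rightarrow> ('v, 'k) mpoly"
    assume "v \<in> vecs (rk F (Suc i))"
    then have "lin (rk G (Suc i)) (g (Suc i)) (lin (rk F (Suc i)) (f (Suc i)) v) - v
        = lin (rk F (Suc i)) (\<phi> (Suc i)) v"
      by (simp add: lin_\<phi>)
    also have "\<dots> = lin (rk F (Suc i))
        (\<lambda>a. dif_map F (Suc i) (h (Suc i) a) + lin (rk F i) (h i) (dmat F i a)) v"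
      by (rule lin_cong) (rule h(3))
    finally show "lin (rk G (Suc i)) (g (Suc i)) (lin (rk F (Suc i)) (f (Suc i)) v) - v =
       dif_map F (Suc i) (lin (rk F (Suc i)) (h (Suc i)) v) + lin (rk F i) (h i) (dif_map F i v)"
      by (simp only: lin_add_left dif_map_lin dif_map_eq_lin[of F i] lin_lin)
  qed (rule h(1))
qed

end

section \<open>Reduction modulo the variables\<close>

definition red :: "(nat \<Rightarrow> ('v, 'k::zero) mpoly) \<Rightarrow> nat \<Rightarrow> 'k" where
  "red w = (\<lambda>a. Poly_Mapping.lookup (w a) 0)"

text \<open>A section of \<open>red\<close>: identities between maps over \<open>S\<close> pass to
  \<open>K\<close> by evaluating them at constant vectors.\<close>

definition const_vec :: "(nat \<Rightarrow> 'k::zero) \<Rightarrow> nat \<Rightarrow> ('v, 'k) mpoly" where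
  "const_vec v = (\<lambda>a. Poly_Mapping.single 0 (v a))"

lemma red_const_vec [simp]: "red (const_vec v) = v"
  by (simp add: red_def const_vec_def)

lemma red_0 [simp]: "red 0 = 0"
  by (simp add: red_def fun_eq_iff)

lemma red_add: "red (v + w) = red v + red w"
  by (simp add: red_def fun_eq_iff lookup_add)

lemma red_diff: "red (v - w) = red v - red w" for v w :: "nat \<Rightarrow> ('v, 'k::comm_ring_1) mpoly"
  by (simp add: red_def fun_eq_iff lookup_minus)

lemma red_in_vecs: "v \<in> vecs n \<Longrightarrow> red v \<in> vecs n"
  by (simp add: red_def vecs_def)

lemma const_vec_in_vecs: "v \<in> vecs n \<Longrightarrow> const_vec v \<in> vecs n"
  by (simp add: const_vec_def vecs_def)

lemma red_lin: "red (lin n M w) = lin n (\<lambda>a. red (M a)) (red w)"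
  by (simp add: red_def lin_def lookup_sum const_coeff_mult)

lemma tensor_map_eq_lin: "tensor_map F i v = lin (rk F (Suc i)) (\<lambda>a. red (dmat F i a)) v"
  by (auto simp: tensor_map_def lin_def red_def dmat_def)

lemma tensor_map_red: "tensor_map F i (red w) = red (dif_map F i w)"
  by (simp add: tensor_map_eq_lin dif_map_eq_lin red_lin)

lemma lin_scale_vec: "lin n M (scale_vec c v) = scale_vec c (lin n M v)"
  by (simp add: lin_def scale_vec_def fun_eq_iff sum_distrib_left mult.assoc)

lemma lin_sum: "lin n M (\<Sum>x\<in>X. v x) = (\<Sum>x\<in>X. lin n M (v x))"
  by (induction X rule: infinite_finite_induct) (simp_all only: sum.infinite sum.empty sum.insert lin_0 lin_add not_False_eq_True)

lemma lin_sum_scale_vec: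
  "lin n M (\<Sum>x\<in>X. scale_vec (u x) (v x)) = (\<Sum>x\<in>X. scale_vec (u x) (lin n M (v x)))"
  by (simp add: lin_sum lin_scale_vec)

lemma subspace_tensor_component: "coeff.subspace (tensor_component F i j)"
  by (rule coeff.subspaceI)
    (auto simp: tensor_component_def vecs_def scale_vec_def, metis add.right_neutral)

lemma subspace_tor_cycles: "coeff.subspace (tor_cycles F i j)"
proof -
  have "tensor_map F i' (v + w) = tensor_map F i' v + tensor_map F i' w"
    "tensor_map F i' (scale_vec c v) = scale_vec c (tensor_map F i' v)"
    "tensor_map F i' 0 = 0" for i' v w c
    by (simp_all only: tensor_map_eq_lin lin_add lin_scale_vec lin_0)
  then show ?thesis
    using subspace_tensor_component[of F i j]
    by (cases i) (auto simp only: tor_cycles_def coeff.subspace_def mem_Collect_eq nat.case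
        add_0 coeff.scale_zero_right)
qed

lemma subspace_tor_boundaries: "coeff.subspace (tor_boundaries F i j)"
proof -
  have "module_hom scale_vec scale_vec (tensor_map F i)"
    by unfold_locales (simp_all add: tensor_map_eq_lin lin_add lin_scale_vec)
  then show ?thesis
    unfolding tor_boundaries_def
    by (rule module_hom.subspace_image) (rule subspace_tensor_component)
qed

lemma tor_cycles_subset_vecs: "tor_cycles F i j \<subseteq> vecs (rk F i)"
  by (auto simp: tor_cycles_def tensor_component_def)

text \<open>Projection to degree \<open>j\<close>. It is needed because an element of
  \<open>tor_boundaries\<close> must have a preimage that is itself of degree
  \<open>j\<close>.\<close>

definition degree_part :: "('v, 'k::field) free_complex \<Rightarrow> nat \<Rightarrow> int \<Rightarrow> (nat \<Rightarrow> 'k) \<Rightarrow> nat \<Rightarrow> 'k" where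
  "degree_part F i j v = (\<lambda>a. if dg F i a = j then v a else 0)"

text \<open>The monomial \<open>1\<close> has degree \<open>0\<close>, so an entry with a nonzero
  constant coefficient joins basis vectors of equal degree.\<close>

lemma red_hmat:
  "hmat n \<alpha> \<beta> M \<Longrightarrow> a < n \<Longrightarrow> red (M a) b \<noteq> 0 \<Longrightarrow> \<beta> b = \<alpha> a"
  by (force simp: hmat_def red_def in_keys_iff monomial_degree_def)

lemma lin_hmat_in_tensor_component:
  assumes "hmat (rk F i) (dg F i) (dg G i') M" "\<And>a. a < rk F i \<Longrightarrow> M a \<in> vecs (rk G i')"
    "v \<in> tensor_component F i j"
  shows "lin (rk F i) (\<lambda>a. red (M a)) v \<in> tensor_component G i' j"
proof -
  have "dg G i' b = j" if "lin (rk F i) (\<lambda>a. red (M a)) v b \<noteq> 0" for b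
  proof -
    have "(\<Sum>a<rk F i. v a * red (M a) b) \<noteq> 0" using that by (simp add: lin_def)
    then obtain a where "a < rk F i" "v a * red (M a) b \<noteq> 0"
      by (rule sum.not_neutral_contains_not_neutral) simp
    then show ?thesis
      using assms(1,3) red_hmat[OF assms(1), of a b] by (auto simp: tensor_component_def)
  qed
  moreover have "lin (rk F i) (\<lambda>a. red (M a)) v \<in> vecs (rk G i')"
    using assms(2) by (intro lin_in_vecs red_in_vecs) auto
  ultimately show ?thesis by (simp add: tensor_component_def)
qed

context
  fixes I :: "('v, 'k::field) mpoly set"
  assumes I: "homogeneous_ideal I"
begin

lemma degree_part_tensor_map:
  assumes "graded_free_resolution I F"
  shows "tensor_map F i (degree_part F (Suc i) j v) = degree_part F i j (tensor_map F i v)"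
proof
  fix b
  have "red (dmat F i a) b = 0" if "a < rk F (Suc i)" "dg F i b \<noteq> dg F (Suc i) a" for a
    using red_hmat[OF hmat_dmat[OF I assms]] that by blast
  then show "tensor_map F i (degree_part F (Suc i) j v) b = degree_part F i j (tensor_map F i v) b"
    by (auto simp: tensor_map_eq_lin lin_def degree_part_def intro!: sum.cong sum.neutral)
qed

lemma tor_boundaries_subset_cycles:
  assumes F: "graded_free_resolution I F"
  shows "tor_boundaries F i j \<subseteq> tor_cycles F i j"
proof
  fix w assume "w \<in> tor_boundaries F i j"
  then obtain v where v: "v \<in> tensor_component F (Suc i) j" "w = tensor_map F i v"
    by (auto simp: tor_boundaries_def)
  have "w \<in> tensor_component F i j"
    unfolding v(2) tensor_map_eq_lin using v(1) hmat_dmat[OF I F]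
    by (intro lin_hmat_in_tensor_component) (auto simp: dmat_in_vecs)
  moreover have "tensor_map F i' w = 0" if "i = Suc i'" for i'
  proof -
    have "w = red (dif_map F i (const_vec v))" using tensor_map_red[of F i "const_vec v"] v(2) by simp
    then have "tensor_map F i' w = red (dif_map F i' (dif_map F (Suc i') (const_vec v)))"
      by (simp add: tensor_map_red that)
    also have "dif_map F i' (dif_map F (Suc i') (const_vec v)) = 0"
      using v(1) by (intro dif_map_dif_map[OF I F])
        (auto simp: tensor_component_def const_vec_in_vecs that)
    finally show ?thesis by (simp only: red_0)
  qed
  ultimately show "w \<in> tor_cycles F i j" by (auto simp: tor_cycles_def split: nat.splits)
qed

lemma chain_map_tensor_map:
  assumes "chain_map I G F g"
  shows "lin (rk G i) (\<lambda>a. red (g i a)) (tensor_map G i x)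
    = tensor_map F i (lin (rk G (Suc i)) (\<lambda>a. red (g (Suc i) a)) x)"
proof -
  have "lin (rk G i) (\<lambda>a. red (g i a)) (tensor_map G i (red (const_vec x :: _ \<Rightarrow> ('v, 'k) mpoly)))
      = red (lin (rk G i) (g i) (dif_map G i (const_vec x)))"
    by (simp only: tensor_map_red red_lin)
  also have "\<dots> = tensor_map F i (red (lin (rk G (Suc i)) (g (Suc i)) (const_vec x)))"
    by (simp only: chain_map_dif_map[OF I assms, symmetric] tensor_map_red)
  finally show ?thesis by (simp add: red_lin)
qed

lemma tor_cycle_image:
  assumes f: "chain_map I F G f" and z: "z \<in> tor_cycles F i j"
  shows "lin (rk F i) (\<lambda>a. red (f i a)) z \<in> tor_cycles G i j"
proof -
  have "lin (rk F i) (\<lambda>a. red (f i a)) z \<in> tensor_component G i j"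
    using z f by (intro lin_hmat_in_tensor_component) (auto simp: chain_map_def[OF I] tor_cycles_def)
  moreover have "tensor_map G i' (lin (rk F i) (\<lambda>a. red (f i a)) z) = 0" if "i = Suc i'" for i'
    using chain_map_tensor_map[OF f, of i' z] z that by (simp add: tor_cycles_def)
  ultimately show ?thesis by (auto simp: tor_cycles_def split: nat.splits)
qed

text \<open>Injectivity of the map that \<open>f\<close> induces on Tor: up to a boundary
  \<open>z\<close> is \<open>g (f z)\<close>, and \<open>g\<close> sends boundaries to
  boundaries.\<close>

lemma tor_boundary_reflect:
  assumes F: "graded_free_resolution I F"
    and f: "chain_map I F G f" and g: "chain_map I G F g"
    and z: "z \<in> tor_cycles F i j" and fz: "lin (rk F i) (\<lambda>a. red (f i a)) z \<in> tor_boundaries G i j"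
  shows "z \<in> tor_boundaries F i j"
proof -
  obtain h where h: "\<And>i a. a < rk F i \<Longrightarrow> h i a \<in> vecs (rk F (Suc i))"
    "\<And>v. v \<in> vecs (rk F 0) \<Longrightarrow>
       lin (rk G 0) (g 0) (lin (rk F 0) (f 0) v) - v = dif_map F 0 (lin (rk F 0) (h 0) v)"
    "\<And>i v. v \<in> vecs (rk F (Suc i)) \<Longrightarrow>
       lin (rk G (Suc i)) (g (Suc i)) (lin (rk F (Suc i)) (f (Suc i)) v) - v =
       dif_map F (Suc i) (lin (rk F (Suc i)) (h (Suc i)) v) + lin (rk F i) (h i) (dif_map F i v)"
    using comparison_homotopy[OF I F f g] by metis
  have zv: "(const_vec z :: nat \<Rightarrow> ('v, 'k) mpoly) \<in> vecs (rk F i)"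
    using z by (auto simp: tor_cycles_def tensor_component_def const_vec_in_vecs)
  have "lin (rk G i) (\<lambda>a. red (g i a)) (lin (rk F i) (\<lambda>a. red (f i a)) z) - z
      = red (lin (rk G i) (g i) (lin (rk F i) (f i) (const_vec z)) - const_vec z)"
    by (simp add: red_diff red_lin)
  also have "\<dots> = tensor_map F i (red (lin (rk F i) (h i) (const_vec z)))"
  proof (cases i)
    case 0
    then show ?thesis using h(2) zv by (simp add: tensor_map_red)
  next
    case (Suc i')
    have "red (dif_map F i' (const_vec z)) = 0"
      using z Suc by (simp add: tensor_map_red[symmetric] tor_cycles_def)
    then show ?thesis using h(3) zv Suc
      by (simp add: tensor_map_red red_add red_lin[of "rk F i'"])
  qed
  finally have 1: "lin (rk G i) (\<lambda>a. red (g i a)) (lin (rk F i) (\<lambda>a. red (f i a)) z) - z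
      = tensor_map F i (red (lin (rk F i) (h i) (const_vec z)))" .
  obtain x where x: "x \<in> tensor_component G (Suc i) j" "lin (rk F i) (\<lambda>a. red (f i a)) z = tensor_map G i x"
    using fz by (auto simp: tor_boundaries_def)
  \<comment> \<open>From \<open>g (f z) - z = d (h z)\<close> and \<open>f z = d x\<close> follows
    \<open>z = d (g x - h z)\<close>; of this preimage only the part of degree \<open>j\<close> is
    kept in the end.\<close>
  define y where "y = lin (rk G (Suc i)) (\<lambda>a. red (g (Suc i) a)) x - red (lin (rk F i) (h i) (const_vec z))"
  have "tensor_map F i y = tensor_map F i (lin (rk G (Suc i)) (\<lambda>a. red (g (Suc i) a)) x)
      - tensor_map F i (red (lin (rk F i) (h i) (const_vec z)))"
    by (simp only: y_def tensor_map_eq_lin lin_diff)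
  then have "tensor_map F i y = z"
    using 1 unfolding x(2) chain_map_tensor_map[OF g] by (simp add: algebra_simps)
  moreover have "degree_part F i j z = z"
    using z by (auto simp: tor_cycles_def tensor_component_def degree_part_def fun_eq_iff)
  ultimately have "tensor_map F i (degree_part F (Suc i) j y) = z"
    by (simp add: degree_part_tensor_map[OF F])
  moreover have "y \<in> vecs (rk F (Suc i))"
    unfolding y_def using g h(1) by (intro vecs_diff lin_in_vecs red_in_vecs) (auto simp: chain_map_def[OF I])
  then have "degree_part F (Suc i) j y \<in> tensor_component F (Suc i) j"
    by (auto simp: tensor_component_def degree_part_def vecs_def)
  ultimately show ?thesis unfolding tor_boundaries_def by blast
qed

text \<open>Cycles independent modulo boundaries stay so under a comparison map because it reflects
  boundaries. Exchanging \<open>F\<close> and \<open>G\<close> then gives equality.\<close>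

theorem tor_dim_le:
  assumes F: "graded_free_resolution I F" and G: "graded_free_resolution I G"
  shows "coeff.dim (tor_cycles F i j) - coeff.dim (tor_boundaries F i j)
    \<le> coeff.dim (tor_cycles G i j) - coeff.dim (tor_boundaries G i j)"
proof -
  obtain f where f: "chain_map I F G f" using chain_map_exists[OF I F G] .
  obtain g where g: "chain_map I G F g" using chain_map_exists[OF I G F] .
  obtain W where W: "finite W" "(vecs (rk F i) :: (nat \<Rightarrow> 'k) set) \<subseteq> coeff.span W"
    using vecs_subset_span by blast
  obtain W' where W': "finite W'" "(vecs (rk G i) :: (nat \<Rightarrow> 'k) set) \<subseteq> coeff.span W'"
    using vecs_subset_span by blast
  obtain C where C: "finite C" "C \<subseteq> tor_cycles F i j"
    "card C = coeff.dim (tor_cycles F i j) - coeff.dim (tor_boundaries F i j)"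
    "\<And>u. (\<Sum>c\<in>C. scale_vec (u c) c) \<in> tor_boundaries F i j \<Longrightarrow> \<forall>c\<in>C. u c = 0"
    by (rule coeff.obtain_independent_modulo[OF subspace_tor_boundaries
        tor_boundaries_subset_cycles[OF F] order.trans[OF tor_cycles_subset_vecs W(2)] W(1)]) (rule that)
  have "card C \<le> coeff.dim (tor_cycles G i j) - coeff.dim (tor_boundaries G i j)"
  proof (rule coeff.card_le_dim_diff[OF subspace_tor_boundaries tor_boundaries_subset_cycles[OF G]
        order.trans[OF tor_cycles_subset_vecs W'(2)] W'(1) C(1)])
    show "lin (rk F i) (\<lambda>a. red (f i a)) c \<in> tor_cycles G i j" if "c \<in> C" for c
      using tor_cycle_image[OF f] C(2) that by blast
    fix u assume "(\<Sum>c\<in>C. scale_vec (u c) (lin (rk F i) (\<lambda>a. red (f i a)) c)) \<in> tor_boundaries G i j"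
    then have "(\<Sum>c\<in>C. scale_vec (u c) c) \<in> tor_boundaries F i j"
      using C(2) by (intro tor_boundary_reflect[OF F f g] coeff.subspace_sum[OF subspace_tor_cycles]
          coeff.subspace_scale[OF subspace_tor_cycles]) (auto simp: lin_sum_scale_vec)
    then show "\<forall>c\<in>C. u c = 0" by (rule C(4))
  qed
  then show ?thesis by (simp add: C(3))
qed

text \<open>As soon as one resolution is known, the choice in \<open>betti_quotient\<close> is a
  resolution as well, and the two can be compared.\<close>

corollary betti_quotient_eq:
  assumes "graded_free_resolution I F"
  shows "betti_quotient I i j = coeff.dim (tor_cycles F i j) - coeff.dim (tor_boundaries F i j)"
proof -
  have "graded_free_resolution I (SOME F. graded_free_resolution I F)"
    using assms by (rule someI)
  then show ?thesis
    unfolding betti_quotient_def Let_def by (intro order.antisym tor_dim_le assms)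
qed

end

section \<open>The Taylor resolution of a monomial ideal\<close>

definition divs :: "'v monomial \<Rightarrow> 'v monomial \<Rightarrow> bool" where
  "divs m n \<longleftrightarrow> (\<forall>v. Poly_Mapping.lookup m v \<le> Poly_Mapping.lookup n v)"

lemma divs_add_diff: "divs m n \<Longrightarrow> m + (n - m) = n"
  by (auto simp: divs_def poly_mapping_eq_iff fun_eq_iff lookup_add lookup_minus)

lemma divs_diff_add: "divs m n \<Longrightarrow> n - m + m = n"
  using divs_add_diff[of m n] by (simp add: add.commute)

lemma divs_refl: "divs m m"
  by (simp add: divs_def)

lemma divs_antisym: "divs a b \<Longrightarrow> divs b a \<Longrightarrow> a = b"
  by (simp add: divs_def poly_mapping_eq_iff fun_eq_iff le_antisym)

lemma divs_add: "divs m (n + m)"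
  by (simp add: divs_def lookup_add)

lemma lookup_single_mult:
  fixes p :: "('v, 'k::comm_ring_1) mpoly"
  shows "Poly_Mapping.lookup (Poly_Mapping.single m c * p) n =
    (if divs m n then c * Poly_Mapping.lookup p (n - m) else 0)"
proof -
  have eq: "n = m + k \<longleftrightarrow> divs m n \<and> k = n - m" for k
    using divs_add_diff[of m n] divs_add[of m k] by (auto simp: add.commute)
  have "Poly_Mapping.single m c * p =
      Poly_Mapping.single m c * (\<Sum>k\<in>Poly_Mapping.keys p. Poly_Mapping.single k (Poly_Mapping.lookup p k))"
    by (simp add: mpoly_expand)
  also have "Poly_Mapping.lookup \<dots> n =
      (\<Sum>k\<in>Poly_Mapping.keys p. if n = m + k then c * Poly_Mapping.lookup p k else 0)"
    by (simp add: sum_distrib_left lookup_sum mult_single lookup_single when_def eq_commute cong: if_cong)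
  also have "\<dots> = (if divs m n then
      \<Sum>k\<in>Poly_Mapping.keys p. if k = n - m then c * Poly_Mapping.lookup p k else 0 else 0)"
    by (auto simp: eq intro: sum.cong)
  also have "\<dots> = (if divs m n then c * Poly_Mapping.lookup p (n - m) else 0)"
    by (auto simp: in_keys_iff)
  finally show ?thesis .
qed

section \<open>Chains of a simplex with ordered vertices\<close>

definition ins_sign :: "nat \<Rightarrow> nat set \<Rightarrow> 'a::comm_ring_1" where
  "ins_sign g Y = (- 1) ^ card {y \<in> Y. y < g}"

text \<open>The augmented simplicial boundary, read off at one face: chains are functions on vertex
  sets, and the coefficient at \<open>Y\<close> collects the simplices \<open>insert g Y\<close>,
  signed by the position of \<open>g\<close>.\<close>

definition simplex_bd :: "nat set \<Rightarrow> (nat set \<Rightarrow> 'a::comm_ring_1) \<Rightarrow> nat set \<Rightarrow> 'a" where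
  "simplex_bd V \<gamma> Y = (\<Sum>g\<in>V - Y. ins_sign g Y * \<gamma> (insert g Y))"

lemma ins_sign_insert:
  assumes "finite Y" "h \<notin> Y"
  shows "ins_sign g (insert h Y) = (if h < g then - ins_sign g Y else ins_sign g Y :: 'a::comm_ring_1)"
proof -
  have "{y \<in> insert h Y. y < g} = (if h < g then insert h {y \<in> Y. y < g} else {y \<in> Y. y < g})"
    by auto
  then show ?thesis using assms by (simp add: ins_sign_def)
qed

text \<open>The pairs \<open>(g, h)\<close> and \<open>(h, g)\<close> reach the same set, with
  opposite signs: the presence of the smaller vertex flips the sign of inserting the larger one, but
  not conversely.\<close>

lemma simplex_bd_simplex_bd:
  assumes "finite V" "Y \<subseteq> V"
  shows "simplex_bd V (simplex_bd V \<gamma>) Y = (0 :: 'a::comm_ring_1)"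
proof -
  define F where "F g h = ins_sign g Y * (ins_sign h (insert g Y) * \<gamma> (insert h (insert g Y)))" for g h
  let ?U = "V - Y"
  have fin: "finite ?U" "finite Y" using assms finite_subset by auto
  have anti: "F g h + F h g = 0" if "g \<in> ?U" "h \<in> ?U" "g < h" for g h
    using that fin by (simp add: F_def ins_sign_insert insert_commute)
  have U: "V - insert g Y = ?U - {g}" for g by auto
  have "simplex_bd V (simplex_bd V \<gamma>) Y = (\<Sum>g\<in>?U. \<Sum>h\<in>?U - {g}. F g h)"
    by (simp only: simplex_bd_def F_def sum_distrib_left U)
  also have "\<dots> = (\<Sum>g\<in>?U. (\<Sum>h\<in>{h\<in>?U. g < h}. F g h) + (\<Sum>h\<in>{h\<in>?U. h < g}. F g h))"
  proof (rule sum.cong[OF refl])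
    fix g
    have "?U - {g} = {h\<in>?U. g < h} \<union> {h\<in>?U. h < g}" by auto
    moreover have "sum (F g) ({h\<in>?U. g < h} \<union> {h\<in>?U. h < g})
        = (\<Sum>h\<in>{h\<in>?U. g < h}. F g h) + (\<Sum>h\<in>{h\<in>?U. h < g}. F g h)"
      using fin by (intro sum.union_disjoint) auto
    ultimately show "(\<Sum>h\<in>?U - {g}. F g h) = (\<Sum>h\<in>{h\<in>?U. g < h}. F g h) + (\<Sum>h\<in>{h\<in>?U. h < g}. F g h)"
      by metis
  qed
  also have "\<dots> = (\<Sum>g\<in>?U. \<Sum>h\<in>{h\<in>?U. g < h}. F g h) + (\<Sum>g\<in>?U. \<Sum>h\<in>{h\<in>?U. h < g}. F g h)"
    by (rule sum.distrib)
  also have "(\<Sum>g\<in>?U. \<Sum>h\<in>{h\<in>?U. h < g}. F g h) = (\<Sum>h\<in>?U. \<Sum>g\<in>{g\<in>?U. h < g}. F g h)"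
    by (rule sum.swap_restrict[OF fin(1) fin(1)])
  also have "(\<Sum>g\<in>?U. \<Sum>h\<in>{h\<in>?U. g < h}. F g h) + \<dots> = (\<Sum>g\<in>?U. \<Sum>h\<in>{h\<in>?U. g < h}. F g h + F h g)"
    by (simp add: sum.distrib)
  also have "\<dots> = 0" using anti by (intro sum.neutral ballI) auto
  finally show ?thesis .
qed

text \<open>The apex is the least vertex because inserting it always has sign \<open>1\<close>,
  while its presence flips the sign of every other insertion.\<close>

definition cone :: "nat set \<Rightarrow> (nat set \<Rightarrow> 'a::zero) \<Rightarrow> nat set \<Rightarrow> 'a" where
  "cone V \<gamma> Y = (if Min V \<in> Y then \<gamma> (Y - {Min V}) else 0)"

text \<open>A simplex is contracted by coning from its least vertex.\<close>

lemma simplex_bd_cone: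
  assumes V: "finite V" "V \<noteq> {}" and Y: "Y \<subseteq> V"
    and cycle: "\<And>Z. Z \<subseteq> V \<Longrightarrow> simplex_bd V \<gamma> Z = (0 :: 'a::comm_ring_1)"
  shows "simplex_bd V (cone V \<gamma>) Y = \<gamma> Y"
proof (cases "Min V \<in> Y")
  case False
  have sign: "ins_sign (Min V) Y = (1 :: 'a)"
  proof -
    have "{y \<in> Y. y < Min V} = {}" using V Y by (auto simp: not_less)
    then show ?thesis unfolding ins_sign_def by (simp only: card.empty power_0)
  qed
  have "simplex_bd V (cone V \<gamma>) Y = (\<Sum>g\<in>{Min V}. ins_sign g Y * cone V \<gamma> (insert g Y))"
    unfolding simplex_bd_def
    by (rule sum.mono_neutral_right) (use V False in \<open>auto simp: cone_def\<close>)
  then show ?thesis using False by (simp add: cone_def sign)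
next
  case True
  let ?m = "Min V"
  define Z where "Z = Y - {?m}"
  have Y_eq: "Y = insert ?m Z" and Z: "?m \<notin> Z" "finite Z" "Z \<subseteq> V"
    using True Y V finite_subset by (auto simp: Z_def)
  have Vm: "?m \<in> V" using V by simp
  have less: "?m < g" if "g \<in> V - Y" for g
    using that True V by (metis DiffD1 DiffD2 Min_le le_neq_implies_less)
  have "V - Z = insert ?m (V - Y)" using Vm Z Y_eq by auto
  moreover have "ins_sign ?m Z = (1 :: 'a)"
  proof -
    have "{y \<in> Z. y < ?m} = {}" using V Z by (auto simp: not_less)
    then show ?thesis unfolding ins_sign_def by (simp only: card.empty power_0)
  qed
  \<comment> \<open>The cycle condition at the face \<open>Z\<close> of \<open>Y\<close> opposite
    the apex expresses \<open>\<gamma> Y\<close> by the sets \<open>insert g Z\<close> without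
    apex.\<close>
  ultimately have "simplex_bd V \<gamma> Z = \<gamma> Y + (\<Sum>g\<in>V - Y. ins_sign g Z * \<gamma> (insert g Z))"
    using V True by (simp add: simplex_bd_def Y_eq[symmetric])
  then have "(\<Sum>g\<in>V - Y. ins_sign g Z * \<gamma> (insert g Z)) = - \<gamma> Y"
    using cycle[OF Z(3)] by (simp add: add_eq_0_iff)
  moreover have "simplex_bd V (cone V \<gamma>) Y = (\<Sum>g\<in>V - Y. - (ins_sign g Z * \<gamma> (insert g Z)))"
    unfolding simplex_bd_def
  proof (rule sum.cong[OF refl])
    fix g assume g: "g \<in> V - Y"
    have "ins_sign g Y = (- ins_sign g Z :: 'a)"
      unfolding Y_eq using less[OF g] Z by (simp add: ins_sign_insert)
    moreover have "insert g Y - {?m} = insert g Z" using less[OF g] Z Y_eq by auto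
    ultimately show "ins_sign g Y * cone V \<gamma> (insert g Y) = - (ins_sign g Z * \<gamma> (insert g Z))"
      using True by (simp add: cone_def)
  qed
  ultimately show ?thesis by (simp add: sum_negf)
qed

section \<open>Least common multiples and the Taylor differential\<close>

locale taylor =
  fixes gen :: "nat \<Rightarrow> 'v::finite monomial" and N :: nat
begin

text \<open>The inserted \<open>0\<close> gives the empty set the monomial \<open>1\<close>. Every
  exponent function has finite support because \<open>'v\<close> is finite.\<close>

definition mlcm :: "nat set \<Rightarrow> 'v monomial" where
  "mlcm X = Abs_poly_mapping (\<lambda>v. Max (insert 0 ((\<lambda>i. Poly_Mapping.lookup (gen i) v) ` X)))"

lemma lookup_mlcm:
  "Poly_Mapping.lookup (mlcm X) v = Max (insert 0 ((\<lambda>i. Poly_Mapping.lookup (gen i) v) ` X))"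
  by (simp add: mlcm_def)

lemma mlcm_divs_iff: "finite X \<Longrightarrow> divs (mlcm X) m \<longleftrightarrow> (\<forall>i\<in>X. divs (gen i) m)"
  by (auto simp: divs_def lookup_mlcm)

lemma mlcm_empty: "mlcm {} = 0"
  by (simp add: poly_mapping_eq_iff fun_eq_iff lookup_mlcm)

lemma mlcm_mono: "finite Y \<Longrightarrow> X \<subseteq> Y \<Longrightarrow> divs (mlcm X) (mlcm Y)"
  using mlcm_divs_iff[of Y "mlcm Y"] mlcm_divs_iff[of X "mlcm Y"] finite_subset
  by (auto simp: divs_refl)

definition below :: "'v monomial \<Rightarrow> nat set" where
  "below m = {g. g < N \<and> divs (gen g) m}"

lemma finite_below: "finite (below m)"
  by (simp add: below_def)

lemma mlcm_divs_iff_below: "Y \<subseteq> {..<N} \<Longrightarrow> divs (mlcm Y) m \<longleftrightarrow> Y \<subseteq> below m"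
  using mlcm_divs_iff[of Y m] finite_subset[of Y "{..<N}"] by (auto simp: below_def)

text \<open>Basis of homological degree \<open>i\<close>: a face with \<open>i\<close> vertices has
  dimension \<open>i - 1\<close>, and the empty face generates degree \<open>0\<close>.\<close>

definition faces :: "nat \<Rightarrow> nat set set" where
  "faces i = {X. X \<subseteq> {..<N} \<and> card X = i}"

lemma finite_faces: "finite (faces i)"
  by (rule finite_subset[of _ "Pow {..<N}"]) (auto simp: faces_def)

lemma finite_face: "X \<in> faces i \<Longrightarrow> finite X"
  using finite_subset by (auto simp: faces_def)

lemma faces_0: "faces 0 = {{}}"
  by (auto simp: faces_def card_eq_0_iff dest: finite_subset[OF _ finite_lessThan])

definition taylor_d :: "(nat set \<Rightarrow> ('v, 'k::comm_ring_1) mpoly) \<Rightarrow> nat set \<Rightarrow> ('v, 'k) mpoly" where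
  "taylor_d c Y = (\<Sum>g\<in>{..<N} - Y.
     Poly_Mapping.single (mlcm (insert g Y) - mlcm Y) (ins_sign g Y) * c (insert g Y))"

text \<open>The Taylor complex is multigraded, and its part of multidegree \<open>m\<close> is the augmented chain
  complex of the simplex on the generators that divide \<open>m\<close>.\<close>

definition strand :: "'v monomial \<Rightarrow> (nat set \<Rightarrow> ('v, 'k::zero) mpoly) \<Rightarrow> nat set \<Rightarrow> 'k" where
  "strand m c Y = (if divs (mlcm Y) m then Poly_Mapping.lookup (c Y) (m - mlcm Y) else 0)"

text \<open>The coefficient of \<open>c Y\<close> at \<open>n\<close> is seen in the strand of
  multidegree \<open>n + mlcm Y\<close>.\<close>

lemma eq_if_strands_eq:
  assumes "\<And>m. strand m c Y = strand m c' Y"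
  shows "c Y = c' Y"
proof (rule poly_mapping_eqI)
  fix n
  show "Poly_Mapping.lookup (c Y) n = Poly_Mapping.lookup (c' Y) n"
    using assms[of "n + mlcm Y"] by (simp add: strand_def divs_add)
qed

lemma strand_outside: "Y \<subseteq> {..<N} \<Longrightarrow> \<not> Y \<subseteq> below m \<Longrightarrow> strand m c Y = 0"
  by (simp add: strand_def mlcm_divs_iff_below)

text \<open>The monomial factors of \<open>taylor_d\<close> just compensate the shifts in
  \<open>strand\<close>; a \<open>g\<close> outside \<open>below m\<close> contributes nothing
  because the lcm of \<open>insert g Y\<close> does not divide \<open>m\<close>.\<close>

lemma strand_taylor_d:
  fixes c :: "nat set \<Rightarrow> ('v, 'k::comm_ring_1) mpoly"
  assumes Y: "Y \<subseteq> below m"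
  shows "strand m (taylor_d c) Y = simplex_bd (below m) (strand m c) Y"
proof -
  have YN: "Y \<subseteq> {..<N}" using Y by (auto simp: below_def)
  then have finY: "finite Y" using finite_subset by blast
  have Ym: "divs (mlcm Y) m" using Y YN by (simp add: mlcm_divs_iff_below)
  have "Poly_Mapping.lookup (Poly_Mapping.single (mlcm (insert g Y) - mlcm Y) (ins_sign g Y) * c (insert g Y)) (m - mlcm Y)
      = (if g \<in> below m then ins_sign g Y * strand m c (insert g Y) else 0)" if "g \<in> {..<N} - Y" for g
  proof -
    have gY: "divs (mlcm Y) (mlcm (insert g Y))" using finY by (intro mlcm_mono) auto
    have "divs (mlcm (insert g Y) - mlcm Y) (m - mlcm Y) \<longleftrightarrow> divs (mlcm (insert g Y)) m"
      using gY Ym unfolding divs_def lookup_minus by (intro iff_allI) (metis diff_le_mono eq_diff_iff le_diff_iff)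
    also have "\<dots> \<longleftrightarrow> g \<in> below m" using that Y YN mlcm_divs_iff_below[of "insert g Y" m] by auto
    finally have 1: "divs (mlcm (insert g Y) - mlcm Y) (m - mlcm Y) \<longleftrightarrow> g \<in> below m" .
    have 2: "m - mlcm Y - (mlcm (insert g Y) - mlcm Y) = m - mlcm (insert g Y)"
      using gY by (auto simp: divs_def poly_mapping_eq_iff fun_eq_iff lookup_minus)
    have 3: "divs (mlcm (insert g Y)) m \<longleftrightarrow> g \<in> below m"
      using that Y YN mlcm_divs_iff_below[of "insert g Y" m] by auto
    show ?thesis by (simp add: lookup_single_mult 1 2 3 strand_def)
  qed
  then have "strand m (taylor_d c) Y =
      (\<Sum>g\<in>{..<N} - Y. if g \<in> below m then ins_sign g Y * strand m c (insert g Y) else 0)"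
    using Ym by (simp add: strand_def[of m "taylor_d c"] taylor_d_def lookup_sum)
  also have "\<dots> = simplex_bd (below m) (strand m c) Y"
    unfolding simplex_bd_def
    by (rule sum.mono_neutral_cong_right) (auto simp: below_def)
  finally show ?thesis .
qed

lemma taylor_d_taylor_d:
  assumes "Y \<subseteq> {..<N}"
  shows "taylor_d (taylor_d c) Y = (0 :: ('v, 'k::comm_ring_1) mpoly)"
proof -
  have "strand m (taylor_d (taylor_d c)) Y = strand m 0 Y" for m
  proof (cases "Y \<subseteq> below m")
    case True
    have "simplex_bd (below m) (strand m (taylor_d c)) Y
        = simplex_bd (below m) (simplex_bd (below m) (strand m c)) Y"
      unfolding simplex_bd_def[of _ "strand m (taylor_d c)"]
        simplex_bd_def[of _ "simplex_bd (below m) (strand m c)"]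
      using True by (intro sum.cong refl) (simp add: strand_taylor_d)
    then show ?thesis
      using True by (simp add: strand_taylor_d simplex_bd_simplex_bd finite_below) (simp add: strand_def)
  qed (simp add: assms strand_outside)
  then show ?thesis using eq_if_strands_eq[of "taylor_d (taylor_d c)" Y 0] by simp
qed

text \<open>Every strand is contracted separately by a cone, and the results are reassembled into
  polynomials. Over the empty simplex there is no apex; there only the face \<open>{}\<close>
  occurs, and \<open>bottom\<close> makes its coefficient vanish.\<close>

lemma taylor_exact:
  fixes c :: "nat set \<Rightarrow> ('v, 'k::comm_ring_1) mpoly"
  assumes supp: "\<And>Y. Y \<notin> faces i \<Longrightarrow> c Y = 0"
    and cycle: "\<And>Y. Y \<subseteq> {..<N} \<Longrightarrow> taylor_d c Y = 0"
    and bottom: "\<And>n. n \<in> Poly_Mapping.keys (c {}) \<Longrightarrow> below n \<noteq> {}"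
  obtains b where "\<And>Y. Y \<notin> faces (Suc i) \<Longrightarrow> b Y = 0" "\<And>Y. Y \<subseteq> {..<N} \<Longrightarrow> taylor_d b Y = c Y"
proof -
  \<comment> \<open>The coefficient of \<open>b Y\<close> at \<open>n\<close> belongs to multidegree
    \<open>n + mlcm Y\<close>, which selects the strand to be coned.\<close>
  define \<beta> where "\<beta> Y n = (if Y \<in> faces (Suc i) then
      cone (below (n + mlcm Y)) (strand (n + mlcm Y) c) Y else 0)" for Y n
  define b where "b Y = Abs_poly_mapping (\<beta> Y)" for Y
  have "finite {n. \<beta> Y n \<noteq> 0}" for Y
  proof (cases "Y \<in> faces (Suc i)")
    case True
    then have fin: "finite Y" by (rule finite_face)
    \<comment> \<open>The support is finite: each coefficient comes from a coefficient of some
      \<open>c (Y - {g})\<close> by a shift of exponents that depends only on \<open>Y\<close> and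
      \<open>g\<close>.\<close>
    have "{n. \<beta> Y n \<noteq> 0} \<subseteq>
        (\<Union>g\<in>Y. (\<lambda>k. k - (mlcm Y - mlcm (Y - {g}))) ` Poly_Mapping.keys (c (Y - {g})))"
    proof
      fix n assume "n \<in> {n. \<beta> Y n \<noteq> 0}"
      then obtain g where g: "g \<in> Y" "strand (n + mlcm Y) c (Y - {g}) \<noteq> 0"
        using True by (auto simp: \<beta>_def cone_def split: if_splits)
      have "divs (mlcm (Y - {g})) (mlcm Y)" using fin by (intro mlcm_mono) auto
      then have "n + mlcm Y - mlcm (Y - {g}) = n + (mlcm Y - mlcm (Y - {g}))"
        by (auto simp: divs_def poly_mapping_eq_iff fun_eq_iff lookup_minus lookup_add)
      then have "n + (mlcm Y - mlcm (Y - {g})) \<in> Poly_Mapping.keys (c (Y - {g}))"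
        using g(2) by (auto simp: strand_def in_keys_iff split: if_splits)
      then show "n \<in> (\<Union>g\<in>Y. (\<lambda>k. k - (mlcm Y - mlcm (Y - {g}))) ` Poly_Mapping.keys (c (Y - {g})))"
        using g(1) by (auto intro!: bexI[of _ g] image_eqI)
    qed
    moreover have "finite (\<Union>g\<in>Y. (\<lambda>k. k - (mlcm Y - mlcm (Y - {g}))) ` Poly_Mapping.keys (c (Y - {g})))"
      using fin by simp
    ultimately show ?thesis by (rule finite_subset)
  qed (simp add: \<beta>_def)
  then have lookup_b: "Poly_Mapping.lookup (b Y) = \<beta> Y" for Y
    by (simp add: b_def lookup_Abs_poly_mapping)
  have b0: "b Y = 0" if "Y \<notin> faces (Suc i)" for Y
    using that by (simp add: poly_mapping_eq_iff lookup_b \<beta>_def fun_eq_iff)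
  have strand_b: "strand m b Y = cone (below m) (strand m c) Y" if Y: "Y \<subseteq> below m" for m Y
  proof (cases "Y \<in> faces (Suc i)")
    case True
    then have "divs (mlcm Y) m" using Y by (simp add: faces_def mlcm_divs_iff_below)
    then show ?thesis by (simp add: strand_def[of m b] lookup_b \<beta>_def True divs_diff_add)
  next
    case False
    have "strand m c (Y - {Min (below m)}) = 0" if "Min (below m) \<in> Y"
    proof -
      have "Y \<subseteq> {..<N}" using Y by (auto simp: below_def)
      then have "finite Y" using finite_subset by blast
      then have "card Y = Suc (card (Y - {Min (below m)}))" using that by (rule card.remove)
      then have "Y - {Min (below m)} \<notin> faces i"
        using False \<open>Y \<subseteq> {..<N}\<close> by (auto simp: faces_def)
      then show ?thesis by (simp add: strand_def supp)
    qed
    then show ?thesis using False by (simp add: strand_def[of m b] b0 cone_def)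
  qed
  have "taylor_d b Y = c Y" if Y: "Y \<subseteq> {..<N}" for Y
  proof (rule eq_if_strands_eq)
    fix m
    show "strand m (taylor_d b) Y = strand m c Y"
    proof (cases "Y \<subseteq> below m")
      case True
      have "strand m (taylor_d b) Y = simplex_bd (below m) (strand m b) Y"
        using True by (rule strand_taylor_d)
      also have "\<dots> = simplex_bd (below m) (cone (below m) (strand m c)) Y"
        unfolding simplex_bd_def using True by (intro sum.cong refl) (simp add: strand_b)
      also have "\<dots> = strand m c Y"
      proof (cases "below m = {}")
        case False
        have "simplex_bd (below m) (strand m c) Z = 0" if "Z \<subseteq> below m" for Z
        proof -
          have "Z \<subseteq> {..<N}" using that by (auto simp: below_def)
          then have "taylor_d c Z = 0" by (rule cycle)
          then show ?thesis using strand_taylor_d[OF that, of c] by (simp add: strand_def split: if_splits)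
        qed
        then show ?thesis using False True by (intro simplex_bd_cone finite_below) auto
      next
        case empty: True
        then have "Y = {}" using True by simp
        moreover have "m \<notin> Poly_Mapping.keys (c {})" using bottom empty by blast
        ultimately show ?thesis
          using empty by (simp add: simplex_bd_def strand_def mlcm_empty in_keys_iff)
      qed
      finally show ?thesis .
    qed (use Y in \<open>simp add: strand_outside\<close>)
  qed
  with b0 show ?thesis by (rule that)
qed

section \<open>The Taylor complex with numbered bases\<close>

definition enum :: "nat \<Rightarrow> nat \<Rightarrow> nat set" where
  "enum i = (SOME e. bij_betw e {..<card (faces i)} (faces i))"

lemma bij_betw_enum: "bij_betw (enum i) {..<card (faces i)} (faces i)"
  unfolding enum_def
  using ex_bij_betw_nat_finite[OF finite_faces[of i]] by (intro someI_ex[of "\<lambda>e. bij_betw e _ _"])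
    (simp add: lessThan_atLeast0)

lemma enum_in_faces: "a < card (faces i) \<Longrightarrow> enum i a \<in> faces i"
  using bij_betwE[OF bij_betw_enum] by simp

text \<open>Translates functions on faces into coordinate vectors of \<open>free_complex\<close>, so
  that arguments can be made on faces instead of their arbitrary numbers.\<close>

definition vec_of :: "nat \<Rightarrow> (nat set \<Rightarrow> 'r::zero) \<Rightarrow> nat \<Rightarrow> 'r" where
  "vec_of i c a = (if a < card (faces i) then c (enum i a) else 0)"

lemma vec_of_in_vecs: "vec_of i c \<in> vecs (card (faces i))"
  by (simp add: vec_of_def vecs_def)

lemma vec_of_eq_iff: "vec_of i c = vec_of i c' \<longleftrightarrow> (\<forall>Y\<in>faces i. c Y = c' Y)"
proof
  assume eq: "vec_of i c = vec_of i c'"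
  show "\<forall>Y\<in>faces i. c Y = c' Y"
  proof
    fix Y assume "Y \<in> faces i"
    then obtain a where "a < card (faces i)" "Y = enum i a"
      using bij_betw_enum[of i] by (auto simp: bij_betw_def)
    then show "c Y = c' Y" using fun_cong[OF eq, of a] by (simp add: vec_of_def)
  qed
qed (auto simp: vec_of_def fun_eq_iff enum_in_faces)

lemma vec_of_0: "vec_of i 0 = 0"
  by (simp add: vec_of_def fun_eq_iff)

lemma vecs_eq_vec_of:
  assumes "v \<in> vecs (card (faces i))"
  obtains c where "v = vec_of i c" "\<And>Y. Y \<notin> faces i \<Longrightarrow> c Y = 0"
proof
  let ?c = "\<lambda>Y. if Y \<in> faces i then v (the_inv_into {..<card (faces i)} (enum i) Y) else 0"
  show "v = vec_of i ?c"
    using assms bij_betw_enum[of i]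
    by (auto simp: fun_eq_iff vec_of_def vecs_def enum_in_faces bij_betw_def the_inv_into_f_f)
qed simp

lemma sum_vec_of: "(\<Sum>a<card (faces i). f (vec_of i c a) (enum i a)) = (\<Sum>X\<in>faces i. f (c X) X)"
proof -
  have "(\<Sum>a<card (faces i). f (vec_of i c a) (enum i a)) = (\<Sum>a<card (faces i). f (c (enum i a)) (enum i a))"
    by (simp add: vec_of_def)
  also have "\<dots> = (\<Sum>X\<in>faces i. f (c X) X)"
    using bij_betw_enum by (rule sum.reindex_bij_betw)
  finally show ?thesis .
qed

text \<open>A face with one more vertex that contains \<open>Y\<close> is \<open>insert g Y\<close>
  for a unique \<open>g\<close>; this converts the matrix form of the differential into the sum of
  \<open>taylor_d\<close>.\<close>

lemma sum_cofaces:
  assumes Y: "Y \<in> faces i"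
  shows "(\<Sum>X\<in>faces (Suc i). if Y \<subseteq> X then f X (the_elem (X - Y)) else 0)
    = (\<Sum>g\<in>{..<N} - Y. f (insert g Y) g :: 'a::comm_monoid_add)"
proof -
  have finY: "finite Y" using Y by (rule finite_face)
  have "bij_betw (\<lambda>g. insert g Y) ({..<N} - Y) {X \<in> faces (Suc i). Y \<subseteq> X}"
    unfolding bij_betw_def
  proof
    show "inj_on (\<lambda>g. insert g Y) ({..<N} - Y)" by (rule inj_onI) auto
    show "(\<lambda>g. insert g Y) ` ({..<N} - Y) = {X \<in> faces (Suc i). Y \<subseteq> X}"
    proof
      show "(\<lambda>g. insert g Y) ` ({..<N} - Y) \<subseteq> {X \<in> faces (Suc i). Y \<subseteq> X}"
        using Y finY by (auto simp: faces_def)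
      show "{X \<in> faces (Suc i). Y \<subseteq> X} \<subseteq> (\<lambda>g. insert g Y) ` ({..<N} - Y)"
      proof
        fix X assume X: "X \<in> {X \<in> faces (Suc i). Y \<subseteq> X}"
        then have "card (X - Y) = 1"
          using Y finY by (simp add: card_Diff_subset) (simp add: faces_def)
        then obtain g where "X - Y = {g}" by (rule card_1_singletonE)
        then have "X = insert g Y" "g \<in> {..<N} - Y" using X by (auto simp: faces_def)
        then show "X \<in> (\<lambda>g. insert g Y) ` ({..<N} - Y)" by blast
      qed
    qed
  qed
  note bij = this
  have elem: "the_elem (insert g Y - Y) = g" if "g \<notin> Y" for g
  proof -
    have "insert g Y - Y = {g}" using that by auto
    then show ?thesis by simp
  qed
  have "(\<Sum>X\<in>faces (Suc i). if Y \<subseteq> X then f X (the_elem (X - Y)) else 0)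
      = (\<Sum>X\<in>{X \<in> faces (Suc i). Y \<subseteq> X}. f X (the_elem (X - Y)))"
    by (rule sum.mono_neutral_cong_right) (auto simp: finite_faces)
  also have "\<dots> = (\<Sum>g\<in>{..<N} - Y. f (insert g Y) (the_elem (insert g Y - Y)))"
    by (rule sum.reindex_bij_betw[OF bij, symmetric])
  also have "\<dots> = (\<Sum>g\<in>{..<N} - Y. f (insert g Y) g)"
    by (rule sum.cong) (auto simp: elem simp del: insert_Diff_if)
  finally show ?thesis .
qed

definition taylor_complex :: "('v, 'k::field) free_complex" where
  "taylor_complex = \<lparr>
     rk = (\<lambda>i. card (faces i)),
     dg = (\<lambda>i a. int (monomial_degree (mlcm (enum i a)))),
     dif = (\<lambda>i a b. if enum i b \<subseteq> enum (Suc i) a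
       then Poly_Mapping.single (mlcm (enum (Suc i) a) - mlcm (enum i b))
              (ins_sign (the_elem (enum (Suc i) a - enum i b)) (enum i b)) else 0),
     aug = (\<lambda>a. 1)\<rparr>"

lemma taylor_complex_simps [simp]:
  "rk taylor_complex i = card (faces i)"
  "dg taylor_complex i a = int (monomial_degree (mlcm (enum i a)))"
  "aug taylor_complex a = 1"
  by (simp_all add: taylor_complex_def)

lemma dif_map_taylor:
  "dif_map taylor_complex i (vec_of (Suc i) c) = vec_of i (taylor_d (c :: _ \<Rightarrow> ('v, 'k::field) mpoly))"
proof
  fix b
  show "dif_map taylor_complex i (vec_of (Suc i) c) b = vec_of i (taylor_d c) b"
  proof (cases "b < card (faces i)")
    case True
    define Y where "Y = enum i b"
    have Y: "Y \<in> faces i" using True by (simp add: Y_def enum_in_faces)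
    let ?m = "\<lambda>X g. Poly_Mapping.single (mlcm X - mlcm Y) (ins_sign g Y) :: ('v, 'k) mpoly"
    have "dif_map taylor_complex i (vec_of (Suc i) c) b = (\<Sum>a<card (faces (Suc i)).
        vec_of (Suc i) c a * (if Y \<subseteq> enum (Suc i) a
          then ?m (enum (Suc i) a) (the_elem (enum (Suc i) a - Y)) else 0))"
      using True unfolding Y_def by (simp add: dif_map_def) (simp add: taylor_complex_def)
    also have "\<dots> = (\<Sum>X\<in>faces (Suc i). c X * (if Y \<subseteq> X then ?m X (the_elem (X - Y)) else 0))"
      by (rule sum_vec_of[where f = "\<lambda>p X. p * (if Y \<subseteq> X then ?m X (the_elem (X - Y)) else 0)"])
    also have "\<dots> = (\<Sum>X\<in>faces (Suc i). if Y \<subseteq> X then ?m X (the_elem (X - Y)) * c X else 0)"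
      by (rule sum.cong) (auto simp: mult.commute)
    also have "\<dots> = taylor_d c Y"
      unfolding taylor_d_def using Y by (rule sum_cofaces)
    finally show ?thesis using True by (simp add: vec_of_def Y_def)
  qed (simp add: dif_map_def vec_of_def)
qed

text \<open>The differential of \<open>T \<otimes> K\<close>: a matrix entry is a signed monomial,
  and its constant coefficient is nonzero only if the lcm does not change. This is the splitting by
  multidegree.\<close>

definition taylor_bd :: "(nat set \<Rightarrow> 'k::comm_ring_1) \<Rightarrow> nat set \<Rightarrow> 'k" where
  "taylor_bd \<gamma> Y = (\<Sum>g\<in>{..<N} - Y. if mlcm (insert g Y) = mlcm Y then ins_sign g Y * \<gamma> (insert g Y) else 0)"

lemma tensor_map_taylor:
  "tensor_map (taylor_complex :: ('v, 'k::field) free_complex) i (vec_of (Suc i) \<gamma>) = vec_of i (taylor_bd \<gamma>)"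
proof -
  let ?c = "\<lambda>X. Poly_Mapping.single 0 (\<gamma> X) :: ('v, 'k) mpoly"
  have red_vec_of: "red (vec_of j c) = vec_of j (\<lambda>X. Poly_Mapping.lookup (c X) 0)" for j and c :: "_ \<Rightarrow> ('v, 'k) mpoly"
    by (auto simp: red_def vec_of_def)
  have "vec_of (Suc i) \<gamma> = red (vec_of (Suc i) ?c)" by (simp add: red_vec_of)
  then have "tensor_map taylor_complex i (vec_of (Suc i) \<gamma>) = red (dif_map taylor_complex i (vec_of (Suc i) ?c))"
    by (simp only: tensor_map_red)
  also have "\<dots> = vec_of i (\<lambda>Y. Poly_Mapping.lookup (taylor_d ?c Y) 0)"
    by (simp only: dif_map_taylor red_vec_of)
  also have "\<dots> = vec_of i (taylor_bd \<gamma>)"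
    unfolding vec_of_eq_iff
  proof
    fix Y assume Y: "Y \<in> faces i"
    have "divs (mlcm (insert g Y) - mlcm Y) 0 \<longleftrightarrow> mlcm (insert g Y) = mlcm Y" for g
    proof
      assume "divs (mlcm (insert g Y) - mlcm Y) 0"
      then have "divs (mlcm (insert g Y)) (mlcm Y)" by (simp add: divs_def lookup_minus)
      moreover have "divs (mlcm Y) (mlcm (insert g Y))"
        using finite_face[OF Y] by (intro mlcm_mono) auto
      ultimately show "mlcm (insert g Y) = mlcm Y" by (rule divs_antisym)
    qed (simp add: divs_refl)
    then show "Poly_Mapping.lookup (taylor_d ?c Y) 0 = taylor_bd \<gamma> Y"
      by (simp add: taylor_d_def taylor_bd_def lookup_sum lookup_single_mult cong: if_cong)
  qed
  finally show ?thesis .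
qed

section \<open>The monomial ideal and exactness\<close>

definition gen_ideal :: "('v, 'k::field) mpoly set" where
  "gen_ideal = ideal.span ((\<lambda>i. Poly_Mapping.single (gen i) 1) ` {..<N})"

text \<open>Multiples of a generator have only monomials divisible by it, and each such monomial is
  a multiple; so membership is decided monomial by monomial.\<close>

lemma gen_ideal_iff: "p \<in> gen_ideal \<longleftrightarrow> (\<forall>n\<in>Poly_Mapping.keys p. below n \<noteq> {})"
proof
  assume "p \<in> gen_ideal"
  then show "\<forall>n\<in>Poly_Mapping.keys p. below n \<noteq> {}"
    unfolding gen_ideal_def
  proof (induction p rule: ideal.span_induct_alt)
    case base
    then show ?case by simp
  next
    case (step c x y)
    then obtain i where i: "i < N" "x = Poly_Mapping.single (gen i) 1" by auto
    show ?case
    proof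
      fix n assume "n \<in> Poly_Mapping.keys (c * x + y)"
      then consider "n \<in> Poly_Mapping.keys (c * x)" | "n \<in> Poly_Mapping.keys y"
        using keys_add[of "c * x" y] by blast
      then show "below n \<noteq> {}"
      proof cases
        case 1
        then obtain a where "n = a + gen i" using keys_mult[of c x] i by auto
        then have "i \<in> below n" using i by (simp add: below_def divs_add)
        then show ?thesis by blast
      qed (use step in blast)
    qed
  qed
next
  assume below: "\<forall>n\<in>Poly_Mapping.keys p. below n \<noteq> {}"
  have "(\<Sum>n\<in>Poly_Mapping.keys p. Poly_Mapping.single n (Poly_Mapping.lookup p n)) \<in> gen_ideal"
    unfolding gen_ideal_def
  proof (rule ideal.span_sum)
    fix n assume "n \<in> Poly_Mapping.keys p"
    then obtain i where i: "i < N" "divs (gen i) n" using below by (auto simp: below_def)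
    then have "Poly_Mapping.single n (Poly_Mapping.lookup p n)
        = Poly_Mapping.single (n - gen i) (Poly_Mapping.lookup p n) * Poly_Mapping.single (gen i) 1"
      by (simp add: mult_single divs_diff_add)
    then show "Poly_Mapping.single n (Poly_Mapping.lookup p n)
        \<in> ideal.span ((\<lambda>i. Poly_Mapping.single (gen i) 1) ` {..<N})"
      using i by (simp add: ideal.span_scale ideal.span_base)
  qed
  then show "p \<in> gen_ideal" by (simp add: mpoly_expand)
qed

lemma homogeneous_gen_ideal: "homogeneous_ideal gen_ideal"
  unfolding homogeneous_ideal_def
proof (intro conjI ballI allI)
  show "ideal.subspace gen_ideal" by (simp add: gen_ideal_def)
  show "hpart d p \<in> gen_ideal" if "p \<in> gen_ideal" for p d
    using that by (auto simp: gen_ideal_iff in_keys_iff lookup_hpart split: if_splits)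
qed

lemma aug_map_taylor: "aug_map taylor_complex (vec_of 0 c) = c {}"
proof -
  have "aug_map taylor_complex (vec_of 0 c) = (\<Sum>a<card (faces 0). vec_of 0 c a)"
    by (simp add: aug_map_def)
  also have "\<dots> = (\<Sum>X\<in>faces 0. c X)" by (rule sum_vec_of[where f = "\<lambda>p X. p"])
  finally show ?thesis by (simp add: faces_0)
qed

lemma taylor_resolution: "graded_free_resolution gen_ideal (taylor_complex :: ('v, 'k::field) free_complex)"
proof -
  let ?T = "taylor_complex :: ('v, 'k) free_complex"
  have step: "(\<exists>b. vec_of i c = dif_map ?T i (vec_of (Suc i) b))"
    if supp: "\<And>Y. Y \<notin> faces i \<Longrightarrow> c Y = 0"
      and cycle: "case i of 0 \<Rightarrow> c {} \<in> gen_ideal | Suc i' \<Rightarrow> dif_map ?T i' (vec_of i c) = 0"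
    for i and c :: "nat set \<Rightarrow> ('v, 'k) mpoly"
  proof -
    have "taylor_d c Y = 0" if Y: "Y \<subseteq> {..<N}" for Y
    \<comment> \<open>Only faces with one vertex less than \<open>i\<close> have cofaces in the
      support of \<open>c\<close>; for all other \<open>Y\<close> the sum is trivially
      \<open>0\<close>.\<close>
    proof (cases "\<exists>i'. i = Suc i' \<and> Y \<in> faces i'")
      case True
      then obtain i' where i': "i = Suc i'" "Y \<in> faces i'" by blast
      then have "vec_of i' (taylor_d c) = vec_of i' 0"
        using cycle by (simp add: dif_map_taylor vec_of_0)
      then show ?thesis using i' by (simp add: vec_of_eq_iff)
    next
      case False
      have "insert g Y \<notin> faces i" if "g \<in> {..<N} - Y" for g
        using False that Y finite_subset[OF Y] by (auto simp: faces_def)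
      then show ?thesis by (simp add: taylor_d_def supp)
    qed
    moreover have "below n \<noteq> {}" if n: "n \<in> Poly_Mapping.keys (c {})" for n
    proof (cases i)
      case 0
      then show ?thesis using cycle n by (simp add: gen_ideal_iff)
    next
      case (Suc i')
      then have "c {} = 0" by (intro supp) (simp add: faces_def)
      then show ?thesis using n by simp
    qed
    ultimately obtain b where b: "\<And>Y. Y \<subseteq> {..<N} \<Longrightarrow> taylor_d b Y = c Y"
      using taylor_exact[of i c] supp by metis
    then have "vec_of i c = dif_map ?T i (vec_of (Suc i) b)"
      by (simp add: dif_map_taylor vec_of_eq_iff faces_def)
    then show ?thesis by blast
  qed
  have image: "dif_map ?T i ` vecs (card (faces (Suc i)))
      = {v \<in> vecs (card (faces i)). case i of 0 \<Rightarrow> aug_map ?T v \<in> gen_ideal | Suc i' \<Rightarrow> dif_map ?T i' v = 0}" for i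
  proof (intro equalityI subsetI)
    fix w assume "w \<in> dif_map ?T i ` vecs (card (faces (Suc i)))"
    then obtain v where v: "v \<in> vecs (card (faces (Suc i)))" "w = dif_map ?T i v" by blast
    obtain b where "v = vec_of (Suc i) b" by (rule vecs_eq_vec_of[OF v(1)])
    with v(2) have w: "w = vec_of i (taylor_d b)" by (simp add: dif_map_taylor)
    have "aug_map ?T w \<in> gen_ideal" if "i = 0"
    proof -
      have "below n \<noteq> {}" if n: "n \<in> Poly_Mapping.keys (taylor_d b {})" for n
      proof
        assume "below n = {}"
        then have "strand n (taylor_d b) {} = 0"
          by (simp add: strand_taylor_d simplex_bd_def)
        then show False using n by (simp add: strand_def mlcm_empty divs_def in_keys_iff)
      qed
      then show ?thesis using that by (simp add: w aug_map_taylor gen_ideal_iff)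
    qed
    moreover have "dif_map ?T i' w = 0" if "i = Suc i'" for i'
    proof -
      have "vec_of i' (taylor_d (taylor_d b)) = vec_of i' 0"
        unfolding vec_of_eq_iff by (simp add: taylor_d_taylor_d faces_def)
      then show ?thesis by (simp add: w that dif_map_taylor vec_of_0)
    qed
    ultimately show "w \<in> {v \<in> vecs (card (faces i)). case i of 0 \<Rightarrow> aug_map ?T v \<in> gen_ideal | Suc i' \<Rightarrow> dif_map ?T i' v = 0}"
      by (simp add: w vec_of_in_vecs split: nat.split)
  next
    fix w assume w: "w \<in> {v \<in> vecs (card (faces i)). case i of 0 \<Rightarrow> aug_map ?T v \<in> gen_ideal | Suc i' \<Rightarrow> dif_map ?T i' v = 0}"
    then have "w \<in> vecs (card (faces i))" by blast
    then obtain c where c: "w = vec_of i c" "\<And>Y. Y \<notin> faces i \<Longrightarrow> c Y = 0"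
      by (rule vecs_eq_vec_of) (rule that)
    have "case i of 0 \<Rightarrow> c {} \<in> gen_ideal | Suc i' \<Rightarrow> dif_map ?T i' (vec_of i c) = 0"
      using w c(1) by (auto simp: aug_map_taylor split: nat.splits)
    with step[of i c] c obtain b where "w = dif_map ?T i (vec_of (Suc i) b)" by blast
    then show "w \<in> dif_map ?T i ` vecs (card (faces (Suc i)))"
      using vec_of_in_vecs by blast
  qed
  show ?thesis
    unfolding graded_free_resolution_def
  proof (intro conjI allI impI ballI)
    fix i a b m assume "a < rk ?T (Suc i)" "b < rk ?T i" "m \<in> Poly_Mapping.keys (dif ?T i a b)"
    then have m: "m = mlcm (enum (Suc i) a) - mlcm (enum i b)" and "enum i b \<subseteq> enum (Suc i) a"
      and "enum (Suc i) a \<in> faces (Suc i)"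
      by (auto simp: taylor_complex_def enum_in_faces split: if_splits)
    then have "m + mlcm (enum i b) = mlcm (enum (Suc i) a)"
      using finite_face by (simp add: divs_diff_add mlcm_mono)
    then show "int (monomial_degree m) + dg ?T i b = dg ?T (Suc i) a"
      by (metis monomial_degree_add of_nat_add taylor_complex_simps(2))
  next
    fix a m assume "a < rk ?T 0" "m \<in> Poly_Mapping.keys (aug ?T a)"
    moreover from this have "enum 0 a = {}" using enum_in_faces[of a 0] by (simp add: faces_0)
    ultimately show "int (monomial_degree m) = dg ?T 0 a" by (simp add: mlcm_empty)
  next
    fix f :: "('v, 'k) mpoly"
    have "f - aug_map ?T (vec_of 0 (\<lambda>_. f)) \<in> gen_ideal"
      by (simp add: aug_map_taylor gen_ideal_iff)
    then show "\<exists>v\<in>vecs (rk ?T 0). f - aug_map ?T v \<in> gen_ideal"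
      using vec_of_in_vecs by (metis taylor_complex_simps(1))
  next
    show "{v \<in> vecs (rk ?T 0). aug_map ?T v \<in> gen_ideal} = dif_map ?T 0 ` vecs (rk ?T 1)"
      using image[of 0] by simp
  next
    fix i
    show "{v \<in> vecs (rk ?T (Suc i)). dif_map ?T i v = 0} = dif_map ?T (Suc i) ` vecs (rk ?T (Suc (Suc i)))"
      using image[of "Suc i"] by simp
  qed
qed

end

section \<open>Cochains on lists\<close>

definition del :: "nat \<Rightarrow> 'a list \<Rightarrow> 'a list" where
  "del i l = take i l @ drop (Suc i) l"

text \<open>The simplicial coboundary on ordered simplices: a cochain of degree \<open>p\<close> is
  evaluated on lists of \<open>p + 1\<close> vertices, with repetitions allowed.\<close>

definition cobd :: "('a list \<Rightarrow> int) \<Rightarrow> 'a list \<Rightarrow> int" where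
  "cobd f l = (\<Sum>i<length l. (- 1) ^ i * f (del i l))"

lemma del_map: "del i (map h l) = map h (del i l)"
  by (simp add: del_def take_map drop_map)

lemma cobd_map: "cobd (\<lambda>l. f (map h l)) l = cobd f (map h l)"
  by (simp add: cobd_def del_map)

lemma sum_lessThan_add:
  "(\<Sum>i<m + n. f i) = (\<Sum>i<m. f i) + (\<Sum>j<n. f (m + j))" for f :: "nat \<Rightarrow> 'a::comm_monoid_add"
  by (induction n) (simp_all add: add.assoc)

text \<open>Leibniz rule for the Alexander--Whitney product. Deletions up to position
  \<open>p\<close> change only the front face, later ones only the back face; the two terms that
  complete the coboundaries of the factors, the last for \<open>f\<close> and the first for
  \<open>g\<close>, cancel.\<close>

lemma cobd_cup:
  assumes len: "length l = p + q + 2"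
  shows "cobd (\<lambda>l. f (take (Suc p) l) * g (drop p l)) l =
    cobd f (take (p + 2) l) * g (drop (Suc p) l) + (- 1) ^ p * f (take (Suc p) l) * cobd g (drop p l)"
proof -
  let ?F = "f (take (Suc p) l)" and ?G = "g (drop (Suc p) l)"
  have low: "f (take (Suc p) (del i l)) * g (drop p (del i l)) = f (del i (take (p + 2) l)) * ?G"
    if "i \<le> p" for i
  proof -
    have "take (Suc p) (del i l) = del i (take (p + 2) l)"
      using that len by (simp add: del_def take_drop min_def)
    moreover have "drop p (del i l) = drop (Suc p) l"
      using that len by (simp add: del_def)
    ultimately show ?thesis by simp
  qed
  have high: "f (take (Suc p) (del (p + Suc j) l)) * g (drop p (del (p + Suc j) l)) = ?F * g (del (Suc j) (drop p l))"
    if "j \<le> q" for j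
  proof -
    have "take (Suc p) (del (p + Suc j) l) = take (Suc p) l"
      using that len by (simp add: del_def min_def)
    moreover have "drop p (del (p + Suc j) l) = del (Suc j) (drop p l)"
      using that len by (simp add: del_def drop_take add.commute)
    ultimately show ?thesis by simp
  qed
  have "cobd (\<lambda>l. f (take (Suc p) l) * g (drop p l)) l
      = (\<Sum>i<Suc p + Suc q. (- 1) ^ i * (f (take (Suc p) (del i l)) * g (drop p (del i l))))"
    using len by (simp add: cobd_def)
  also have "\<dots> = (\<Sum>i<Suc p. (- 1) ^ i * (f (take (Suc p) (del i l)) * g (drop p (del i l))))
      + (\<Sum>j<Suc q. (- 1) ^ (p + Suc j) * (f (take (Suc p) (del (p + Suc j) l)) * g (drop p (del (p + Suc j) l))))"
    unfolding sum_lessThan_add by (simp only: add_Suc add_Suc_right)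
  also have "\<dots> = (\<Sum>i<Suc p. (- 1) ^ i * f (del i (take (p + 2) l))) * ?G
      + (- 1) ^ p * ?F * (\<Sum>j<Suc q. (- 1) ^ Suc j * g (del (Suc j) (drop p l)))"
    unfolding sum_distrib_left sum_distrib_right
    by (intro arg_cong2[of _ _ _ _ "(+)"] sum.cong refl; simp only: lessThan_iff less_Suc_eq_le low high)
      (simp_all only: power_add mult_ac)
  also have "(\<Sum>i<Suc p. (- 1) ^ i * f (del i (take (p + 2) l))) = cobd f (take (p + 2) l) - (- 1) ^ Suc p * ?F"
  proof -
    have "cobd f (take (p + 2) l) = (\<Sum>i<Suc (Suc p). (- 1) ^ i * f (del i (take (p + 2) l)))"
      using len by (simp add: cobd_def)
    moreover have "del (Suc p) (take (p + 2) l) = take (Suc p) l"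
      using len by (simp add: del_def min_def)
    ultimately show ?thesis by simp
  qed
  also have "(\<Sum>j<Suc q. (- 1) ^ Suc j * g (del (Suc j) (drop p l))) = cobd g (drop p l) - ?G"
  proof -
    have "cobd g (drop p l) = (\<Sum>i<Suc (Suc q). (- 1) ^ i * g (del i (drop p l)))"
      using len by (simp add: cobd_def)
    also have "\<dots> = g (del 0 (drop p l)) + (\<Sum>j<Suc q. (- 1) ^ Suc j * g (del (Suc j) (drop p l)))"
      by (simp only: sum.lessThan_Suc_shift power_0 mult_1)
    also have "del 0 (drop p l) = drop (Suc p) l" by (simp add: del_def)
    finally show ?thesis by simp
  qed
  finally show ?thesis by (simp add: algebra_simps)
qed

text \<open>The sign of the permutation that sorts the list, or \<open>0\<close> if there are repetitions.\<close>

fun alt_sign :: "nat list \<Rightarrow> int" where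
  "alt_sign [] = 1"
| "alt_sign (x # xs) = (\<Prod>y\<leftarrow>xs. sgn (int y - int x)) * alt_sign xs"

lemma alt_sign_eq_0_iff: "alt_sign l = 0 \<longleftrightarrow> \<not> distinct l"
  by (induction l) (auto simp: prod_list_zero_iff sgn_eq_0_iff)

lemma abs_alt_sign: "distinct l \<Longrightarrow> \<bar>alt_sign l\<bar> = 1"
proof (induction l)
  case (Cons x xs)
  have "x \<notin> set ys \<Longrightarrow> \<bar>\<Prod>y\<leftarrow>ys. sgn (int y - int x)\<bar> = 1" for ys
    by (induction ys) (auto simp: abs_mult abs_sgn_eq)
  with Cons show ?case by (simp add: abs_mult)
qed simp

lemma alt_sign_swap: "alt_sign (xs @ a # b # ys) = - alt_sign (xs @ b # a # ys)"
  by (induction xs) (simp_all add: sgn_if)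

lemma alt_sign_move: "alt_sign (xs @ a # ys @ zs) = (- 1) ^ length ys * alt_sign (xs @ ys @ a # zs)"
proof (induction ys arbitrary: xs)
  case (Cons b ys)
  have "alt_sign (xs @ a # (b # ys) @ zs) = - alt_sign ((xs @ [b]) @ a # ys @ zs)"
    using alt_sign_swap[of xs a b "ys @ zs"] by simp
  also have "\<dots> = (- 1) ^ length (b # ys) * alt_sign (xs @ (b # ys) @ a # zs)"
    by (simp only: Cons.IH) simp
  finally show ?case .
qed simp

text \<open>Some entry occurs twice, so only the deletion of one of the two copies can leave a list
  without repetition. The two results differ by moving the entry past \<open>ys\<close>, and the
  signs cancel.\<close>

lemma cobd_alt_sign:
  assumes "length l = Suc k" "set l \<subseteq> {..<k}"
  shows "cobd alt_sign l = 0"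
proof -
  have "card (set l) < length l"
    using card_mono[OF _ assms(2)] assms(1) by simp
  then have "\<not> distinct l" using distinct_card by fastforce
  then obtain xs ys zs a where l: "l = xs @ [a] @ ys @ [a] @ zs"
    using not_distinct_decomp by blast
  define p q where "p = length xs" and "q = Suc (length xs + length ys)"
  have "alt_sign (del i l) = 0" if i: "i < length l" "i \<noteq> p" "i \<noteq> q" for i
  proof -
    consider "i < p" | "p < i" "i < q" | "q < i" using i by linarith
    then have "\<not> distinct (del i l)"
    proof cases
      case 1
      then show ?thesis by (simp add: l del_def p_def)
    next
      case 2
      then have "take i l = xs @ [a] @ take (i - Suc p) ys"
        by (simp add: l p_def q_def take_Cons')
      moreover have "drop (Suc i) l = drop (i - p) ys @ [a] @ zs"
        using 2 by (auto simp: l p_def q_def drop_Cons' Suc_diff_le)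
      ultimately show ?thesis by (simp add: del_def)
    next
      case 3
      then have "take i l = xs @ [a] @ ys @ [a] @ take (i - Suc q) zs"
        by (auto simp: l q_def take_Cons')
      then show ?thesis by (simp add: del_def)
    qed
    then show ?thesis by (simp add: alt_sign_eq_0_iff)
  qed
  then have "cobd alt_sign l = (\<Sum>i\<in>{p, q}. (- 1) ^ i * alt_sign (del i l))"
    unfolding cobd_def by (intro sum.mono_neutral_right) (auto simp: l p_def q_def)
  moreover have "del p l = xs @ ys @ a # zs" by (simp add: l del_def p_def)
  moreover have "del q l = xs @ a # ys @ zs" by (simp add: l del_def q_def)
  ultimately have "cobd alt_sign l = (- 1) ^ p * alt_sign (xs @ ys @ a # zs) + (- 1) ^ q * alt_sign (xs @ a # ys @ zs)"
    by (simp add: p_def q_def)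
  also have "\<dots> = 0" by (simp add: alt_sign_move p_def q_def power_add)
  finally show ?thesis .
qed

text \<open>Parity of the inversions of a word with repeated letters; equal letters do not count. It
  orients the cell of the staircase path with this word.\<close>

fun inv_sign :: "nat list \<Rightarrow> int" where
  "inv_sign [] = 1"
| "inv_sign (x # xs) = (\<Prod>y\<leftarrow>xs. if y < x then - 1 else 1) * inv_sign xs"

lemma abs_inv_sign: "\<bar>inv_sign w\<bar> = 1"
proof (induction w)
  case (Cons x xs)
  have "\<bar>\<Prod>y\<leftarrow>ys. if y < x then - 1 else 1 :: int\<bar> = 1" for ys
    by (induction ys) (auto simp: abs_mult)
  with Cons show ?case by (simp add: abs_mult)
qed simp

lemma inv_sign_swap: "a \<noteq> b \<Longrightarrow> inv_sign (xs @ a # b # ys) = - inv_sign (xs @ b # a # ys)"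
  by (induction xs) auto

lemma abs_prod_eq_1: "(\<And>i. i < n \<Longrightarrow> \<bar>f i\<bar> = 1) \<Longrightarrow> \<bar>\<Prod>i<n. f i\<bar> = 1" for f :: "nat \<Rightarrow> int"
  by (induction n) (simp_all add: abs_mult)

lemma take_Suc_count_list:
  "t < length w \<Longrightarrow> count_list (take (Suc t) w) c = count_list (take t w) c + (if w ! t = c then 1 else 0)"
  by (simp add: take_Suc_conv_app_nth)

lemma count_list_take_mono: "t \<le> t' \<Longrightarrow> count_list (take t w) c \<le> count_list (take t' w) c"
  by (metis count_list_append le_add1 le_add_diff_inverse take_add)

text \<open>Discrete intermediate value theorem: the count starts at \<open>0\<close> and grows by
  at most one per step.\<close>

lemma count_list_take_attained:
  "t \<le> length w \<Longrightarrow> a \<le> count_list (take t w) c \<Longrightarrow> \<exists>t'\<le>t. count_list (take t' w) c = a"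
proof (induction t)
  case (Suc t)
  show ?case
  proof (cases "a \<le> count_list (take t w) c")
    case True
    then show ?thesis using Suc by (auto intro: le_SucI)
  next
    case False
    then have "count_list (take (Suc t) w) c = a"
      using Suc.prems by (simp add: take_Suc_count_list split: if_splits)
    then show ?thesis by blast
  qed
qed simp

lemma sorted_list_of_set_remove_nth:
  fixes X :: "nat set"
  assumes "finite X" "i < card X"
  shows "sorted_list_of_set (X - {sorted_list_of_set X ! i}) = del i (sorted_list_of_set X)"
proof -
  let ?l = "sorted_list_of_set X"
  have i: "i < length ?l" using assms by simp
  have l: "?l = take i ?l @ ?l ! i # drop (Suc i) ?l" using i by (rule id_take_nth_drop)
  have "distinct ?l" by simp
  then have "?l ! i \<notin> set (take i ?l)" by (subst (asm) l) auto
  then have "remove1 (?l ! i) ?l = del i ?l"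
    by (subst (2) l) (simp add: remove1_append del_def)
  then show ?thesis using assms by (simp add: sorted_list_of_set_remove)
qed

text \<open>The signs on vertex sets count smaller vertices; this identifies them with the
  alternating signs of \<open>cobd\<close> on the sorted list.\<close>

lemma card_less_nth_sorted_list_of_set:
  fixes X :: "nat set"
  assumes "finite X" "i < card X"
  shows "card {y \<in> X. y < sorted_list_of_set X ! i} = i"
proof -
  let ?l = "sorted_list_of_set X"
  have less: "?l ! a < ?l ! b \<longleftrightarrow> a < b" if "a < card X" "b < card X" for a b
    using that sorted_wrt_nth_less[OF strict_sorted_list_of_set[of X], of a b]
      sorted_wrt_nth_less[OF strict_sorted_list_of_set[of X], of b a]
    by (metis length_sorted_list_of_set less_asym linorder_neqE_nat)
  have X: "X = (\<lambda>j. ?l ! j) ` {..<card X}"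
    using set_sorted_list_of_set[OF assms(1)] by (auto simp: set_conv_nth)
  have "{y \<in> X. y < ?l ! i} = (\<lambda>j. ?l ! j) ` {..<i}"
  proof (intro equalityI subsetI)
    fix y assume y: "y \<in> {y \<in> X. y < ?l ! i}"
    then obtain j where "j < card X" "y = ?l ! j" using X by auto
    then show "y \<in> (\<lambda>j. ?l ! j) ` {..<i}" using y less assms(2) by auto
  next
    fix y assume "y \<in> (\<lambda>j. ?l ! j) ` {..<i}"
    then obtain j where j: "j < i" "y = ?l ! j" by auto
    moreover have "y \<in> X" using X j assms(2) by auto
    ultimately show "y \<in> {y \<in> X. y < ?l ! i}" using less assms(2) by simp
  qed
  moreover have "inj_on (\<lambda>j. ?l ! j) {..<i}"
  proof (rule linorder_inj_onI')
    fix a b assume "a \<in> {..<i}" "b \<in> {..<i}" "a < b"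
    then have "?l ! a < ?l ! b" using less assms(2) by simp
    then show "?l ! a \<noteq> ?l ! b" by simp
  qed
  ultimately show ?thesis by (simp add: card_image)
qed

section \<open>The fundamental class of a product of simplices\<close>

text \<open>
  The points \<open>v\<close> with \<open>v c < k\<close> for \<open>c < s\<close> are the vertices of a product of \<open>s\<close> simplices of
  dimension \<open>k - 1\<close>; they are numbered by \<open>idx\<close>, and \<open>coord\<close> recovers the point from its number.
  A set of vertices is covering iff it is contained in no facet of the product.
\<close>

locale grid =
  fixes s k :: nat and idx :: "(nat \<Rightarrow> nat) \<Rightarrow> nat" and coord :: "nat \<Rightarrow> nat \<Rightarrow> nat" and G :: "nat set"
  assumes s: "0 < s" and k: "0 < k" and finite_G: "finite G"
    and idx_in: "(\<And>c. c < s \<Longrightarrow> v c < k) \<Longrightarrow> idx v \<in> G"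
    and coord_idx: "(\<And>c. c < s \<Longrightarrow> v c < k) \<Longrightarrow> c < s \<Longrightarrow> coord (idx v) c = v c"
    and idx_less: "(\<And>c. c < s \<Longrightarrow> v' c < k) \<Longrightarrow> (\<And>c. c < s \<Longrightarrow> v c \<le> v' c) \<Longrightarrow> c < s \<Longrightarrow> v c < v' c
      \<Longrightarrow> idx v < idx v'"
    and coord_less: "g \<in> G \<Longrightarrow> c < s \<Longrightarrow> coord g c < k"
begin

section \<open>The product cocycle\<close>

definition dim_cell :: nat where
  "dim_cell = s * (k - 1)"

definition covering :: "nat set \<Rightarrow> bool" where
  "covering S \<longleftrightarrow> (\<forall>c<s. \<forall>a<k. \<exists>g\<in>S. coord g c = a)"

text \<open>The cup product of the pullbacks of the fundamental cochains of the factors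
  (Alexander--Whitney formula).\<close>

fun cup_power :: "nat \<Rightarrow> nat list \<Rightarrow> int" where
  "cup_power 0 l = 1"
| "cup_power (Suc c) l = cup_power c (take (Suc (c * (k - 1))) l) *
     alt_sign (map (\<lambda>g. coord g c) (drop (c * (k - 1)) l))"

text \<open>Leibniz rule and induction on the number of factors. Each factor is closed because
  \<open>Suc k\<close> vertices have coordinates below \<open>k\<close>; the empty product is the
  constant \<open>1\<close>, closed on lists of two vertices.\<close>

lemma cobd_cup_power:
  "c \<le> s \<Longrightarrow> length l = c * (k - 1) + 2 \<Longrightarrow> set l \<subseteq> G \<Longrightarrow> cobd (cup_power c) l = 0"
proof (induction c arbitrary: l)
  case 0
  then show ?case by (simp add: cobd_def numeral_2_eq_2)
next
  case (Suc c)
  let ?p = "c * (k - 1)" and ?f = "\<lambda>l. alt_sign (map (\<lambda>g. coord g c) l)"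
  have len: "length l = ?p + (k - 1) + 2" using Suc.prems by simp
  have set: "set (take (?p + 2) l) \<subseteq> G" "set (drop ?p l) \<subseteq> G"
    using Suc.prems set_take_subset[of _ l] set_drop_subset[of _ l] by blast+
  have 1: "cobd (cup_power c) (take (?p + 2) l) = 0"
    using Suc.prems set by (intro Suc.IH) auto
  have 2: "cobd ?f (drop ?p l) = 0"
    unfolding cobd_map
  proof (rule cobd_alt_sign)
    show "length (map (\<lambda>g. coord g c) (drop ?p l)) = Suc k" using len k by simp
    show "set (map (\<lambda>g. coord g c) (drop ?p l)) \<subseteq> {..<k}"
      using set(2) coord_less[of _ c] Suc.prems(1) by auto
  qed
  have "cobd (\<lambda>l. cup_power c (take (Suc ?p) l) * ?f (drop ?p l)) l = 0"
    unfolding cobd_cup[OF len, of "cup_power c" ?f] 1 2 by simp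
  moreover have "cup_power (Suc c) = (\<lambda>l. cup_power c (take (Suc ?p) l) * ?f (drop ?p l))"
    by (simp add: fun_eq_iff)
  ultimately show ?case by (simp only:)
qed

text \<open>A nonzero factor sees \<open>k\<close> vertices with distinct coordinates below
  \<open>k\<close>, hence all values. So the product is a relative cochain: it vanishes on sets
  inside a facet.\<close>

lemma cup_power_covering:
  "c \<le> s \<Longrightarrow> length l = c * (k - 1) + 1 \<Longrightarrow> set l \<subseteq> G \<Longrightarrow> cup_power c l \<noteq> 0
    \<Longrightarrow> c' < c \<Longrightarrow> a < k \<Longrightarrow> \<exists>g\<in>set l. coord g c' = a"
proof (induction c arbitrary: l)
  case (Suc c)
  let ?p = "c * (k - 1)"
  have nz: "cup_power c (take (Suc ?p) l) \<noteq> 0" "distinct (map (\<lambda>g. coord g c) (drop ?p l))"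
    using Suc.prems(4) by (auto simp: alt_sign_eq_0_iff)
  show ?case
  proof (cases "c' = c")
    case True
    let ?m = "map (\<lambda>g. coord g c) (drop ?p l)"
    have "set ?m \<subseteq> {..<k}"
      using Suc.prems(1,3) coord_less[of _ c] set_drop_subset[of ?p l] by auto
    moreover have "length ?m = k" using Suc.prems(2) k by simp
    then have "card (set ?m) = k" using nz(2) distinct_card by metis
    ultimately have "set ?m = {..<k}" by (intro card_subset_eq) auto
    then have "a \<in> set ?m" using Suc.prems(6) by simp
    then show ?thesis using True set_drop_subset[of ?p l] by auto
  next
    case False
    then have "\<exists>g\<in>set (take (Suc ?p) l). coord g c' = a"
      using Suc.prems set_take_subset[of "Suc ?p" l] nz(1) by (intro Suc.IH) auto
    then show ?thesis using set_take_subset[of "Suc ?p" l] by blast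
  qed
qed simp

text \<open>The value on an unordered simplex is taken on its increasing list, in agreement with the
  signs of the Taylor complex.\<close>

definition cocycle :: "nat set \<Rightarrow> int" where
  "cocycle S = (if S \<subseteq> G \<and> card S = Suc dim_cell then cup_power s (sorted_list_of_set S) else 0)"

lemma cocycle_covering: "cocycle S \<noteq> 0 \<Longrightarrow> S \<subseteq> G \<and> covering S"
  using cup_power_covering[of s "sorted_list_of_set S"] finite_G
  by (auto simp: cocycle_def covering_def dim_cell_def finite_subset split: if_splits)

lemma cocycle_condition:
  assumes X: "X \<subseteq> G" "card X = dim_cell + 2"
  shows "(\<Sum>g\<in>X. (- 1) ^ card {y \<in> X. y < g} * cocycle (X - {g})) = 0"
proof -
  have fin: "finite X" using X finite_G finite_subset by blast
  let ?l = "sorted_list_of_set X"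
  have bij: "bij_betw (\<lambda>i. ?l ! i) {..<card X} X"
    using bij_betw_nth[of ?l "{..<card X}" X] fin by simp
  have "(\<Sum>g\<in>X. (- 1) ^ card {y \<in> X. y < g} * cocycle (X - {g}))
      = (\<Sum>i<card X. (- 1) ^ card {y \<in> X. y < ?l ! i} * cocycle (X - {?l ! i}))"
    by (rule sum.reindex_bij_betw[OF bij, symmetric])
  also have "\<dots> = (\<Sum>i<card X. (- 1) ^ i * cup_power s (del i ?l))"
  proof (rule sum.cong[OF refl])
    fix i assume i: "i \<in> {..<card X}"
    then have "?l ! i \<in> X" using bij by (auto simp: bij_betw_def)
    then have "cocycle (X - {?l ! i}) = cup_power s (del i ?l)"
      using i X fin sorted_list_of_set_remove_nth[of X i] by (auto simp: cocycle_def)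
    then show "(- 1) ^ card {y \<in> X. y < ?l ! i} * cocycle (X - {?l ! i}) = (- 1) ^ i * cup_power s (del i ?l)"
      using i fin by (simp add: card_less_nth_sorted_list_of_set)
  qed
  also have "\<dots> = cobd (cup_power s) ?l" using fin by (simp add: cobd_def)
  also have "\<dots> = 0" using X fin by (intro cobd_cup_power) (auto simp: dim_cell_def)
  finally show ?thesis .
qed

text \<open>
  The cells of the staircase triangulation are the monotone lattice paths from \<open>(0, \<dots>, 0)\<close> to
  \<open>(k - 1, \<dots>, k - 1)\<close>; a path is encoded by the word of directions of its steps.
\<close>

definition words :: "nat list set" where
  "words = {w. length w = dim_cell \<and> set w \<subseteq> {..<s} \<and> (\<forall>c<s. count_list w c = k - 1)}"

definition vtx :: "nat list \<Rightarrow> nat \<Rightarrow> nat" where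
  "vtx w t = idx (count_list (take t w))"

definition path :: "nat list \<Rightarrow> nat set" where
  "path w = vtx w ` {..dim_cell}"

text \<open>The sum over the fibre of \<open>path\<close> spares a proof that a path determines its
  word.\<close>

definition staircase :: "nat set \<Rightarrow> int" where
  "staircase S = (\<Sum>w\<in>{w \<in> words. path w = S}. inv_sign w)"

lemma finite_words: "finite words"
  by (rule finite_subset[OF _ finite_lists_length_eq[of "{..<s}" dim_cell]]) (auto simp: words_def)

lemma count_take_less: "w \<in> words \<Longrightarrow> c < s \<Longrightarrow> count_list (take t w) c < k"
  using count_list_take_mono[of t "max t (length w)" w c] k by (auto simp: words_def)

lemma vtx_in: "w \<in> words \<Longrightarrow> vtx w t \<in> G"
  unfolding vtx_def by (intro idx_in count_take_less)

lemma coord_vtx: "w \<in> words \<Longrightarrow> c < s \<Longrightarrow> coord (vtx w t) c = count_list (take t w) c"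
  unfolding vtx_def by (intro coord_idx count_take_less)

text \<open>A step raises the coordinate of its direction and lowers none, so
  \<open>idx_less\<close> applies.\<close>

lemma vtx_less:
  assumes "w \<in> words" "t < t'" "t' \<le> dim_cell"
  shows "vtx w t < vtx w t'"
  unfolding vtx_def
proof (rule idx_less)
  have t: "t < length w" using assms by (simp add: words_def)
  then have "w ! t \<in> set w" by simp
  then show "w ! t < s" using assms(1) by (auto simp: words_def)
  show "count_list (take t w) (w ! t) < count_list (take t' w) (w ! t)"
    using count_list_take_mono[of "Suc t" t' w "w ! t"] take_Suc_count_list[OF t, of "w ! t"] assms(2)
    by simp
qed (use assms in \<open>auto intro: count_take_less count_list_take_mono\<close>)

lemma inj_on_vtx: "w \<in> words \<Longrightarrow> inj_on (vtx w) {..dim_cell}"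
  by (rule linorder_inj_onI') (force dest: vtx_less)

lemma card_path: "w \<in> words \<Longrightarrow> card (path w) = Suc dim_cell"
  by (simp add: path_def card_image inj_on_vtx)

lemma path_subset: "w \<in> words \<Longrightarrow> path w \<subseteq> G"
  using vtx_in by (auto simp: path_def)

lemma covering_path:
  assumes w: "w \<in> words"
  shows "covering (path w)"
  unfolding covering_def
proof (intro allI impI)
  fix c a assume c: "c < s" "a < k"
  have "\<exists>t\<le>length w. count_list (take t w) c = a"
    using w c by (intro count_list_take_attained) (auto simp: words_def)
  then show "\<exists>g\<in>path w. coord g c = a"
    using w c(1) by (auto simp: path_def coord_vtx words_def)
qed

lemma sorted_list_of_path:
  assumes w: "w \<in> words"
  shows "sorted_list_of_set (path w) = map (vtx w) [0..<Suc dim_cell]"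
proof (rule sorted_list_of_set_unique[THEN iffD1])
  have "sorted_wrt (<) (map (vtx w) [0..<Suc dim_cell])"
    using w by (auto simp: sorted_wrt_iff_nth_less nth_append vtx_less simp del: upt_Suc)
  then show "sorted_wrt (<) (map (vtx w) [0..<Suc dim_cell]) \<and> set (map (vtx w) [0..<Suc dim_cell]) = path w
      \<and> length (map (vtx w) [0..<Suc dim_cell]) = card (path w)"
    using w by (auto simp: path_def card_image inj_on_vtx lessThan_Suc_atMost atLeast0LessThan simp del: upt_Suc)
qed (simp add: path_def)

lemma staircase_neq_0:
  assumes "staircase S \<noteq> 0"
  shows "S \<subseteq> G" "covering S" "card S = Suc dim_cell"
proof -
  have "{w \<in> words. path w = S} \<noteq> {}"
    using assms unfolding staircase_def by (metis sum.empty)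
  then obtain w where "w \<in> words" "path w = S" by blast
  then show "S \<subseteq> G" "covering S" "card S = Suc dim_cell"
    using path_subset covering_path card_path by blast+
qed

text \<open>Exchanging two steps of a path replaces only the vertex between them.\<close>

definition flip :: "nat \<Rightarrow> nat list \<Rightarrow> nat list" where
  "flip r w = take r w @ w ! Suc r # w ! r # drop (r + 2) w"

context
  fixes r :: nat and w :: "nat list"
  assumes r: "Suc r < length w"
begin

lemma unflip: "w = take r w @ w ! r # w ! Suc r # drop (r + 2) w"
  using r by (metis Cons_nth_drop_Suc Suc_lessD add_2_eq_Suc' append_take_drop_id)

lemma length_flip: "length (flip r w) = length w"
  using r by (simp add: flip_def)

lemma flip_flip: "flip r (flip r w) = w"
proof -
  have "take r (flip r w) = take r w" "flip r w ! Suc r = w ! r" "flip r w ! r = w ! Suc r"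
    "drop (r + 2) (flip r w) = drop (r + 2) w"
    using r by (simp_all add: flip_def nth_append min_def)
  then show ?thesis unfolding flip_def[of r "flip r w"] by (simp only: unflip[symmetric])
qed

lemma count_list_flip: "count_list (flip r w) c = count_list w c"
proof -
  have "count_list (flip r w) c = count_list (take r w @ w ! r # w ! Suc r # drop (r + 2) w) c"
    by (simp add: flip_def)
  then show ?thesis by (simp only: unflip[symmetric])
qed

lemma set_flip: "set (flip r w) = set w"
proof -
  have "set (flip r w) = set (take r w @ w ! r # w ! Suc r # drop (r + 2) w)"
    by (auto simp: flip_def)
  then show ?thesis by (simp only: unflip[symmetric])
qed

lemma inv_sign_flip:
  assumes "w ! r \<noteq> w ! Suc r"
  shows "inv_sign (flip r w) = - inv_sign w"
proof -
  have "inv_sign (flip r w) = - inv_sign (take r w @ w ! r # w ! Suc r # drop (r + 2) w)"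
    unfolding flip_def using assms by (intro inv_sign_swap) simp
  then show ?thesis by (simp only: unflip[symmetric])
qed

lemma count_list_take_flip:
  assumes "t \<noteq> Suc r"
  shows "count_list (take t (flip r w)) = count_list (take t w)"
proof (cases "t \<le> r")
  case True
  then show ?thesis using r by (simp add: flip_def min_def)
next
  case False
  then obtain j where t: "t = r + 2 + j" using assms
    using le_Suc_ex[of "r + 2" t] by auto
  have "take t (flip r w) = take r w @ [w ! Suc r, w ! r] @ take j (drop (r + 2) w)"
    using r by (simp add: flip_def t)
  moreover have "take t (take r w @ w ! r # w ! Suc r # drop (r + 2) w)
      = take r w @ [w ! r, w ! Suc r] @ take j (drop (r + 2) w)"
    using r by (simp add: t)
  then have "take t w = take r w @ [w ! r, w ! Suc r] @ take j (drop (r + 2) w)"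
    by (simp only: unflip[symmetric])
  ultimately show ?thesis by (simp add: fun_eq_iff)
qed

end

lemma flip_in_words: "w \<in> words \<Longrightarrow> Suc r < dim_cell \<Longrightarrow> flip r w \<in> words"
  by (auto simp: words_def length_flip count_list_flip set_flip)

text \<open>A vertex that is not a turn is the only one on the path with some coordinate value, so
  without it the path lies in a facet. For the start this is the value \<open>0\<close> in the first
  direction; for any other vertex it is the value reached by the step into it, unless a next step
  exists and has another direction.\<close>

lemma covering_path_remove:
  assumes w: "w \<in> words" and t: "t \<le> dim_cell" and cov: "covering (path w - {vtx w t})"
  obtains r where "t = Suc r" "Suc r < dim_cell" "w ! r \<noteq> w ! Suc r"
proof -
  have len: "length w = dim_cell" using w by (simp add: words_def)
  have dir: "w ! i < s" if "i < dim_cell" for i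
  proof -
    have "w ! i \<in> set w" using that len by simp
    then show ?thesis using w by (auto simp: words_def)
  qed
  have other: "\<exists>t'\<le>dim_cell. t' \<noteq> t \<and> count_list (take t' w) c = a" if c: "c < s" and a: "a < k" for c a
  proof -
    obtain t' where "t' \<le> dim_cell" "vtx w t' \<noteq> vtx w t" "coord (vtx w t') c = a"
      using cov c a unfolding covering_def path_def by blast
    then show ?thesis using coord_vtx[OF w c] by metis
  qed
  have step: "count_list (take (Suc i) w) (w ! i) = Suc (count_list (take i w) (w ! i))" if "i < dim_cell" for i
    using take_Suc_count_list[of i w] that len by simp
  have "t \<noteq> 0"
  proof
    assume "t = 0"
    \<comment> \<open>If \<open>dim_cell = 0\<close>, the start is the only vertex, and no vertex is
      left to attain a value.\<close>
    then have "0 < dim_cell" using other[OF s k] by auto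
    with other[OF dir k] obtain t' where t': "t' \<noteq> 0" "count_list (take t' w) (w ! 0) = 0"
      using \<open>t = 0\<close> by blast
    moreover have "count_list (take (Suc 0) w) (w ! 0) \<le> count_list (take t' w) (w ! 0)"
      using t'(1) by (intro count_list_take_mono) simp
    ultimately show False using step[OF \<open>0 < dim_cell\<close>] by simp
  qed
  then obtain r where r: "t = Suc r" using not0_implies_Suc by blast
  then have r_less: "r < dim_cell" using t by simp
  define a where "a = count_list (take t w) (w ! r)"
  have a: "a < k" using w dir[OF r_less] by (simp add: a_def count_take_less)
  obtain t' where t': "t' \<le> dim_cell" "t' \<noteq> t" "count_list (take t' w) (w ! r) = a"
    using other[OF dir[OF r_less] a] by blast
  have "\<not> t' \<le> r"
  proof
    assume "t' \<le> r"
    from count_list_take_mono[OF this, of w "w ! r"]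
    have "a \<le> count_list (take r w) (w ! r)" by (simp only: t'(3))
    then show False using step[OF r_less] by (simp add: a_def r)
  qed
  then have Suc: "Suc t \<le> t'" using t'(2) r by simp
  then have "Suc r < dim_cell" using t' r by simp
  moreover have "w ! r \<noteq> w ! Suc r"
  proof
    assume eq: "w ! r = w ! Suc r"
    have "count_list (take (Suc t) w) (w ! r) \<le> a"
      using count_list_take_mono[OF Suc, of w "w ! r"] by (simp only: t'(3))
    then show False using step[OF \<open>Suc r < dim_cell\<close>] by (simp add: a_def r eq)
  qed
  ultimately show ?thesis using r that by blast
qed

lemma path_remove_eq: "w \<in> words \<Longrightarrow> t \<le> dim_cell \<Longrightarrow> path w - {vtx w t} = vtx w ` ({..dim_cell} - {t})"
  unfolding path_def by (subst inj_on_image_set_diff[OF inj_on_vtx]) auto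

text \<open>A sign-reversing involution: if removing the vertex at time \<open>t\<close> leaves a
  covering set, the vertex is a turn, and \<open>flip\<close> gives the other path through the same
  remaining vertices.\<close>

lemma sum_path_remove:
  assumes cov: "covering Y" and t: "t \<le> dim_cell"
  shows "(\<Sum>w\<in>{w \<in> words. path w - {vtx w t} = Y}. inv_sign w) = 0"
proof (cases "\<exists>r. t = Suc r \<and> Suc r < dim_cell")
  case True
  then obtain r where r: "t = Suc r" "Suc r < dim_cell" by blast
  let ?D = "{w \<in> words. path w - {vtx w t} = Y}"
  have len: "Suc r < length w" if "w \<in> ?D" for w using that r by (simp add: words_def)
  have neq: "w ! r \<noteq> w ! Suc r" if w: "w \<in> ?D" for w
    using covering_path_remove[of w t] w cov t r(1) by blast
  have flip: "flip r w \<in> ?D" if w: "w \<in> ?D" for w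
  proof -
    have "vtx (flip r w) t' = vtx w t'" if "t' \<noteq> t" for t'
      using count_list_take_flip[OF len[OF w]] that by (simp add: vtx_def r(1))
    then have "vtx (flip r w) ` ({..dim_cell} - {t}) = vtx w ` ({..dim_cell} - {t})"
      by (intro image_cong) auto
    moreover have "w \<in> words" "flip r w \<in> words" using w r(2) by (simp_all add: flip_in_words)
    ultimately have "path (flip r w) - {vtx (flip r w) t} = path w - {vtx w t}"
      using path_remove_eq t by metis
    then show ?thesis using w \<open>flip r w \<in> words\<close> by simp
  qed
  have "(\<Sum>w\<in>?D. inv_sign w) = (\<Sum>w\<in>?D. inv_sign (flip r w))"
    by (rule sum.reindex_bij_witness[of _ "flip r" "flip r"])
      (use flip flip_flip[OF len] in \<open>auto simp del: mem_Collect_eq\<close>)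
  also have "\<dots> = - (\<Sum>w\<in>?D. inv_sign w)"
    unfolding sum_negf[symmetric]
    by (rule sum.cong[OF refl]) (rule inv_sign_flip[OF len neq])
  finally show ?thesis by simp
next
  case False
  then have "{w \<in> words. path w - {vtx w t} = Y} = {}"
    using covering_path_remove[of _ t] cov t by blast
  then show ?thesis by (simp only: sum.empty)
qed

lemma path_less_card:
  assumes w: "w \<in> words" and t: "t \<le> dim_cell"
  shows "card {y \<in> path w - {vtx w t}. y < vtx w t} = t"
proof -
  have "{y \<in> path w - {vtx w t}. y < vtx w t} = vtx w ` {..<t}"
  proof (intro equalityI subsetI)
    fix y assume "y \<in> {y \<in> path w - {vtx w t}. y < vtx w t}"
    then obtain t' where t': "t' \<le> dim_cell" "y = vtx w t'" "vtx w t' < vtx w t"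
      by (auto simp: path_def)
    then have "\<not> t \<le> t'" using vtx_less[OF w, of t t'] by (auto simp: le_less)
    then show "y \<in> vtx w ` {..<t}" using t' by simp
  qed (use vtx_less[OF w] t in \<open>force simp: path_def\<close>)
  moreover have "inj_on (vtx w) {..<t}"
    using inj_on_vtx[OF w] by (rule inj_on_subset) (use t in auto)
  ultimately show ?thesis by (simp add: card_image)
qed

text \<open>Covering faces with one vertex less are shared by pairs of cells with opposite signs.
  Expanding \<open>staircase\<close> and summing by the time \<open>t\<close> of the removed vertex
  reduces this to \<open>sum_path_remove\<close>. The set \<open>U\<close> allows for generators
  outside \<open>G\<close>, which lie on no path.\<close>

lemma staircase_cycle:
  assumes cov: "covering Y" and "finite U" "G \<subseteq> U"
  shows "(\<Sum>g\<in>U - Y. (- 1) ^ card {y \<in> Y. y < g} * staircase (insert g Y)) = 0"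
proof -
  have one: "(\<Sum>g\<in>U - Y. if path w = insert g Y then (- 1) ^ card {y \<in> Y. y < g} * inv_sign w else 0)
      = (\<Sum>t\<le>dim_cell. if path w - {vtx w t} = Y then (- 1) ^ t * inv_sign w else 0)" if w: "w \<in> words" for w
  proof -
    have "(\<Sum>g\<in>U - Y. if path w = insert g Y then (- 1) ^ card {y \<in> Y. y < g} * inv_sign w else 0)
        = (\<Sum>g\<in>path w. if path w - {g} = Y then (- 1) ^ card {y \<in> path w - {g}. y < g} * inv_sign w else 0)"
    proof (rule sum.mono_neutral_cong)
      show "(if path w = insert g Y then (- 1) ^ card {y \<in> Y. y < g} * inv_sign w else 0) = 0"
        if "g \<in> U - Y - path w" for g
        using that by auto
      show "(if path w - {g} = Y then (- 1) ^ card {y \<in> path w - {g}. y < g} * inv_sign w else 0) = 0"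
        if "g \<in> path w - (U - Y)" for g
        using that path_subset[OF w] assms(3) by auto
      show "(if path w = insert g Y then (- 1) ^ card {y \<in> Y. y < g} * inv_sign w else 0)
          = (if path w - {g} = Y then (- 1) ^ card {y \<in> path w - {g}. y < g} * inv_sign w else 0)"
        if "g \<in> (U - Y) \<inter> path w" for g
      proof -
        have "path w = insert g Y \<longleftrightarrow> path w - {g} = Y" using that by auto
        then show ?thesis by auto
      qed
    qed (use assms(2) in \<open>auto simp: path_def\<close>)
    also have "\<dots> = (\<Sum>t\<le>dim_cell. if path w - {vtx w t} = Y
        then (- 1) ^ card {y \<in> path w - {vtx w t}. y < vtx w t} * inv_sign w else 0)"
      unfolding path_def[of w] sum.reindex[OF inj_on_vtx[OF w]] by simp
    also have "\<dots> = (\<Sum>t\<le>dim_cell. if path w - {vtx w t} = Y then (- 1) ^ t * inv_sign w else 0)"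
      by (rule sum.cong[OF refl]) (simp only: path_less_card[OF w] atMost_iff)
    finally show ?thesis .
  qed
  have "(\<Sum>g\<in>U - Y. (- 1) ^ card {y \<in> Y. y < g} * staircase (insert g Y))
      = (\<Sum>g\<in>U - Y. \<Sum>w\<in>words. if path w = insert g Y then (- 1) ^ card {y \<in> Y. y < g} * inv_sign w else 0)"
    by (intro sum.cong refl)
      (simp add: staircase_def sum_distrib_left sum.inter_filter[OF finite_words] if_distrib cong: if_cong)
  also have "\<dots> = (\<Sum>w\<in>words. \<Sum>t\<le>dim_cell. if path w - {vtx w t} = Y then (- 1) ^ t * inv_sign w else 0)"
    by (subst sum.swap) (rule sum.cong[OF refl], rule one)
  also have "\<dots> = (\<Sum>t\<le>dim_cell. \<Sum>w\<in>words. if path w - {vtx w t} = Y then (- 1) ^ t * inv_sign w else 0)"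
    by (rule sum.swap)
  also have "\<dots> = (\<Sum>t\<le>dim_cell. (- 1) ^ t * (\<Sum>w\<in>{w \<in> words. path w - {vtx w t} = Y}. inv_sign w))"
    by (intro sum.cong refl)
      (simp add: sum_distrib_left sum.inter_filter[OF finite_words] if_distrib cong: if_cong)
  also have "\<dots> = 0" by (rule sum.neutral) (simp add: sum_path_remove[OF cov])
  finally show ?thesis .
qed

section \<open>The pairing of cocycle and cycle\<close>

text \<open>On a path the factor \<open>c'\<close> sees the vertices at times
  \<open>c' * (k - 1)\<close> to \<open>Suc c' * (k - 1)\<close>; neighbouring blocks share one
  vertex.\<close>

lemma cup_power_path:
  "c \<le> s \<Longrightarrow> w \<in> words \<Longrightarrow> cup_power c (map (vtx w) [0..<Suc (c * (k - 1))])
    = (\<Prod>c'<c. alt_sign (map (\<lambda>t. count_list (take t w) c') [c' * (k - 1)..<Suc (Suc c' * (k - 1))]))"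
proof (induction c)
  case (Suc c)
  let ?p = "c * (k - 1)" and ?q = "Suc c * (k - 1)"
  have "take (Suc ?p) (map (vtx w) [0..<Suc ?q]) = map (vtx w) [0..<Suc ?p]"
    by (simp add: take_map take_upt del: upt_Suc)
  moreover have "drop ?p (map (vtx w) [0..<Suc ?q]) = map (vtx w) [?p..<Suc ?q]"
    by (simp add: drop_map drop_upt del: upt_Suc)
  moreover have "map (\<lambda>g. coord g c) (map (vtx w) [?p..<Suc ?q])
      = map (\<lambda>t. count_list (take t w) c) [?p..<Suc ?q]"
    using Suc.prems by (simp add: coord_vtx del: upt_Suc)
  ultimately show ?case
    using Suc by (simp only: cup_power.simps prod.lessThan_Suc Suc_leD)
qed simp

text \<open>The path that runs through the directions one after another, \<open>k - 1\<close> steps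
  each. For \<open>k = 1\<close> the word is empty, so no division by \<open>0\<close> is
  evaluated.\<close>

definition main_word :: "nat list" where
  "main_word = map (\<lambda>t. t div (k - 1)) [0..<dim_cell]"

lemma nth_main_word: "t < dim_cell \<Longrightarrow> main_word ! t = t div (k - 1)"
  by (simp add: main_word_def)

lemma length_main_word: "length main_word = dim_cell"
  by (simp add: main_word_def)

lemma main_word_in_words: "main_word \<in> words"
proof -
  have "count_list main_word c = k - 1" if "c < s" for c
  proof -
    have "count_list main_word c = card {t. t < length main_word \<and> c = main_word ! t}"
      by (simp only: count_list_eq_length_filter length_filter_conv_card)
    also have "{t. t < length main_word \<and> c = main_word ! t} = {t. t < dim_cell \<and> t div (k - 1) = c}"
      by (auto simp: length_main_word nth_main_word)
    also have "{t. t < dim_cell \<and> t div (k - 1) = c} = {c * (k - 1)..<Suc c * (k - 1)}"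
    proof (cases "k - 1 = 0")
      case False
      have le: "Suc c * (k - 1) \<le> dim_cell"
        unfolding dim_cell_def using that by (intro mult_le_mono1) simp
      have iff: "t div (k - 1) = c \<longleftrightarrow> c * (k - 1) \<le> t \<and> t < Suc c * (k - 1)" for t
      proof -
        have "t div (k - 1) = c \<longleftrightarrow> c \<le> t div (k - 1) \<and> t div (k - 1) < Suc c" by auto
        then show ?thesis
          using False by (simp only: less_eq_div_iff_mult_less_eq div_less_iff_less_mult neq0_conv)
      qed
      show ?thesis
        unfolding iff using le by (auto simp del: mult_Suc)
    qed (simp add: dim_cell_def)
    finally show ?thesis by simp
  qed
  moreover have "set main_word \<subseteq> {..<s}"
    by (auto simp: main_word_def dim_cell_def less_mult_imp_div_less)
  ultimately show ?thesis by (simp add: words_def main_word_def)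
qed

lemma cocycle_path:
  assumes w: "w \<in> words"
  shows "cocycle (path w) = (\<Prod>c<s. alt_sign (map (\<lambda>t. count_list (take t w) c) [c * (k - 1)..<Suc (Suc c * (k - 1))]))"
  using cup_power_path[OF order_refl w] w
  by (simp add: cocycle_def path_subset card_path sorted_list_of_path dim_cell_def del: upt_Suc)

text \<open>If all factors are nonzero, coordinate \<open>c\<close> changes at every step of block
  \<open>c\<close>. A step changes only the coordinate of its direction, so every step of this block
  has direction \<open>c\<close>.\<close>

lemma cocycle_path_eq_0:
  assumes w: "w \<in> words" "w \<noteq> main_word"
  shows "cocycle (path w) = 0"
proof (rule ccontr)
  assume nz: "cocycle (path w) \<noteq> 0"
  have "w ! t = main_word ! t" if t: "t < dim_cell" for t
  proof -
    let ?c = "t div (k - 1)"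
    have q: "0 < k - 1" using t by (auto simp: dim_cell_def intro: ccontr)
    have c: "?c < s" using t by (simp add: dim_cell_def less_mult_imp_div_less)
    have "distinct (map (\<lambda>t. count_list (take t w) ?c) [?c * (k - 1)..<Suc (Suc ?c * (k - 1))])"
      using nz c unfolding cocycle_path[OF w(1)] by (simp add: alt_sign_eq_0_iff del: upt_Suc)
    then have inj: "inj_on (\<lambda>t. count_list (take t w) ?c) {?c * (k - 1)..<Suc (Suc ?c * (k - 1))}"
      by (simp add: distinct_map del: upt_Suc)
    have "?c * (k - 1) \<le> t" "t < Suc ?c * (k - 1)"
      using q dividend_less_div_times[of "k - 1" t] by simp_all
    then have "t \<in> {?c * (k - 1)..<Suc (Suc ?c * (k - 1))}" "Suc t \<in> {?c * (k - 1)..<Suc (Suc ?c * (k - 1))}"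
      by (simp_all only: atLeastLessThan_iff Suc_less_eq le_SucI less_SucI)
    then have "count_list (take (Suc t) w) ?c \<noteq> count_list (take t w) ?c"
      using inj_onD[OF inj, of "Suc t" t] by (metis n_not_Suc_n)
    then have "w ! t = ?c"
      using t w(1) by (auto simp: take_Suc_count_list words_def split: if_splits)
    then show ?thesis using t by (simp add: nth_main_word)
  qed
  then have "w = main_word"
    using w(1) main_word_in_words by (intro nth_equalityI) (auto simp: words_def)
  with w(2) show False ..
qed

text \<open>In block \<open>c\<close> the coordinate \<open>c\<close> increases strictly along
  \<open>main_word\<close>, so each factor is a sign.\<close>

lemma abs_cocycle_main_word: "\<bar>cocycle (path main_word)\<bar> = 1"
proof -
  have "\<bar>alt_sign (map (\<lambda>t. count_list (take t main_word) c) [c * (k - 1)..<Suc (Suc c * (k - 1))])\<bar> = 1"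
    if c: "c < s" for c
  proof (rule abs_alt_sign)
    let ?f = "\<lambda>t. count_list (take t main_word) c"
    have le: "Suc c * (k - 1) \<le> dim_cell"
      unfolding dim_cell_def using c by (intro mult_le_mono1) simp
    have "?f t < ?f t'" if "c * (k - 1) \<le> t" "t < t'" "t' \<le> Suc c * (k - 1)" for t t'
    proof -
      have t: "t < dim_cell" "t < Suc c * (k - 1)" using that le by auto
      then have "t div (k - 1) = c" using that(1) by (intro div_nat_eqI) (simp_all add: mult.commute)
      then have "?f (Suc t) = Suc (?f t)"
        using t by (simp add: take_Suc_count_list nth_main_word length_main_word)
      then show ?thesis using count_list_take_mono[of "Suc t" t' main_word c] that(2) by simp
    qed
    then have "inj_on ?f {c * (k - 1)..<Suc (Suc c * (k - 1))}"
      by (intro linorder_inj_onI') (force simp: less_Suc_eq_le)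
    then show "distinct (map ?f [c * (k - 1)..<Suc (Suc c * (k - 1))])"
      by (simp add: distinct_map del: upt_Suc)
  qed
  note 1 = this
  show ?thesis
    unfolding cocycle_path[OF main_word_in_words] using 1 by (rule abs_prod_eq_1)
qed

text \<open>Once \<open>staircase\<close> is expanded over words, only \<open>main_word\<close>
  contributes.\<close>

lemma cocycle_staircase:
  assumes "finite U" "\<And>S. S \<subseteq> G \<Longrightarrow> card S = Suc dim_cell \<Longrightarrow> S \<in> U"
  shows "\<bar>\<Sum>S\<in>U. cocycle S * staircase S\<bar> = 1"
proof -
  have "(\<Sum>S\<in>U. cocycle S * staircase S)
      = (\<Sum>S\<in>U. \<Sum>w\<in>words. if path w = S then cocycle (path w) * inv_sign w else 0)"
    by (intro sum.cong refl)
      (simp add: staircase_def sum_distrib_left sum.inter_filter[OF finite_words] if_distrib cong: if_cong)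
  also have "\<dots> = (\<Sum>w\<in>words. \<Sum>S\<in>U. if path w = S then cocycle (path w) * inv_sign w else 0)"
    by (rule sum.swap)
  also have "\<dots> = (\<Sum>w\<in>words. cocycle (path w) * inv_sign w)"
    using assms path_subset card_path by (intro sum.cong refl) (simp add: sum.delta)
  also have "\<dots> = (\<Sum>w\<in>{main_word}. cocycle (path w) * inv_sign w)"
    using main_word_in_words finite_words cocycle_path_eq_0
    by (intro sum.mono_neutral_right) auto
  finally show ?thesis by (simp add: abs_mult abs_cocycle_main_word abs_inv_sign)
qed

end

section \<open>Betti numbers from the Taylor resolution\<close>

context taylor
begin

lemma betti_gen_ideal:
  "betti_quotient (gen_ideal :: ('v, 'k::field) mpoly set) i j =
    coeff.dim (tor_cycles (taylor_complex :: ('v, 'k) free_complex) i j) -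
    coeff.dim (tor_boundaries (taylor_complex :: ('v, 'k) free_complex) i j)"
  by (rule betti_quotient_eq[OF homogeneous_gen_ideal taylor_resolution])

lemma betti_neq_0:
  assumes "betti_quotient (gen_ideal :: ('v, 'k::field) mpoly set) i j \<noteq> 0"
  obtains Y where "Y \<in> faces i" "j = int (monomial_degree (mlcm Y))"
proof -
  let ?T = "taylor_complex :: ('v, 'k) free_complex"
  have "\<exists>a<card (faces i). dg ?T i a = j"
  proof (rule ccontr)
    assume no: "\<not> (\<exists>a<card (faces i). dg ?T i a = j)"
    have "v = 0" if v: "v \<in> tor_cycles ?T i j" for v
    proof
      fix a
      show "v a = 0 a"
        using v no by (cases "a < card (faces i)")
          (auto simp: tor_cycles_def tensor_component_def vecs_def)
    qed
    then have "tor_cycles ?T i j \<subseteq> coeff.span {}" by auto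
    then have "coeff.dim (tor_cycles ?T i j) \<le> card ({} :: (nat \<Rightarrow> 'k) set)"
      by (rule coeff.dim_le_card) simp
    then show False using assms by (simp add: betti_gen_ideal)
  qed
  then show ?thesis using that enum_in_faces by auto
qed

text \<open>Makes \<open>Max\<close> in \<open>reg_quotient\<close> an upper bound of its set: a
  nonzero Betti number needs a Taylor basis vector in its degree, and there are finitely
  many.\<close>

lemma finite_betti_shifts:
  "finite {j - int i | i j. betti_quotient (gen_ideal :: ('v, 'k::field) mpoly set) i j \<noteq> 0}"
proof (rule finite_subset)
  show "{j - int i | i j. betti_quotient (gen_ideal :: ('v, 'k) mpoly set) i j \<noteq> 0}
      \<subseteq> (\<lambda>Y. int (monomial_degree (mlcm Y)) - int (card Y)) ` Pow {..<N}"
  proof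
    fix d assume "d \<in> {j - int i | i j. betti_quotient (gen_ideal :: ('v, 'k) mpoly set) i j \<noteq> 0}"
    then obtain i j where d: "d = j - int i" "betti_quotient (gen_ideal :: ('v, 'k) mpoly set) i j \<noteq> 0"
      by blast
    from d(2) obtain Y where "Y \<in> faces i" "j = int (monomial_degree (mlcm Y))" by (rule betti_neq_0)
    then show "d \<in> (\<lambda>Y. int (monomial_degree (mlcm Y)) - int (card Y)) ` Pow {..<N}"
      by (auto simp: d(1) faces_def)
  qed
qed simp

text \<open>The adjoint of \<open>taylor_bd\<close> is the coboundary: pairs of a face and a vertex
  outside it correspond to pairs of a coface and a vertex in it. Hence a cocycle vanishes on all
  boundaries.\<close>

lemma sum_faces_coboundary:
  fixes \<psi> :: "nat set \<Rightarrow> 'k::comm_ring_1"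
  shows "(\<Sum>S\<in>faces i. \<psi> S * taylor_bd \<gamma> S) = (\<Sum>X\<in>faces (Suc i).
    (\<Sum>g\<in>X. if mlcm (X - {g}) = mlcm X then ins_sign g X * \<psi> (X - {g}) else 0) * \<gamma> X)"
proof -
  let ?L = "SIGMA S:faces i. {..<N} - S" and ?R = "SIGMA X:faces (Suc i). X"
  have sign: "ins_sign g (insert g S) = (ins_sign g S :: 'k)" if "g \<notin> S" for g S
  proof -
    have "{y \<in> insert g S. y < g} = {y \<in> S. y < g}" by auto
    then show ?thesis by (simp add: ins_sign_def)
  qed
  have "(\<Sum>S\<in>faces i. \<psi> S * taylor_bd \<gamma> S)
      = (\<Sum>(S, g)\<in>?L. if mlcm (insert g S) = mlcm S then \<psi> S * (ins_sign g S * \<gamma> (insert g S)) else 0)"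
    by (simp add: taylor_bd_def sum_distrib_left sum.Sigma finite_faces if_distrib cong: if_cong)
  also have "\<dots> = (\<Sum>(X, g)\<in>?R. if mlcm (X - {g}) = mlcm X then ins_sign g X * \<psi> (X - {g}) * \<gamma> X else 0)"
  proof (rule sum.reindex_bij_witness[of _ "\<lambda>(X, g). (X - {g}, g)" "\<lambda>(S, g). (insert g S, g)"])
    fix u assume "u \<in> ?L"
    then obtain S g where u: "u = (S, g)" "S \<in> faces i" "g \<in> {..<N} - S" by auto
    then have S: "insert g S - {g} = S" by auto
    show "(case (case u of (S, g) \<Rightarrow> (insert g S, g)) of (X, g) \<Rightarrow> (X - {g}, g)) = u"
      using u S by simp
    show "(case u of (S, g) \<Rightarrow> (insert g S, g)) \<in> ?R"
      using u finite_face[OF u(2)] by (auto simp: faces_def)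
    show "(case case u of (S, g) \<Rightarrow> (insert g S, g) of
        (X, g) \<Rightarrow> if mlcm (X - {g}) = mlcm X then ins_sign g X * \<psi> (X - {g}) * \<gamma> X else 0)
        = (case u of (S, g) \<Rightarrow> if mlcm (insert g S) = mlcm S then \<psi> S * (ins_sign g S * \<gamma> (insert g S)) else 0)"
      using u by (simp add: S sign[of g S] eq_commute[of "mlcm S"] ac_simps del: insert_Diff_if)
  next
    fix u assume "u \<in> ?R"
    then obtain X g where u: "u = (X, g)" "X \<in> faces (Suc i)" "g \<in> X" by auto
    then show "(case (case u of (X, g) \<Rightarrow> (X - {g}, g)) of (S, g) \<Rightarrow> (insert g S, g)) = u" by auto
    show "(case u of (X, g) \<Rightarrow> (X - {g}, g)) \<in> ?L"
      using u finite_face[OF u(2)] by (auto simp: faces_def)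
  qed
  also have "\<dots> = (\<Sum>X\<in>faces (Suc i). \<Sum>g\<in>X. if mlcm (X - {g}) = mlcm X then ins_sign g X * \<psi> (X - {g}) * \<gamma> X else 0)"
    using finite_face by (simp add: sum.Sigma finite_faces)
  also have "\<dots> = (\<Sum>X\<in>faces (Suc i).
      (\<Sum>g\<in>X. if mlcm (X - {g}) = mlcm X then ins_sign g X * \<psi> (X - {g}) else 0) * \<gamma> X)"
    unfolding sum_distrib_right by (intro sum.cong refl) auto
  finally show ?thesis .
qed

text \<open>Cycles \<open>z a\<close> are independent modulo boundaries if cocycles \<open>\<psi> a\<close> separate them.\<close>

lemma card_le_betti:
  fixes z \<psi> :: "'a \<Rightarrow> nat set \<Rightarrow> 'k::field"
  assumes J: "finite J"
    and supp: "\<And>a S. a \<in> J \<Longrightarrow> S \<in> faces i \<Longrightarrow> z a S \<noteq> 0 \<Longrightarrow> int (monomial_degree (mlcm S)) = d"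
    and cycle: "\<And>a i' Y. a \<in> J \<Longrightarrow> i = Suc i' \<Longrightarrow> Y \<in> faces i' \<Longrightarrow> taylor_bd (z a) Y = 0"
    and cocycle: "\<And>a X. a \<in> J \<Longrightarrow> X \<in> faces (Suc i) \<Longrightarrow>
      (\<Sum>g\<in>X. if mlcm (X - {g}) = mlcm X then ins_sign g X * \<psi> a (X - {g}) else 0) = 0"
    and diag: "\<And>a. a \<in> J \<Longrightarrow> (\<Sum>S\<in>faces i. \<psi> a S * z a S) \<noteq> 0"
    and off_diag: "\<And>a b. a \<in> J \<Longrightarrow> b \<in> J \<Longrightarrow> a \<noteq> b \<Longrightarrow> (\<Sum>S\<in>faces i. \<psi> a S * z b S) = 0"
  shows "card J \<le> betti_quotient (gen_ideal :: ('v, 'k) mpoly set) i d"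
proof -
  let ?T = "taylor_complex :: ('v, 'k) free_complex"
  obtain W where W: "finite W" "(vecs (rk ?T i) :: (nat \<Rightarrow> 'k) set) \<subseteq> coeff.span W"
    using vecs_subset_span by blast
  have "card J \<le> coeff.dim (tor_cycles ?T i d) - coeff.dim (tor_boundaries ?T i d)"
  proof (rule coeff.card_le_dim_diff[OF subspace_tor_boundaries
        tor_boundaries_subset_cycles[OF homogeneous_gen_ideal taylor_resolution]
        order.trans[OF tor_cycles_subset_vecs W(2)] W(1) J])
    show "vec_of i (z a) \<in> tor_cycles ?T i d" if a: "a \<in> J" for a
    proof -
      have "vec_of i (z a) \<in> tensor_component ?T i d"
        using supp[OF a] enum_in_faces
        by (auto simp: tensor_component_def vec_of_in_vecs) (auto simp: vec_of_def split: if_splits)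
      moreover have "tensor_map ?T i' (vec_of i (z a)) = 0" if "i = Suc i'" for i'
      proof -
        have "vec_of i' (taylor_bd (z a)) = vec_of i' 0"
          using cycle[OF a that] by (simp add: vec_of_eq_iff)
        then show ?thesis unfolding that tensor_map_taylor vec_of_0 .
      qed
      ultimately show ?thesis by (auto simp: tor_cycles_def split: nat.splits)
    qed
    fix u assume "(\<Sum>a\<in>J. scale_vec (u a) (vec_of i (z a))) \<in> tor_boundaries ?T i d"
    then obtain v where v: "v \<in> vecs (card (faces (Suc i)))"
      "(\<Sum>a\<in>J. scale_vec (u a) (vec_of i (z a))) = tensor_map ?T i v"
      by (auto simp: tor_boundaries_def tensor_component_def)
    obtain \<gamma> where "v = vec_of (Suc i) \<gamma>" by (rule vecs_eq_vec_of[OF v(1)])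
    with v(2) have "(\<Sum>a\<in>J. scale_vec (u a) (vec_of i (z a))) = vec_of i (taylor_bd \<gamma>)"
      by (simp add: tensor_map_taylor)
    moreover have "(\<Sum>a\<in>J. scale_vec (u a) (vec_of i (z a))) = vec_of i (\<lambda>S. \<Sum>a\<in>J. u a * z a S)"
      by (auto simp: fun_eq_iff sum_fun_apply scale_vec_def vec_of_def)
    ultimately have eq: "(\<Sum>a\<in>J. u a * z a S) = taylor_bd \<gamma> S" if "S \<in> faces i" for S
      using that by (simp add: vec_of_eq_iff)
    show "\<forall>a\<in>J. u a = 0"
    proof
      fix b assume b: "b \<in> J"
      \<comment> \<open>Pairing with \<open>\<psi> b\<close> kills the boundary and isolates the
        coefficient of \<open>z b\<close>.\<close>
      have "0 = (\<Sum>S\<in>faces i. \<psi> b S * taylor_bd \<gamma> S)"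
        using cocycle[OF b] by (simp add: sum_faces_coboundary)
      also have "\<dots> = (\<Sum>S\<in>faces i. \<Sum>a\<in>J. u a * (\<psi> b S * z a S))"
        by (intro sum.cong refl) (simp add: eq[symmetric] sum_distrib_left mult.left_commute)
      also have "\<dots> = (\<Sum>a\<in>J. u a * (\<Sum>S\<in>faces i. \<psi> b S * z a S))"
        by (subst sum.swap) (simp add: sum_distrib_left)
      also have "\<dots> = (\<Sum>a\<in>{b}. u a * (\<Sum>S\<in>faces i. \<psi> b S * z a S))"
        using J b off_diag[OF b] by (intro sum.mono_neutral_right) auto
      finally show "u b = 0" using diag[OF b] by simp
    qed
  qed
  then show ?thesis by (simp add: betti_gen_ideal)
qed

end

section \<open>Connected components and antichains\<close>

text \<open>A comparable pair that is neither equal nor an edge has an element in between, and both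
  halves of the interval are smaller. So comparable elements lie in one component.\<close>

lemma le_imp_hasse_rtrancl: "x \<le> y \<Longrightarrow> (x, y) \<in> (hasse :: ('a::{finite,order} \<times> 'a) set)\<^sup>*"
proof (induction "card {x..y}" arbitrary: x y rule: less_induct)
  case less
  show ?case
  proof (cases "x = y \<or> (x, y) \<in> hasse")
    case False
    then obtain z where z: "x < z" "z < y" using less.prems by (auto simp: hasse_def)
    then have "{x..z} \<subset> {x..y}" "{z..y} \<subset> {x..y}" by (auto simp: less_le_not_le)
    then have "card {x..z} < card {x..y}" "card {z..y} < card {x..y}"
      by (simp_all add: psubset_card_mono)
    with less.hyps z have "(x, z) \<in> hasse\<^sup>*" "(z, y) \<in> hasse\<^sup>*" by auto
    then show ?thesis by (rule rtrancl_trans)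
  qed auto
qed

lemma equiv_hasse: "equiv UNIV ((hasse \<union> hasse\<inverse>)\<^sup>*)"
  by (rule equivI) (auto intro: refl_rtrancl sym_rtrancl sym_Un_converse trans_rtrancl)

text \<open>Along an edge of the Hasse diagram the images are comparable elements of an antichain,
  hence equal.\<close>

lemma mono_antichain_const:
  fixes f :: "'a::order \<Rightarrow> 'b::order"
  assumes "mono f" "range f \<subseteq> A" "antichain A" "(x, y) \<in> (hasse \<union> hasse\<inverse>)\<^sup>*"
  shows "f x = f y"
  using assms(4)
proof (induction rule: rtrancl_induct)
  case (step y z)
  have "f a = f b" if "(a, b) \<in> hasse" for a b
  proof -
    have "f a \<le> f b" using that by (intro monoD[OF assms(1)]) (auto simp: hasse_def)
    moreover have "f a \<in> A" "f b \<in> A" using assms(2) by auto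
    ultimately show ?thesis using assms(3) unfolding antichain_def by blast
  qed
  with step show ?case by auto
qed simp

section \<open>The ideal of homomorphisms\<close>

definition graph_monomial :: "('p::finite \<Rightarrow> 'q) \<Rightarrow> ('p \<times> 'q) monomial" where
  "graph_monomial \<phi> = (\<Sum>p\<in>UNIV. Poly_Mapping.single (p, \<phi> p) 1)"

lemma lookup_graph_monomial:
  "Poly_Mapping.lookup (graph_monomial \<phi>) (p, q) = (if \<phi> p = q then 1 else 0)"
proof -
  have "Poly_Mapping.lookup (graph_monomial \<phi>) (p, q) = (\<Sum>x\<in>UNIV. if x = p then if \<phi> x = q then 1 else 0 else 0)"
    unfolding graph_monomial_def lookup_sum lookup_single when_def by (rule sum.cong) auto
  then show ?thesis by simp
qed

lemma hom_monomial_eq_single: "hom_monomial \<phi> = Poly_Mapping.single (graph_monomial \<phi>) 1"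
proof -
  have "(\<Prod>p\<in>P. var (p, \<phi> p)) = Poly_Mapping.single (\<Sum>p\<in>P. Poly_Mapping.single (p, \<phi> p) 1) 1" for P
    by (induction P rule: infinite_finite_induct) (simp_all add: var_def mult_single)
  then show ?thesis by (simp add: hom_monomial_def graph_monomial_def)
qed

text \<open>The homomorphisms are enumerated by increasing weight, so that moving up along a staircase
  path increases the number of the generator.\<close>

locale hom_enumeration =
  fixes hs :: "('p::{finite,order} \<Rightarrow> 'q::{finite,order}) list" and \<rho> :: "'q \<Rightarrow> nat"
  assumes inj_\<rho>: "inj \<rho>" and distinct_hs: "distinct hs" and set_hs: "set hs = {\<phi>. mono \<phi>}"
    and sorted_hs: "sorted (map (\<lambda>\<phi>. \<Sum>p\<in>UNIV. \<rho> (\<phi> p)) hs)"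

sublocale hom_enumeration \<subseteq> taylor "\<lambda>i. graph_monomial (hs ! i)" "length hs" .

context hom_enumeration
begin

lemma gen_ideal_eq_hom_ideal: "gen_ideal = (hom_ideal :: ('p \<times> 'q, 'k::field) mpoly set)"
proof -
  have "(\<lambda>i. Poly_Mapping.single (graph_monomial (hs ! i)) (1 :: 'k)) ` {..<length hs} = hom_monomial ` set hs"
    by (force simp: hom_monomial_eq_single set_conv_nth image_iff)
  then show ?thesis by (simp add: gen_ideal_def hom_ideal_def set_hs)
qed

definition full :: "'q set \<Rightarrow> ('p \<times> 'q) monomial" where
  "full A = Abs_poly_mapping (\<lambda>(p, q). if q \<in> A then 1 else 0)"

lemma lookup_full: "Poly_Mapping.lookup (full A) (p, q) = (if q \<in> A then 1 else 0)"
  by (simp add: full_def)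

lemma full_inject: "full A = full B \<longleftrightarrow> A = B"
proof
  assume "full A = full B"
  then have "Poly_Mapping.lookup (full A) (p, q) = Poly_Mapping.lookup (full B) (p, q)" for p q by simp
  then have "(if q \<in> A then 1 else 0) = (if q \<in> B then 1 else 0 :: nat)" for q
    unfolding lookup_full .
  then have "q \<in> A \<longleftrightarrow> q \<in> B" for q by (metis zero_neq_one)
  then show "A = B" by blast
qed simp

lemma degree_full: "monomial_degree (full A) = card A * CARD('p)"
proof -
  have "monomial_degree (full A) = (\<Sum>x\<in>UNIV \<times> UNIV. Poly_Mapping.lookup (full A) x)"
    by (rule monomial_degree_superset) auto
  also have "\<dots> = (\<Sum>p\<in>UNIV. \<Sum>q\<in>UNIV. Poly_Mapping.lookup (full A) (p, q))"
    unfolding sum.cartesian_product by (rule sum.cong) auto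
  also have "\<dots> = (\<Sum>p\<in>(UNIV :: 'p set). \<Sum>q\<in>UNIV. if q \<in> A then 1 else 0)"
    by (simp only: lookup_full)
  also have "\<dots> = card A * CARD('p)" by (simp add: sum.If_cases)
  finally show ?thesis .
qed

lemma lookup_mlcm_graph:
  assumes "finite S"
  shows "Poly_Mapping.lookup (mlcm S) (p, q) = (if \<exists>g\<in>S. (hs ! g) p = q then 1 else 0)"
proof -
  have "Poly_Mapping.lookup (mlcm S) (p, q) = Max (insert 0 ((\<lambda>g. if (hs ! g) p = q then 1 else 0) ` S))"
    by (simp add: lookup_mlcm lookup_graph_monomial)
  also have "\<dots> = (if \<exists>g\<in>S. (hs ! g) p = q then 1 else 0)"
    using assms by (intro Max_eqI) (auto split: if_splits)
  finally show ?thesis .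
qed

lemma mlcm_eq_full_iff:
  assumes "finite S"
  shows "mlcm S = full A \<longleftrightarrow> (\<forall>p q. (\<exists>g\<in>S. (hs ! g) p = q) \<longleftrightarrow> q \<in> A)"
proof -
  have "mlcm S = full A \<longleftrightarrow>
      (\<forall>p q. Poly_Mapping.lookup (mlcm S) (p, q) = Poly_Mapping.lookup (full A) (p, q))"
    by (simp add: poly_mapping_eq_iff fun_eq_iff)
  also have "\<dots> \<longleftrightarrow> (\<forall>p q. (\<exists>g\<in>S. (hs ! g) p = q) \<longleftrightarrow> q \<in> A)"
    unfolding lookup_mlcm_graph[OF assms] lookup_full by (intro iff_allI) auto
  finally show ?thesis .
qed

definition pos :: "('p \<Rightarrow> 'q) \<Rightarrow> nat" where
  "pos = the_inv_into {..<length hs} (\<lambda>i. hs ! i)"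

lemma
  assumes "mono \<phi>"
  shows pos_less: "pos \<phi> < length hs" and nth_pos: "hs ! pos \<phi> = \<phi>"
proof -
  have inj: "inj_on (\<lambda>i. hs ! i) {..<length hs}"
    using distinct_hs by (auto simp: inj_on_def nth_eq_iff_index_eq)
  have "\<phi> \<in> (\<lambda>i. hs ! i) ` {..<length hs}"
    using assms set_hs by (auto simp: set_conv_nth)
  then show "pos \<phi> < length hs" "hs ! pos \<phi> = \<phi>"
    using the_inv_into_into[OF inj, of \<phi> "{..<length hs}"] f_the_inv_into_f[OF inj, of \<phi>]
    by (simp_all add: pos_def)
qed

lemma pos_less_pos:
  assumes "mono \<phi>" "mono \<psi>" "(\<Sum>p\<in>UNIV. \<rho> (\<phi> p)) < (\<Sum>p\<in>UNIV. \<rho> (\<psi> p))"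
  shows "pos \<phi> < pos \<psi>"
proof (rule ccontr)
  assume "\<not> pos \<phi> < pos \<psi>"
  then have "map (\<lambda>\<phi>. \<Sum>p\<in>UNIV. \<rho> (\<phi> p)) hs ! pos \<psi> \<le> map (\<lambda>\<phi>. \<Sum>p\<in>UNIV. \<rho> (\<phi> p)) hs ! pos \<phi>"
    using pos_less[OF assms(1)] by (intro sorted_nth_mono[OF sorted_hs]) auto
  then show False
    using assms pos_less[OF assms(1)] pos_less[OF assms(2)] by (simp add: nth_pos)
qed

text \<open>An integral cycle \<open>z\<close> and an integral cocycle \<open>\<psi>\<close> in homological degree \<open>Suc n\<close> and
  multidegree \<open>full A\<close> whose pairing is invertible in every field.\<close>

definition dual_pair :: "nat \<Rightarrow> 'q set \<Rightarrow> (nat set \<Rightarrow> int) \<Rightarrow> (nat set \<Rightarrow> int) \<Rightarrow> bool" where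
  "dual_pair n A z \<psi> \<longleftrightarrow>
     (\<forall>S. mlcm S \<noteq> full A \<longrightarrow> z S = 0 \<and> \<psi> S = 0) \<and>
     (\<forall>Y\<in>faces n. mlcm Y = full A \<longrightarrow>
        (\<Sum>g\<in>{..<length hs} - Y. (- 1) ^ card {y \<in> Y. y < g} * z (insert g Y)) = 0) \<and>
     (\<forall>X\<in>faces (Suc (Suc n)). mlcm X = full A \<longrightarrow>
        (\<Sum>g\<in>X. (- 1) ^ card {y \<in> X. y < g} * \<psi> (X - {g})) = 0) \<and>
     \<bar>\<Sum>S\<in>faces (Suc n). \<psi> S * z S\<bar> = 1"

text \<open>A homomorphism into an antichain is constant on components, so those into a \<open>k\<close>-element
  antichain are the vertices of a product of \<open>s\<close> simplices.\<close>

lemma dual_pair_exists: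
  fixes A :: "'q set" and s :: nat
  defines "s \<equiv> card (poset_components :: 'p set set)"
  assumes A: "antichain A" "0 < card A"
  shows "\<exists>z \<psi>. dual_pair (s * (card A - 1)) A z \<psi>"
proof -
  let ?rel = "(hasse \<union> hasse\<inverse>)\<^sup>* :: ('p \<times> 'p) set" and ?k = "card A"
  have "finite (poset_components :: 'p set set)" by simp
  from ex_bij_betw_finite_nat[OF this] obtain e where
    e: "bij_betw e (poset_components :: 'p set set) {..<s}"
    by (auto simp: s_def atLeast0LessThan)
  define cidx where "cidx p = e (?rel `` {p})" for p
  have cls: "?rel `` {p} \<in> poset_components" for p
    by (simp add: poset_components_def quotientI)
  have cidx_less: "cidx p < s" for p
    using bij_betwE[OF e] cls by (auto simp: cidx_def)
  have cidx_eq_iff: "cidx p = cidx p' \<longleftrightarrow> (p, p') \<in> ?rel" for p p'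
    using bij_betw_imp_inj_on[OF e] cls eq_equiv_class_iff[OF equiv_hasse UNIV_I UNIV_I, of p p']
    by (simp add: cidx_def inj_on_eq_iff)
  have s: "0 < s" using cidx_less by (metis gr0I not_less0)
  have "\<exists>p. cidx p = c" if "c < s" for c
  proof -
    have "c \<in> e ` poset_components" using that bij_betw_imp_surj_on[OF e] by simp
    then obtain C where C: "C \<in> poset_components" "e C = c" by blast
    then obtain p where "C = ?rel `` {p}" by (auto simp: poset_components_def elim: quotientE)
    then show ?thesis using C by (auto simp: cidx_def)
  qed
  then obtain rep where rep: "\<And>c. c < s \<Longrightarrow> cidx (rep c) = c" by metis
  \<comment> \<open>The elements of \<open>A\<close> are numbered by increasing
    \<open>\<rho>\<close>, so that a larger coordinate means a larger weight; the order of
    \<open>Q\<close> gives no such numbering inside an antichain.\<close>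
  define el where "el i = inv \<rho> (sorted_list_of_set (\<rho> ` A) ! i)" for i
  have card_A: "card (\<rho> ` A) = ?k"
    using inj_\<rho> by (intro card_image) (rule inj_on_subset, auto)
  have nth_in: "sorted_list_of_set (\<rho> ` A) ! i \<in> \<rho> ` A" if "i < ?k" for i
    using that card_A nth_mem[of i "sorted_list_of_set (\<rho> ` A)"] by simp
  have \<rho>_el: "\<rho> (el i) = sorted_list_of_set (\<rho> ` A) ! i" and el_in: "el i \<in> A" if "i < ?k" for i
    using nth_in[OF that] inj_\<rho> by (auto simp: el_def)
  have \<rho>_el_less: "\<rho> (el i) < \<rho> (el j)" if "i < j" "j < ?k" for i j
    using that card_A sorted_wrt_nth_less[OF strict_sorted_list_of_set[of "\<rho> ` A"], of i j]
    by (simp add: \<rho>_el)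
  have inj_el: "inj_on el {..<?k}"
    by (rule linorder_inj_onI') (use \<rho>_el_less in force)
  have el_surj: "\<exists>i<?k. q = el i" if "q \<in> A" for q
  proof -
    have "\<rho> q \<in> set (sorted_list_of_set (\<rho> ` A))" using that by simp
    then obtain i where "i < ?k" "sorted_list_of_set (\<rho> ` A) ! i = \<rho> q"
      unfolding in_set_conv_nth by (auto simp: card_A)
    then show ?thesis using inj_\<rho> by (auto simp: el_def)
  qed
  define num where "num q = the_inv_into {..<?k} el q" for q
  have num_el: "num (el i) = i" if "i < ?k" for i
    using that inj_el by (simp add: num_def the_inv_into_f_f)
  have el_num: "el (num q) = q" and num_less: "num q < ?k" if "q \<in> A" for q
    using el_surj[OF that] num_el by auto
  \<comment> \<open>The point \<open>v\<close> as a homomorphism: constant on each component, with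
    the element of \<open>A\<close> that \<open>v\<close> selects there.\<close>
  define hom where "hom v p = el (v (cidx p))" for v p
  have mono_hom: "mono (hom v)" for v
  proof (rule monoI)
    fix x y :: 'p assume "x \<le> y"
    then have "(x, y) \<in> ?rel" using le_imp_hasse_rtrancl rtrancl_mono[of hasse "hasse \<union> hasse\<inverse>"] by blast
    then show "hom v x \<le> hom v y" by (simp add: hom_def flip: cidx_eq_iff)
  qed
  define idx where "idx v = pos (hom v)" for v
  define coord where "coord g c = num ((hs ! g) (rep c))" for g c
  define G where "G = {g. g < length hs \<and> range (hs ! g) \<subseteq> A}"
  have nth_idx: "hs ! idx v = hom v" "idx v < length hs" for v
    using mono_hom by (simp_all add: idx_def nth_pos pos_less)
  have const: "(hs ! g) p = (hs ! g) (rep (cidx p))" if "g \<in> G" for g p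
  proof -
    have "hs ! g \<in> set hs" using that by (simp add: G_def)
    then have "mono (hs ! g)" using set_hs by blast
    moreover have "(p, rep (cidx p)) \<in> ?rel"
      using rep[OF cidx_less[of p]] by (simp flip: cidx_eq_iff)
    ultimately show ?thesis using that A(1) by (intro mono_antichain_const) (auto simp: G_def)
  qed
  interpret grid s ?k idx coord G
  proof
    show "0 < s" "0 < ?k" "finite G" using s A(2) by (auto simp: G_def)
    show "idx v \<in> G" if "\<And>c. c < s \<Longrightarrow> v c < ?k" for v
      using that by (auto simp: G_def nth_idx hom_def el_in cidx_less)
    show "coord (idx v) c = v c" if "\<And>c. c < s \<Longrightarrow> v c < ?k" "c < s" for v c
      using that by (simp add: coord_def nth_idx hom_def rep num_el)
    show "coord g c < ?k" if "g \<in> G" "c < s" for g c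
      using that by (auto simp: coord_def G_def intro!: num_less)
    show "idx v < idx v'"
      if less: "\<And>c. c < s \<Longrightarrow> v' c < ?k" and le: "\<And>c. c < s \<Longrightarrow> v c \<le> v' c"
        and c: "c < s" "v c < v' c" for v v' c
      unfolding idx_def
    proof (rule pos_less_pos[OF mono_hom mono_hom])
      \<comment> \<open>The weights compare pointwise, strictly on component \<open>c\<close>, which
        contains \<open>rep c\<close>.\<close>
      show "(\<Sum>p\<in>UNIV. \<rho> (hom v p)) < (\<Sum>p\<in>UNIV. \<rho> (hom v' p))"
      proof (rule sum_strict_mono_ex1)
        show "\<forall>p\<in>UNIV. \<rho> (hom v p) \<le> \<rho> (hom v' p)"
        proof
          fix p
          show "\<rho> (hom v p) \<le> \<rho> (hom v' p)"
            using le[OF cidx_less[of p]] \<rho>_el_less[OF _ less[OF cidx_less[of p]], of "v (cidx p)"]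
            by (cases "v (cidx p) = v' (cidx p)") (auto simp: hom_def less_imp_le)
        qed
        show "\<exists>p\<in>UNIV. \<rho> (hom v p) < \<rho> (hom v' p)"
          using \<rho>_el_less[OF c(2) less[OF c(1)]] rep[OF c(1)] by (auto simp: hom_def intro!: exI[of _ "rep c"])
      qed simp
    qed
  qed
  \<comment> \<open>The lcm of \<open>S\<close> records the values taken at each \<open>p\<close>:
    it is \<open>full A\<close> iff no map of \<open>S\<close> leaves \<open>A\<close> and, on every
    component, the maps together take every value in \<open>A\<close>.\<close>
  have full_iff: "mlcm S = full A \<longleftrightarrow> S \<subseteq> G \<and> covering S" if S: "S \<subseteq> {..<length hs}" for S
  proof -
    have "finite S" using S finite_subset by blast
    note eq = mlcm_eq_full_iff[OF this, of A]
    show ?thesis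
    proof
      assume "mlcm S = full A"
      then have *: "(\<exists>g\<in>S. (hs ! g) p = q) \<longleftrightarrow> q \<in> A" for p q using eq by blast
      have "S \<subseteq> G" using * S by (fastforce simp: G_def)
      moreover have "\<exists>g\<in>S. coord g c = a" if c: "c < s" and a: "a < ?k" for c a
      proof -
        obtain g where "g \<in> S" "(hs ! g) (rep c) = el a"
          using *[of "rep c" "el a"] el_in[OF a] by blast
        then show ?thesis using num_el[OF a] by (auto simp: coord_def intro!: bexI[of _ g])
      qed
      ultimately show "S \<subseteq> G \<and> covering S" by (simp add: covering_def)
    next
      assume SG: "S \<subseteq> G \<and> covering S"
      have "(\<exists>g\<in>S. (hs ! g) p = q) \<longleftrightarrow> q \<in> A" for p q
      proof
        assume "q \<in> A"
        then obtain g where g: "g \<in> S" "coord g (cidx p) = num q"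
          using SG cidx_less num_less unfolding covering_def by blast
        then have gG: "g \<in> G" using SG by blast
        then have "(hs ! g) (rep (cidx p)) \<in> A" by (auto simp: G_def)
        then have "(hs ! g) (rep (cidx p)) = q"
          using g(2) el_num[OF \<open>q \<in> A\<close>] el_num unfolding coord_def by metis
        then show "\<exists>g\<in>S. (hs ! g) p = q" using const[OF gG, of p] g(1) by auto
      qed (use SG in \<open>auto simp: G_def\<close>)
      then show "mlcm S = full A" using eq by blast
    qed
  qed
  have G_sub: "G \<subseteq> {..<length hs}" by (auto simp: G_def)
  have "dual_pair (s * (?k - 1)) A staircase cocycle"
    unfolding dual_pair_def
  proof (intro conjI allI impI ballI)
    show "staircase S = 0" if "mlcm S \<noteq> full A" for S
      using staircase_neq_0[of S] full_iff[of S] G_sub that by blast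
    show "cocycle S = 0" if "mlcm S \<noteq> full A" for S
      using cocycle_covering[of S] full_iff[of S] G_sub that by blast
    show "(\<Sum>g\<in>{..<length hs} - Y. (- 1) ^ card {y \<in> Y. y < g} * staircase (insert g Y)) = 0"
      if "Y \<in> faces (s * (?k - 1))" "mlcm Y = full A" for Y
      using that full_iff[of Y] G_sub by (intro staircase_cycle) (auto simp: faces_def)
    show "(\<Sum>g\<in>X. (- 1) ^ card {y \<in> X. y < g} * cocycle (X - {g})) = 0"
      if "X \<in> faces (Suc (Suc (s * (?k - 1))))" "mlcm X = full A" for X
      using that full_iff[of X] by (intro cocycle_condition) (auto simp: faces_def dim_cell_def)
    show "\<bar>\<Sum>S\<in>faces (Suc (s * (?k - 1))). cocycle S * staircase S\<bar> = 1"
      using G_sub by (intro cocycle_staircase finite_faces) (auto simp: faces_def dim_cell_def)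
  qed
  then show ?thesis by blast
qed

text \<open>All antichains with \<open>k\<close> elements share the total degree
  \<open>k * CARD('p)\<close>, so their classes live in one graded piece of Tor; their distinct
  multidegrees make the matrix of pairings diagonal.\<close>

lemma betti_antichains_pos:
  fixes s k :: nat
  defines "s \<equiv> card (poset_components :: 'p set set)"
  assumes k: "0 < k"
  shows "card {A :: 'q set. antichain A \<and> card A = k}
    \<le> betti_quotient (gen_ideal :: ('p \<times> 'q, 'k::field) mpoly set) (Suc (s * (k - 1))) (int (k * CARD('p)))"
proof -
  let ?J = "{A :: 'q set. antichain A \<and> card A = k}"
  let ?n = "s * (k - 1)"
  have "\<forall>A\<in>?J. \<exists>z \<psi>. dual_pair ?n A z \<psi>"
    using dual_pair_exists k unfolding s_def by blast
  then obtain z \<psi> where dual: "\<And>A. A \<in> ?J \<Longrightarrow> dual_pair ?n A (z A) (\<psi> A)" by metis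
  have z: "z A S = 0" and \<psi>: "\<psi> A S = 0" if "A \<in> ?J" "mlcm S \<noteq> full A" for A S
    using dual[OF that(1)] that(2) by (simp_all add: dual_pair_def)
  have cycle: "(\<Sum>g\<in>{..<length hs} - Y. (- 1) ^ card {y \<in> Y. y < g} * z A (insert g Y)) = 0"
    if "A \<in> ?J" "Y \<in> faces ?n" "mlcm Y = full A" for A Y
    using dual[OF that(1)] that(2,3) by (simp add: dual_pair_def)
  have cocycle: "(\<Sum>g\<in>X. (- 1) ^ card {y \<in> X. y < g} * \<psi> A (X - {g})) = 0"
    if "A \<in> ?J" "X \<in> faces (Suc (Suc ?n))" "mlcm X = full A" for A X
    using dual[OF that(1)] that(2,3) by (simp add: dual_pair_def)
  have diag: "\<bar>\<Sum>S\<in>faces (Suc ?n). \<psi> A S * z A S\<bar> = 1" if "A \<in> ?J" for A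
    using dual[OF that] by (simp add: dual_pair_def)
  show ?thesis
  proof (rule card_le_betti[where z = "\<lambda>A S. of_int (z A S)" and \<psi> = "\<lambda>A S. of_int (\<psi> A S)"])
    show "finite ?J" by simp
    show "int (monomial_degree (mlcm S)) = int (k * CARD('p))"
      if "A \<in> ?J" "of_int (z A S) \<noteq> (0 :: 'k)" for A S
    proof -
      have "z A S \<noteq> 0" using that(2) by auto
      then have "mlcm S = full A" using z[OF that(1)] by blast
      then show ?thesis using that(1) by (simp add: degree_full)
    qed
    show "taylor_bd (\<lambda>S. of_int (z A S) :: 'k) Y = 0"
      if A: "A \<in> ?J" and "Suc (s * (k - 1)) = Suc i'" "Y \<in> faces i'" for A i' Y
    proof (cases "mlcm Y = full A")
      case True
      \<comment> \<open>The terms that \<open>taylor_bd\<close> drops because the lcm changes are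
        \<open>0\<close> in the integral sum, since \<open>z A\<close> is supported on sets with lcm
        \<open>full A\<close>.\<close>
      have "taylor_bd (\<lambda>S. of_int (z A S) :: 'k) Y
          = of_int (\<Sum>g\<in>{..<length hs} - Y. (- 1) ^ card {y \<in> Y. y < g} * z A (insert g Y))"
        unfolding taylor_bd_def of_int_sum
        by (rule sum.cong[OF refl]) (use True z[OF A] in \<open>auto simp: ins_sign_def\<close>)
      moreover have "Y \<in> faces (s * (k - 1))" using that by simp
      ultimately show ?thesis by (simp only: cycle[OF A _ True] of_int_0)
    next
      case False
      then show ?thesis
        unfolding taylor_bd_def by (intro sum.neutral ballI) (use z[OF A] in auto)
    qed
    show "(\<Sum>g\<in>X. if mlcm (X - {g}) = mlcm X then ins_sign g X * of_int (\<psi> A (X - {g})) else (0 :: 'k)) = 0"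
      if A: "A \<in> ?J" and X: "X \<in> faces (Suc (Suc (s * (k - 1))))" for A X
    proof (cases "mlcm X = full A")
      case True
      have "(\<Sum>g\<in>X. if mlcm (X - {g}) = mlcm X then ins_sign g X * of_int (\<psi> A (X - {g})) else (0 :: 'k))
          = of_int (\<Sum>g\<in>X. (- 1) ^ card {y \<in> X. y < g} * \<psi> A (X - {g}))"
        unfolding of_int_sum
        by (rule sum.cong[OF refl]) (use True \<psi>[OF A] in \<open>auto simp: ins_sign_def\<close>)
      then show ?thesis by (simp only: cocycle[OF A X True] of_int_0)
    next
      case False
      then show ?thesis by (intro sum.neutral ballI) (use \<psi>[OF A] in auto)
    qed
    show "(\<Sum>S\<in>faces (Suc (s * (k - 1))). of_int (\<psi> A S) * of_int (z A S)) \<noteq> (0 :: 'k)" if "A \<in> ?J" for A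
    proof -
      have eq: "(\<Sum>S\<in>faces (Suc (s * (k - 1))). of_int (\<psi> A S) * of_int (z A S) :: 'k)
          = of_int (\<Sum>S\<in>faces (Suc (s * (k - 1))). \<psi> A S * z A S)"
        by simp
      \<comment> \<open>A pairing equal to \<open>1\<close> or \<open>-1\<close> survives in every
        characteristic.\<close>
      have unit: "of_int x \<noteq> (0 :: 'k)" if "\<bar>x\<bar> = 1" for x
      proof -
        have "x = 1 \<or> x = - 1" using that by linarith
        then show ?thesis by auto
      qed
      show ?thesis unfolding eq by (rule unit) (rule diag[OF that])
    qed
    show "(\<Sum>S\<in>faces (Suc (s * (k - 1))). of_int (\<psi> A S) * of_int (z B S)) = (0 :: 'k)"
      if "A \<in> ?J" "B \<in> ?J" "A \<noteq> B" for A B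
    proof (intro sum.neutral ballI)
      fix S
      have "mlcm S \<noteq> full A \<or> mlcm S \<noteq> full B" using that(3) full_inject by metis
      then have "\<psi> A S = 0 \<or> z B S = 0" using z[OF that(2)] \<psi>[OF that(1)] by blast
      then show "of_int (\<psi> A S) * of_int (z B S) = (0 :: 'k)" by auto
    qed
  qed
qed

text \<open>The class of the empty antichain is carried by the empty face. Its dual cochain is
  closed because every generator is a monomial different from \<open>1\<close>.\<close>

lemma betti_0_0: "1 \<le> betti_quotient (gen_ideal :: ('p \<times> 'q, 'k::field) mpoly set) 0 0"
proof -
  have "card {()} \<le> betti_quotient (gen_ideal :: ('p \<times> 'q, 'k) mpoly set) 0 0"
  proof (rule card_le_betti[where z = "\<lambda>_ _. 1" and \<psi> = "\<lambda>_ _. 1"])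
    fix X assume "X \<in> faces (Suc 0)"
    then obtain g where "X = {g}" by (auto simp: faces_def card_1_singleton_iff)
    moreover have "mlcm {} \<noteq> mlcm {g}"
    proof
      assume "mlcm {} = mlcm {g}"
      then have "Poly_Mapping.lookup (mlcm {}) (undefined, (hs ! g) undefined)
          = Poly_Mapping.lookup (mlcm {g}) (undefined, (hs ! g) undefined)" by simp
      then show False by (simp add: lookup_mlcm_graph)
    qed
    ultimately show "(\<Sum>g\<in>X. if mlcm (X - {g}) = mlcm X then ins_sign g X * 1 else (0 :: 'k)) = 0"
      by simp
  qed (auto simp: faces_0 mlcm_empty monomial_degree_def)
  then show ?thesis by simp
qed

end

lemma hom_enumeration_exists: "\<exists>hs \<rho>. hom_enumeration (hs :: ('p::{finite,order} \<Rightarrow> 'q::{finite,order}) list) \<rho>"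
proof -
  obtain \<rho> :: "'q \<Rightarrow> nat" where \<rho>: "inj \<rho>"
    using finite_imp_inj_to_nat_seg[of "UNIV :: 'q set"] by auto
  obtain xs where xs: "set xs = {\<phi> :: 'p \<Rightarrow> 'q. mono \<phi>}" "distinct xs"
    using finite_distinct_list[of "{\<phi> :: 'p \<Rightarrow> 'q. mono \<phi>}"] by auto
  have "hom_enumeration (sort_key (\<lambda>\<phi>. \<Sum>p\<in>UNIV. \<rho> (\<phi> p)) xs) \<rho>"
    by standard (use \<rho> xs in auto)
  then show ?thesis by blast
qed

theorem proposition4p2:
  fixes L :: "('p::{finite,order} \<times> 'q::{finite,order}, 'k::field) mpoly set" and s :: nat
  defines "L \<equiv> hom_ideal"
    and "s \<equiv> card (poset_components :: 'p set set)"
  shows "reg_quotient L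
           \<ge> int (antichain_number TYPE('q)) * (int CARD('p) - int s) + int s - 1 \<and>
         (s = 1 \<longrightarrow>
           (\<forall>k. betti_quotient L k (int (k * CARD('p)))
                  \<ge> card {A :: 'q set. antichain A \<and> card A = k}))"
proof -
  obtain hs :: "('p \<Rightarrow> 'q) list" and \<rho> where "hom_enumeration hs \<rho>"
    using hom_enumeration_exists by blast
  then interpret hom_enumeration hs \<rho> .
  have L: "gen_ideal = L" unfolding L_def by (rule gen_ideal_eq_hom_ideal)
  note pos = betti_antichains_pos[where 'k = 'k, unfolded L, folded s_def]
  let ?a = "antichain_number TYPE('q)"
  have fin: "finite {card A | A :: 'q set. antichain A}" by simp
  have "?a \<in> {card A | A :: 'q set. antichain A}"
    unfolding antichain_number_def using fin by (rule Max_in) (auto simp: antichain_def)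
  then obtain A :: "'q set" where A: "antichain A" "card A = ?a" by auto
  \<comment> \<open>Singletons are antichains, so the maximum is positive, as \<open>pos\<close>
    requires.\<close>
  have "card {undefined :: 'q} \<le> ?a"
    unfolding antichain_number_def by (rule Max_ge[OF fin]) (auto simp: antichain_def intro!: exI[of _ "{undefined}"])
  then have a: "0 < ?a" by simp
  have "0 < card {A :: 'q set. antichain A \<and> card A = ?a}"
    using A by (subst card_gt_0_iff) auto
  then have "betti_quotient L (Suc (s * (?a - 1))) (int (?a * CARD('p))) \<noteq> 0"
    using pos[OF a] by simp
  then have "int (?a * CARD('p)) - int (Suc (s * (?a - 1))) \<le> reg_quotient L"
    unfolding reg_quotient_def
    by (intro Max_ge finite_betti_shifts[where 'k = 'k, unfolded L]) blast
  \<comment> \<open>Degree minus homological degree of the classes that come from antichains of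
    maximal size.\<close>
  moreover have "int (?a * CARD('p)) - int (Suc (s * (?a - 1)))
      = int ?a * (int CARD('p) - int s) + int s - 1"
    using a by (simp add: of_nat_diff algebra_simps)
  moreover have "card {A :: 'q set. antichain A \<and> card A = k} \<le> betti_quotient L k (int (k * CARD('p)))"
    if "s = 1" for k
  proof (cases "k = 0")
    case True
    then have "{A :: 'q set. antichain A \<and> card A = k} = {{}}" by (auto simp: antichain_def)
    then show ?thesis using betti_0_0[where 'k = 'k, unfolded L] True by simp
  next
    case False
    then show ?thesis using pos[of k] that by simp
  qed
  ultimately show ?thesis by simp
qed

end
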